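(* Suppose $\tau$ is in the limit-circle case at both endpoints and $S$ is a self-adjoint restriction of $T_{\max}$. Then for each $z\in\rho(S)$ the resolvent $R_z=(S-zI)^{-1}$ is an integral operator $$R_zg(x)=\int_a^bG_z(x,y)g(y)\,r(y)dy,\quad x\in(a,b),\ g\in L^2((a,b);r(x)dx),$$ with a square integrable kernel $G_z$ (with respect to $r(x)dx\otimes r(y)dy$), that is, $R_z$ is a Hilbert–Schmidt operator. For any two given linearly independent solutions $u_1,u_2$ of $(\tau-z)u=0$ there are coefficients $m_{ij}^{\pm}(z)\in\mathbb C$, $i,j\in\{1,2\}$, such that the kernel is given by $$G_z(x,y)=\begin{cases}\sum_{i,j=1}^2m_{ij}^+(z)u_i(x)u_j(y),&y\in(a,x],\\[1mm]\sum_{i,j=1}^2m_{ij}^-(z)u_i(x)u_j(y),&y\in[x,b).\end{cases}$$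
   Context: Setting. $(a,b)\subseteq\mathbb R$ is an open interval (possibly unbounded); $p,q,r,s$ are Lebesgue measurable and real-valued a.e. on $(a,b)$, with $p^{-1},q,r,s\in L^1_{\mathrm{loc}}((a,b);dx)$, $r>0$ and $p\neq0$ a.e. For $f\in AC_{\mathrm{loc}}((a,b))$ put $f^{[1]}=p(f'+sf)$, $\mathfrak D_\tau=\{f\in AC_{\mathrm{loc}}((a,b)) : f^{[1]}\in AC_{\mathrm{loc}}((a,b))\}$, and $\tau f=\frac1r\big(-(f^{[1]})'+sf^{[1]}+qf\big)$ for $f\in\mathfrak D_\tau$; solutions of $(\tau-z)u=0$ are elements of $\mathfrak D_\tau$. In $L^2((a,b);r(x)dx)$ the maximal operator is $T_{\max}f=\tau f$, $\operatorname{dom}(T_{\max})=\{g\in L^2((a,b);r\,dx): g\in\mathfrak D_\tau,\ \tau g\in L^2((a,b);r\,dx)\}$. $\tau$ is in the limit-circle case at $a$ if for each $z\in\mathbb C$ all solutions of $(\tau-z)u=0$ lie in $L^2((a,c);r\,dx)$ for every $c\in(a,b)$; similarly at $b$, with $L^2((c,b);r\,dx)$. *)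

theory Defs
  imports "HOL-Analysis.Analysis"
begin

section \<open>Operators in the Hilbert space of square integrable functions\<close>

text \<open>
  The Hilbert space of square integrable functions over a measure \<open>M\<close> is represented by the
  functions themselves; two functions denote the same vector iff they agree almost everywhere.
  A linear operator is represented by its graph, a set of pairs of functions that is closed under
  change of representatives and is single-valued up to almost everywhere equality.
\<close>

definition L2 :: "'a measure \<Rightarrow> ('a \<Rightarrow> complex) set" where
  "L2 M = {f \<in> borel_measurable M. integrable M (\<lambda>x. (cmod (f x))\<^sup>2)}"

definition L2_inner :: "'a measure \<Rightarrow> ('a \<Rightarrow> complex) \<Rightarrow> ('a \<Rightarrow> complex) \<Rightarrow> complex" where
  "L2_inner M f g = (\<integral>x. cnj (f x) * g x \<partial>M)"

definition L2_norm :: "'a measure \<Rightarrow> ('a \<Rightarrow> complex) \<Rightarrow> real" where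
  "L2_norm M f = sqrt (\<integral>x. (cmod (f x))\<^sup>2 \<partial>M)"

type_synonym 'a graph = "(('a \<Rightarrow> complex) \<times> ('a \<Rightarrow> complex)) set"

definition L2_operator :: "'a measure \<Rightarrow> 'a graph \<Rightarrow> bool" where
  "L2_operator M T \<longleftrightarrow>
     T \<subseteq> L2 M \<times> L2 M \<and>
     (\<lambda>x. 0, \<lambda>x. 0) \<in> T \<and>
     (\<forall>f g f' g'. (f, g) \<in> T \<longrightarrow> (f', g') \<in> T \<longrightarrow> (\<lambda>x. f x + f' x, \<lambda>x. g x + g' x) \<in> T) \<and>
     (\<forall>c f g. (f, g) \<in> T \<longrightarrow> (\<lambda>x. c * f x, \<lambda>x. c * g x) \<in> T) \<and>
     (\<forall>f g. \<forall>f'\<in>L2 M. \<forall>g'\<in>L2 M. (f, g) \<in> T \<longrightarrow>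
        (AE x in M. f x = f' x) \<longrightarrow> (AE x in M. g x = g' x) \<longrightarrow> (f', g') \<in> T) \<and>
     (\<forall>f g f' g'. (f, g) \<in> T \<longrightarrow> (f', g') \<in> T \<longrightarrow>
        (AE x in M. f x = f' x) \<longrightarrow> (AE x in M. g x = g' x))"

definition L2_densely_defined :: "'a measure \<Rightarrow> 'a graph \<Rightarrow> bool" where
  "L2_densely_defined M T \<longleftrightarrow>
     (\<forall>f\<in>L2 M. \<forall>\<epsilon>>0. \<exists>h\<in>Domain T. L2_norm M (\<lambda>x. f x - h x) < \<epsilon>)"

definition L2_adjoint :: "'a measure \<Rightarrow> 'a graph \<Rightarrow> 'a graph" where
  "L2_adjoint M T =
     {(u, v). u \<in> L2 M \<and> v \<in> L2 M \<and> (\<forall>(f, g)\<in>T. L2_inner M u g = L2_inner M v f)}"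

definition L2_self_adjoint :: "'a measure \<Rightarrow> 'a graph \<Rightarrow> bool" where
  "L2_self_adjoint M T \<longleftrightarrow>
     L2_operator M T \<and> L2_densely_defined M T \<and> L2_adjoint M T = T"

definition L2_bounded_operator :: "'a measure \<Rightarrow> 'a graph \<Rightarrow> bool" where
  "L2_bounded_operator M T \<longleftrightarrow>
     L2_operator M T \<and> Domain T = L2 M \<and>
     (\<exists>C. \<forall>(f, g)\<in>T. L2_norm M g \<le> C * L2_norm M f)"

text \<open>The graph of the inverse of \<open>T - zI\<close>.\<close>

definition resolvent :: "'a graph \<Rightarrow> complex \<Rightarrow> 'a graph" where
  "resolvent T z = {(\<lambda>x. h x - z * f x, f) | f h. (f, h) \<in> T}"

definition resolvent_set :: "'a measure \<Rightarrow> 'a graph \<Rightarrow> complex set" where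
  "resolvent_set M T = {z. L2_bounded_operator M (resolvent T z)}"

definition L2_orthonormal_basis :: "'a measure \<Rightarrow> ('a \<Rightarrow> complex) set \<Rightarrow> bool" where
  "L2_orthonormal_basis M E \<longleftrightarrow>
     E \<subseteq> L2 M \<and>
     (\<forall>e\<in>E. \<forall>e'\<in>E. L2_inner M e e' = (if e = e' then 1 else 0)) \<and>
     (\<forall>f\<in>L2 M. (\<forall>e\<in>E. L2_inner M e f = 0) \<longrightarrow> (AE x in M. f x = 0))"

text \<open>The function \<open>F\<close> selects a representative of the image of each basis vector.\<close>

definition L2_hilbert_schmidt :: "'a measure \<Rightarrow> 'a graph \<Rightarrow> bool" where
  "L2_hilbert_schmidt M T \<longleftrightarrow>
     L2_bounded_operator M T \<and>
     (\<exists>E F. L2_orthonormal_basis M E \<and> (\<forall>e\<in>E. (e, F e) \<in> T) \<and>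
        (\<lambda>e. (L2_norm M (F e))\<^sup>2) summable_on E)"


section \<open>Local integrability and local absolute continuity on an open interval\<close>

definition locally_integrable :: "ereal \<Rightarrow> ereal \<Rightarrow> (real \<Rightarrow> real) \<Rightarrow> bool" where
  "locally_integrable a b f \<longleftrightarrow>
     (\<forall>c d. a < ereal c \<longrightarrow> ereal d < b \<longrightarrow> set_integrable lebesgue {c..d} f)"

definition AC :: "real \<Rightarrow> real \<Rightarrow> (real \<Rightarrow> complex) \<Rightarrow> bool" where
  "AC c d f \<longleftrightarrow>
     (\<forall>\<epsilon>>0. \<exists>\<delta>>0. \<forall>(n::nat) \<alpha> \<beta>.
        (\<forall>i<n. c \<le> \<alpha> i \<and> \<alpha> i \<le> \<beta> i \<and> \<beta> i \<le> d) \<longrightarrow>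
        disjoint_family_on (\<lambda>i. {\<alpha> i<..<\<beta> i}) {..<n} \<longrightarrow>
        (\<Sum>i<n. \<beta> i - \<alpha> i) < \<delta> \<longrightarrow>
        (\<Sum>i<n. cmod (f (\<beta> i) - f (\<alpha> i))) < \<epsilon>)"

definition AC_loc :: "ereal \<Rightarrow> ereal \<Rightarrow> (real \<Rightarrow> complex) \<Rightarrow> bool" where
  "AC_loc a b f \<longleftrightarrow> (\<forall>c d. a < ereal c \<longrightarrow> c \<le> d \<longrightarrow> ereal d < b \<longrightarrow> AC c d f)"


section \<open>The Sturm-Liouville differential expression\<close>

text \<open>
  Functions on \<open>(a, b)\<close> are total functions whose values outside \<open>(a, b)\<close> are irrelevant.
  The product \<open>p (f' + s f)\<close> is determined only almost everywhere; \<open>g\<close> is its (on \<open>(a, b)\<close>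
  unique) locally absolutely continuous representative.
\<close>

definition is_quasi_deriv ::
  "ereal \<Rightarrow> ereal \<Rightarrow> (real \<Rightarrow> real) \<Rightarrow> (real \<Rightarrow> real) \<Rightarrow> (real \<Rightarrow> complex) \<Rightarrow> (real \<Rightarrow> complex) \<Rightarrow> bool"
where
  "is_quasi_deriv a b p s f g \<longleftrightarrow>
     AC_loc a b g \<and>
     (AE x in lebesgue_on (einterval a b).
        g x = of_real (p x) * (vector_derivative f (at x) + of_real (s x) * f x))"

definition quasi_deriv ::
  "ereal \<Rightarrow> ereal \<Rightarrow> (real \<Rightarrow> real) \<Rightarrow> (real \<Rightarrow> real) \<Rightarrow> (real \<Rightarrow> complex) \<Rightarrow> real \<Rightarrow> complex" where
  "quasi_deriv a b p s f = (SOME g. is_quasi_deriv a b p s f g)"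

definition tau_domain ::
  "ereal \<Rightarrow> ereal \<Rightarrow> (real \<Rightarrow> real) \<Rightarrow> (real \<Rightarrow> real) \<Rightarrow> (real \<Rightarrow> complex) set" where
  "tau_domain a b p s = {f. AC_loc a b f \<and> (\<exists>g. is_quasi_deriv a b p s f g)}"

definition tau ::
  "ereal \<Rightarrow> ereal \<Rightarrow> (real \<Rightarrow> real) \<Rightarrow> (real \<Rightarrow> real) \<Rightarrow> (real \<Rightarrow> real) \<Rightarrow> (real \<Rightarrow> real) \<Rightarrow>
   (real \<Rightarrow> complex) \<Rightarrow> real \<Rightarrow> complex" where
  "tau a b p q r s f x =
     (let f1 = quasi_deriv a b p s f in
      (- vector_derivative f1 (at x) + of_real (s x) * f1 x + of_real (q x) * f x) / of_real (r x))"

definition tau_solution ::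
  "ereal \<Rightarrow> ereal \<Rightarrow> (real \<Rightarrow> real) \<Rightarrow> (real \<Rightarrow> real) \<Rightarrow> (real \<Rightarrow> real) \<Rightarrow> (real \<Rightarrow> real) \<Rightarrow>
   complex \<Rightarrow> (real \<Rightarrow> complex) \<Rightarrow> bool" where
  "tau_solution a b p q r s z u \<longleftrightarrow>
     u \<in> tau_domain a b p s \<and>
     (AE x in lebesgue_on (einterval a b). tau a b p q r s u x - z * u x = 0)"

definition lin_indep2_on :: "real set \<Rightarrow> (real \<Rightarrow> complex) \<Rightarrow> (real \<Rightarrow> complex) \<Rightarrow> bool" where
  "lin_indep2_on I u v \<longleftrightarrow>
     (\<forall>c d::complex. (\<forall>x\<in>I. c * u x + d * v x = 0) \<longrightarrow> c = 0 \<and> d = 0)"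

definition weighted :: "ereal \<Rightarrow> ereal \<Rightarrow> (real \<Rightarrow> real) \<Rightarrow> real measure" where
  "weighted a b r = density (lebesgue_on (einterval a b)) (\<lambda>x. ennreal (r x))"

definition T_max ::
  "ereal \<Rightarrow> ereal \<Rightarrow> (real \<Rightarrow> real) \<Rightarrow> (real \<Rightarrow> real) \<Rightarrow> (real \<Rightarrow> real) \<Rightarrow> (real \<Rightarrow> real) \<Rightarrow>
   real graph" where
  "T_max a b p q r s =
     {(f, g). f \<in> L2 (weighted a b r) \<and> g \<in> L2 (weighted a b r) \<and>
        (\<exists>h\<in>tau_domain a b p s.
           (AE x in weighted a b r. f x = h x) \<and>
           (AE x in weighted a b r. g x = tau a b p q r s h x))}"

definition limit_circle_left ::
  "ereal \<Rightarrow> ereal \<Rightarrow> (real \<Rightarrow> real) \<Rightarrow> (real \<Rightarrow> real) \<Rightarrow> (real \<Rightarrow> real) \<Rightarrow> (real \<Rightarrow> real) \<Rightarrow> bool"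
where
  "limit_circle_left a b p q r s \<longleftrightarrow>
     (\<forall>z u. tau_solution a b p q r s z u \<longrightarrow>
        (\<forall>c\<in>einterval a b. u \<in> L2 (weighted a (ereal c) r)))"

definition limit_circle_right ::
  "ereal \<Rightarrow> ereal \<Rightarrow> (real \<Rightarrow> real) \<Rightarrow> (real \<Rightarrow> real) \<Rightarrow> (real \<Rightarrow> real) \<Rightarrow> (real \<Rightarrow> real) \<Rightarrow> bool"
where
  "limit_circle_right a b p q r s \<longleftrightarrow>
     (\<forall>z u. tau_solution a b p q r s z u \<longrightarrow>
        (\<forall>c\<in>einterval a b. u \<in> L2 (weighted (ereal c) b r)))"

end

theory Submission
  imports Defs
begin

text \<open>Let \<open>u1\<close>, \<open>u2\<close> be solutions of \<open>(\<tau> - z) u = 0\<close> with Wronskian \<open>1\<close>; by the limit-circle assumption they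
  are square integrable. By variation of constants every solution of \<open>(\<tau> - z) h = g\<close> is
  \<open>u1 \<integral>\<^sub>a\<^sup>x u2 g r - u2 \<integral>\<^sub>a\<^sup>x u1 g r + A u1 + B u2\<close>, so it remains to find how \<open>A\<close> and \<open>B\<close> depend on \<open>g\<close> when
  \<open>h = R\<^sub>z g\<close>. No boundary conditions are needed for this: since \<open>S\<close> is self-adjoint and \<open>z\<close> is no eigenvalue,
  there are \<open>k\<^sub>1\<close>, \<open>k\<^sub>2\<close> in the range of the conjugate of \<open>S - cnj z\<close> whose pairings with \<open>u1\<close> and \<open>u2\<close> are
  the Kronecker delta. Moving the resolvent from \<open>g\<close> to \<open>k\<^sub>i\<close> and exchanging the order of integration
  expresses \<open>A\<close> and \<open>B\<close> as linear combinations of \<open>\<integral> u1 g r\<close> and \<open>\<integral> u2 g r\<close>. The resulting kernel is square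
  integrable because \<open>u1\<close> and \<open>u2\<close> are, and Bessel's inequality then gives the Hilbert-Schmidt property.\<close>

section \<open>Absolutely continuous functions\<close>

text \<open>\<open>tau\<close> and \<open>is_quasi_deriv\<close> use
  \<open>vector_derivative\<close>, whose value is meaningless where a function is not
  differentiable, while \<open>AC\<close> is a bare epsilon-delta condition. Elements of
  \<open>T_max\<close> therefore become solutions of a first-order system only once absolutely
  continuous functions are known to be differentiable almost everywhere and to be integrals of their
  derivatives. Both facts are obtained from Vitali coverings and gauge sums, working directly with
  increments over finitely many intervals. The pairings with \<open>u1\<close> and \<open>u2\<close>
  are bilinear, not sesquilinear. This fits because the coefficients are real: conjugation carries
  solutions for \<open>cnj z\<close> to solutions for \<open>z\<close>, so the symmetry of
  \<open>S\<close> becomes a symmetry of the bilinear pairing. What makes \<open>A\<close> and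
  \<open>B\<close> computable is that the iterated integrals produced by the resolvent and by the
  dual solution run over complementary triangles: together they fill the square and factor into
  products of single integrals.\<close>

lemma AC_E:
  assumes "AC c d f" "\<epsilon> > 0"
  obtains \<delta> where "\<delta> > 0"
    "\<And>(n::nat) \<alpha> \<beta>.
        (\<forall>i<n. c \<le> \<alpha> i \<and> \<alpha> i \<le> \<beta> i \<and> \<beta> i \<le> d) \<Longrightarrow>
        disjoint_family_on (\<lambda>i. {\<alpha> i<..<\<beta> i}) {..<n} \<Longrightarrow>
        (\<Sum>i<n. \<beta> i - \<alpha> i) < \<delta> \<Longrightarrow> (\<Sum>i<n. cmod (f (\<beta> i) - f (\<alpha> i))) < \<epsilon>"
  using assms unfolding AC_def by blast

text \<open>Gauge sums and Vitali coverings deliver finite sets of non-overlapping closed intervals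
  rather than indexed endpoints. \<open>\<D> division_of \<Union>\<D>\<close> only says that the
  members are such intervals; their endpoints are recovered as \<open>Inf\<close> and
  \<open>Sup\<close>.\<close>

lemma AC_division:
  assumes "AC c d f" "\<epsilon> > 0"
  obtains \<delta> where "\<delta> > 0"
    "\<And>\<D>. \<D> division_of \<Union>\<D> \<Longrightarrow> \<Union>\<D> \<subseteq> {c..d} \<Longrightarrow> (\<Sum>k\<in>\<D>. Sup k - Inf k) < \<delta> \<Longrightarrow>
       (\<Sum>k\<in>\<D>. cmod (f (Sup k) - f (Inf k))) < \<epsilon>"
proof -
  obtain \<delta> where "\<delta> > 0" and \<delta>: "\<And>(n::nat) \<alpha> \<beta>.
        (\<forall>i<n. c \<le> \<alpha> i \<and> \<alpha> i \<le> \<beta> i \<and> \<beta> i \<le> d) \<Longrightarrow>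
        disjoint_family_on (\<lambda>i. {\<alpha> i<..<\<beta> i}) {..<n} \<Longrightarrow>
        (\<Sum>i<n. \<beta> i - \<alpha> i) < \<delta> \<Longrightarrow> (\<Sum>i<n. cmod (f (\<beta> i) - f (\<alpha> i))) < \<epsilon>"
    by (rule AC_E[OF assms]) blast
  show thesis
  proof (rule that[OF \<open>\<delta> > 0\<close>])
    fix \<D> assume div: "\<D> division_of \<Union>\<D>" and sub: "\<Union>\<D> \<subseteq> {c..d}" and small: "(\<Sum>k\<in>\<D>. Sup k - Inf k) < \<delta>"
    have "finite \<D>" using div by auto
    then obtain h where h: "bij_betw h {..<card \<D>} \<D>"
      using ex_bij_betw_nat_finite[of \<D>] by (auto simp: atLeast0LessThan)
    have k: "k = {Inf k..Sup k} \<and> Inf k \<le> Sup k \<and> c \<le> Inf k \<and> Sup k \<le> d" if kD: "k \<in> \<D>" for k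
    proof -
      obtain u v where uv: "k = {u..v}" "k \<noteq> {}"
        using division_ofD(3,4)[OF div kD] by auto
      then have "u \<le> v" by auto
      moreover have "k \<subseteq> {c..d}" using sub kD by auto
      ultimately show ?thesis using uv by auto
    qed
    have hD: "h i \<in> \<D>" if "i < card \<D>" for i using h that by (auto simp: bij_betw_def)
    have "(\<Sum>i<card \<D>. cmod (f (Sup (h i)) - f (Inf (h i)))) < \<epsilon>"
    proof (rule \<delta>)
      show "\<forall>i<card \<D>. c \<le> Inf (h i) \<and> Inf (h i) \<le> Sup (h i) \<and> Sup (h i) \<le> d"
        using k hD by blast
      show "disjoint_family_on (\<lambda>i. {Inf (h i)<..<Sup (h i)}) {..<card \<D>}"
        unfolding disjoint_family_on_def
      proof (intro ballI impI)
        fix i j assume ij: "i \<in> {..<card \<D>}" "j \<in> {..<card \<D>}" "i \<noteq> j"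
        then have "h i \<noteq> h j" using h by (auto simp: bij_betw_def inj_on_def)
        then have "interior (h i) \<inter> interior (h j) = {}"
          using division_ofD(5)[OF div] hD ij by auto
        moreover have "interior (h i) = {Inf (h i)<..<Sup (h i)}" "interior (h j) = {Inf (h j)<..<Sup (h j)}"
          using k hD ij by (metis interior_atLeastAtMost_real lessThan_iff)+
        ultimately show "{Inf (h i)<..<Sup (h i)} \<inter> {Inf (h j)<..<Sup (h j)} = {}" by simp
      qed
      show "(\<Sum>i<card \<D>. Sup (h i) - Inf (h i)) < \<delta>"
        using sum.reindex_bij_betw[OF h, of "\<lambda>k. Sup k - Inf k"] small by simp
    qed
    also have "(\<Sum>i<card \<D>. cmod (f (Sup (h i)) - f (Inf (h i)))) = (\<Sum>k\<in>\<D>. cmod (f (Sup k) - f (Inf k)))"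
      using sum.reindex_bij_betw[OF h, of "\<lambda>k. cmod (f (Sup k) - f (Inf k))"] .
    finally show "(\<Sum>k\<in>\<D>. cmod (f (Sup k) - f (Inf k))) < \<epsilon>" .
  qed
qed

lemma AC_increment:
  assumes "AC c d f" "\<epsilon> > 0"
  obtains \<delta> where "\<delta> > 0"
    "\<And>x y. c \<le> x \<Longrightarrow> x \<le> y \<Longrightarrow> y \<le> d \<Longrightarrow> y - x < \<delta> \<Longrightarrow> cmod (f y - f x) < \<epsilon>"
proof -
  obtain \<delta> where "\<delta> > 0" and \<delta>: "\<And>(n::nat) \<alpha> \<beta>.
        (\<forall>i<n. c \<le> \<alpha> i \<and> \<alpha> i \<le> \<beta> i \<and> \<beta> i \<le> d) \<Longrightarrow>
        disjoint_family_on (\<lambda>i. {\<alpha> i<..<\<beta> i}) {..<n} \<Longrightarrow>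
        (\<Sum>i<n. \<beta> i - \<alpha> i) < \<delta> \<Longrightarrow> (\<Sum>i<n. cmod (f (\<beta> i) - f (\<alpha> i))) < \<epsilon>"
    by (rule AC_E[OF assms]) blast
  show thesis
  proof (rule that[OF \<open>\<delta> > 0\<close>])
    fix x y assume "c \<le> x" "x \<le> y" "y \<le> d" "y - x < \<delta>"
    then show "cmod (f y - f x) < \<epsilon>"
      using \<delta>[of 1 "\<lambda>_. x" "\<lambda>_. y"] by (auto simp: disjoint_family_on_def)
  qed
qed

section \<open>Continuity and algebra of absolutely continuous functions\<close>

lemma AC_imp_continuous_on:
  assumes "AC c d f" shows "continuous_on {c..d} f"
  unfolding continuous_on_iff
proof (intro ballI allI impI)
  fix x \<epsilon> :: real assume x: "x \<in> {c..d}" and "\<epsilon> > 0"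
  obtain \<delta> where "\<delta> > 0" and \<delta>: "\<And>x y. c \<le> x \<Longrightarrow> x \<le> y \<Longrightarrow> y \<le> d \<Longrightarrow> y - x < \<delta> \<Longrightarrow> cmod (f y - f x) < \<epsilon>"
    by (rule AC_increment[OF assms \<open>\<epsilon> > 0\<close>]) blast
  show "\<exists>\<delta>>0. \<forall>y\<in>{c..d}. dist y x < \<delta> \<longrightarrow> dist (f y) (f x) < \<epsilon>"
  proof (intro exI[of _ \<delta>] conjI ballI impI \<open>\<delta> > 0\<close>)
    fix y assume y: "y \<in> {c..d}" and d: "dist y x < \<delta>"
    show "dist (f y) (f x) < \<epsilon>"
    proof (cases "x \<le> y")
      case True then show ?thesis using \<delta>[of x y] x y d by (auto simp: dist_norm)
    next
      case False then show ?thesis using \<delta>[of y x] x y d by (auto simp: dist_norm norm_minus_commute)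
    qed
  qed
qed

lemma AC_subset: "AC c d f \<Longrightarrow> c \<le> c' \<Longrightarrow> d' \<le> d \<Longrightarrow> AC c' d' f"
  unfolding AC_def
proof (intro allI impI)
  fix \<epsilon> :: real
  assume *: "\<forall>\<epsilon>>0. \<exists>\<delta>>0. \<forall>(n::nat) \<alpha> \<beta>. (\<forall>i<n. c \<le> \<alpha> i \<and> \<alpha> i \<le> \<beta> i \<and> \<beta> i \<le> d) \<longrightarrow>
           disjoint_family_on (\<lambda>i. {\<alpha> i<..<\<beta> i}) {..<n} \<longrightarrow>
           (\<Sum>i<n. \<beta> i - \<alpha> i) < \<delta> \<longrightarrow> (\<Sum>i<n. cmod (f (\<beta> i) - f (\<alpha> i))) < \<epsilon>"
    and le: "c \<le> c'" "d' \<le> d" and "\<epsilon> > 0"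
  then obtain \<delta> where "\<delta> > 0" and \<delta>: "\<forall>(n::nat) \<alpha> \<beta>. (\<forall>i<n. c \<le> \<alpha> i \<and> \<alpha> i \<le> \<beta> i \<and> \<beta> i \<le> d) \<longrightarrow>
           disjoint_family_on (\<lambda>i. {\<alpha> i<..<\<beta> i}) {..<n} \<longrightarrow>
           (\<Sum>i<n. \<beta> i - \<alpha> i) < \<delta> \<longrightarrow> (\<Sum>i<n. cmod (f (\<beta> i) - f (\<alpha> i))) < \<epsilon>"
    by blast
  show "\<exists>\<delta>>0. \<forall>(n::nat) \<alpha> \<beta>. (\<forall>i<n. c' \<le> \<alpha> i \<and> \<alpha> i \<le> \<beta> i \<and> \<beta> i \<le> d') \<longrightarrow>
           disjoint_family_on (\<lambda>i. {\<alpha> i<..<\<beta> i}) {..<n} \<longrightarrow>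
           (\<Sum>i<n. \<beta> i - \<alpha> i) < \<delta> \<longrightarrow> (\<Sum>i<n. cmod (f (\<beta> i) - f (\<alpha> i))) < \<epsilon>"
  proof (intro exI[of _ \<delta>] conjI \<open>\<delta> > 0\<close> allI impI)
    fix n :: nat and \<alpha> \<beta>
    assume "\<forall>i<n. c' \<le> \<alpha> i \<and> \<alpha> i \<le> \<beta> i \<and> \<beta> i \<le> d'"
    then have "\<forall>i<n. c \<le> \<alpha> i \<and> \<alpha> i \<le> \<beta> i \<and> \<beta> i \<le> d" using le by (meson order_trans)
    moreover assume "disjoint_family_on (\<lambda>i. {\<alpha> i<..<\<beta> i}) {..<n}" "(\<Sum>i<n. \<beta> i - \<alpha> i) < \<delta>"
    ultimately show "(\<Sum>i<n. cmod (f (\<beta> i) - f (\<alpha> i))) < \<epsilon>" using \<delta> by blast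
  qed
qed

text \<open>A common source for the closure properties: increments that are linearly controlled by
  those of absolutely continuous functions inherit their \<delta>. With \<open>B = 0\<close> it
  covers conjugation, real and imaginary parts and change of sign.\<close>

lemma AC_dominated:
  assumes f: "AC c d f" and g: "AC c d g" and "A \<ge> 0" "B \<ge> 0"
    and h: "\<And>x y. c \<le> x \<Longrightarrow> x \<le> y \<Longrightarrow> y \<le> d \<Longrightarrow>
              cmod (h y - h x) \<le> A * cmod (f y - f x) + B * cmod (g y - g x)"
  shows "AC c d h"
  unfolding AC_def
proof (intro allI impI)
  fix \<epsilon> :: real assume "\<epsilon> > 0"
  \<comment> \<open>The extra 1 keeps the denominator positive for \<open>A = B = 0\<close> and
    makes the final inequality strict.\<close>
  define e where "e = \<epsilon> / (A + B + 1)"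
  have "e > 0" using \<open>\<epsilon> > 0\<close> \<open>A \<ge> 0\<close> \<open>B \<ge> 0\<close> by (simp add: e_def)
  obtain \<delta> where "\<delta> > 0" and \<delta>: "\<And>(n::nat) \<alpha> \<beta>.
        (\<forall>i<n. c \<le> \<alpha> i \<and> \<alpha> i \<le> \<beta> i \<and> \<beta> i \<le> d) \<Longrightarrow>
        disjoint_family_on (\<lambda>i. {\<alpha> i<..<\<beta> i}) {..<n} \<Longrightarrow>
        (\<Sum>i<n. \<beta> i - \<alpha> i) < \<delta> \<Longrightarrow> (\<Sum>i<n. cmod (f (\<beta> i) - f (\<alpha> i))) < e"
    by (rule AC_E[OF f \<open>e > 0\<close>]) blast
  obtain \<delta>' where "\<delta>' > 0" and \<delta>': "\<And>(n::nat) \<alpha> \<beta>.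
        (\<forall>i<n. c \<le> \<alpha> i \<and> \<alpha> i \<le> \<beta> i \<and> \<beta> i \<le> d) \<Longrightarrow>
        disjoint_family_on (\<lambda>i. {\<alpha> i<..<\<beta> i}) {..<n} \<Longrightarrow>
        (\<Sum>i<n. \<beta> i - \<alpha> i) < \<delta>' \<Longrightarrow> (\<Sum>i<n. cmod (g (\<beta> i) - g (\<alpha> i))) < e"
    by (rule AC_E[OF g \<open>e > 0\<close>]) blast
  show "\<exists>\<delta>>0. \<forall>(n::nat) \<alpha> \<beta>. (\<forall>i<n. c \<le> \<alpha> i \<and> \<alpha> i \<le> \<beta> i \<and> \<beta> i \<le> d) \<longrightarrow>
           disjoint_family_on (\<lambda>i. {\<alpha> i<..<\<beta> i}) {..<n} \<longrightarrow>
           (\<Sum>i<n. \<beta> i - \<alpha> i) < \<delta> \<longrightarrow> (\<Sum>i<n. cmod (h (\<beta> i) - h (\<alpha> i))) < \<epsilon>"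
  proof (intro exI[of _ "min \<delta> \<delta>'"] conjI allI impI)
    fix n :: nat and \<alpha> \<beta>
    assume 1: "\<forall>i<n. c \<le> \<alpha> i \<and> \<alpha> i \<le> \<beta> i \<and> \<beta> i \<le> d"
      "disjoint_family_on (\<lambda>i. {\<alpha> i<..<\<beta> i}) {..<n}" and 2: "(\<Sum>i<n. \<beta> i - \<alpha> i) < min \<delta> \<delta>'"
    have "(\<Sum>i<n. cmod (h (\<beta> i) - h (\<alpha> i))) \<le>
        (\<Sum>i<n. A * cmod (f (\<beta> i) - f (\<alpha> i)) + B * cmod (g (\<beta> i) - g (\<alpha> i)))"
      using h 1 by (intro sum_mono) auto
    also have "\<dots> = A * (\<Sum>i<n. cmod (f (\<beta> i) - f (\<alpha> i))) + B * (\<Sum>i<n. cmod (g (\<beta> i) - g (\<alpha> i)))"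
      by (simp add: sum.distrib sum_distrib_left)
    also have "\<dots> \<le> A * e + B * e"
      using \<delta>[OF 1] \<delta>'[OF 1] 2 \<open>A \<ge> 0\<close> \<open>B \<ge> 0\<close> by (intro add_mono mult_left_mono) auto
    also have "\<dots> < (A + B + 1) * e" using \<open>e > 0\<close> by (simp add: algebra_simps)
    also have "\<dots> = \<epsilon>" using \<open>A \<ge> 0\<close> \<open>B \<ge> 0\<close> by (simp add: e_def)
    finally show "(\<Sum>i<n. cmod (h (\<beta> i) - h (\<alpha> i))) < \<epsilon>" .
  qed (use \<open>\<delta> > 0\<close> \<open>\<delta>' > 0\<close> in auto)
qed

lemma AC_const: "AC c d (\<lambda>x. k)"
  unfolding AC_def by (auto intro: exI[of _ 1])

lemma AC_add: "AC c d f \<Longrightarrow> AC c d g \<Longrightarrow> AC c d (\<lambda>x. f x + g x)"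
  by (rule AC_dominated[of c d f g 1 1]) (auto intro: order_trans[OF _ norm_triangle_ineq] simp: algebra_simps)

lemma AC_cnj: "AC c d f \<Longrightarrow> AC c d (\<lambda>x. cnj (f x))"
  by (rule AC_dominated[of c d f f 1 0]) (auto simp flip: complex_cnj_diff)

lemma AC_of_real_Re: "AC c d f \<Longrightarrow> AC c d (\<lambda>x. complex_of_real (Re (f x)))"
  by (rule AC_dominated[of c d f f 1 0])
     (auto simp flip: of_real_diff minus_complex.sel simp: abs_Re_le_cmod)

lemma AC_of_real_Im: "AC c d f \<Longrightarrow> AC c d (\<lambda>x. complex_of_real (Im (f x)))"
  by (rule AC_dominated[of c d f f 1 0])
     (auto simp flip: of_real_diff minus_complex.sel simp: abs_Im_le_cmod)

lemma AC_mult: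
  assumes f: "AC c d f" and g: "AC c d g" shows "AC c d (\<lambda>x. f x * g x)"
proof -
  have "bounded (f ` {c..d})" "bounded (g ` {c..d})"
    using AC_imp_continuous_on[OF f] AC_imp_continuous_on[OF g]
    by (auto intro!: compact_imp_bounded compact_continuous_image)
  then obtain A B where A: "\<And>x. x \<in> {c..d} \<Longrightarrow> cmod (f x) \<le> A" "A > 0" and B: "\<And>x. x \<in> {c..d} \<Longrightarrow> cmod (g x) \<le> B" "B > 0"
    unfolding bounded_pos ball_simps by blast
  show ?thesis
  proof (rule AC_dominated[OF f g, of B A])
    fix x y assume xy: "c \<le> x" "x \<le> y" "y \<le> d"
    have "f y * g y - f x * g x = (f y - f x) * g y + f x * (g y - g x)" by (simp add: algebra_simps)
    also have "cmod \<dots> \<le> cmod (f y - f x) * cmod (g y) + cmod (f x) * cmod (g y - g x)"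
      using norm_triangle_ineq by (simp add: norm_mult[symmetric])
    also have "\<dots> \<le> cmod (f y - f x) * B + A * cmod (g y - g x)"
      using xy A B by (intro add_mono mult_left_mono mult_right_mono) auto
    finally show "cmod (f y * g y - f x * g x) \<le> B * cmod (f y - f x) + A * cmod (g y - g x)"
      by (simp add: mult.commute)
  qed (use A B in auto)
qed

lemma AC_cmult: "AC c d f \<Longrightarrow> AC c d (\<lambda>x. k * f x)"
  using AC_mult[OF AC_const] .

lemma AC_cong: "(\<And>x. x \<in> {c..d} \<Longrightarrow> f x = g x) \<Longrightarrow> AC c d f \<longleftrightarrow> AC c d g"
proof -
  have "AC c d g" if "\<And>x. x \<in> {c..d} \<Longrightarrow> f x = g x" "AC c d f" for f g
    by (rule AC_dominated[OF that(2,2), of 1 0]) (use that(1) in auto)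
  then show "(\<And>x. x \<in> {c..d} \<Longrightarrow> f x = g x) \<Longrightarrow> AC c d f \<longleftrightarrow> AC c d g" by metis
qed

section \<open>The fundamental theorem of calculus for absolutely continuous functions\<close>

lemma negligible_outer_open:
  fixes N :: "real set"
  assumes "negligible N" "\<delta> > 0"
  obtains U where "open U" "N \<subseteq> U" "U \<in> lmeasurable" "measure lebesgue U < \<delta>"
proof -
  have N: "N \<in> null_sets lebesgue" using assms(1) by (simp add: negligible_iff_null_sets)
  then obtain U where U: "open U" "N \<subseteq> U" "(U - N) \<in> lmeasurable" "emeasure lebesgue (U - N) < ennreal \<delta>"
    using sets_lebesgue_outer_open[of N \<delta>] assms by blast
  have "U = (U - N) \<union> N" using U by auto
  then have "U \<in> lmeasurable"
    using U(3) N by (metis fmeasurable.Un fmeasurableI_null_sets)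
  moreover have "measure lebesgue U = measure lebesgue (U - N)"
    using measure_Diff_null_set[OF _ N, of U] U by auto
  moreover have "measure lebesgue (U - N) < \<delta>"
    using U(3,4) assms(2) by (simp add: emeasure_eq_measure2 ennreal_less_iff)
  ultimately show ?thesis using U that by auto
qed

lemma sum_length_division:
  fixes \<D> :: "real set set"
  assumes "\<D> division_of S"
  shows "(\<Sum>k\<in>\<D>. Sup k - Inf k) = measure lebesgue S"
proof -
  have "(\<Sum>k\<in>\<D>. Sup k - Inf k) = (\<Sum>k\<in>\<D>. measure lebesgue k)"
  proof (rule sum.cong[OF refl])
    fix k assume "k \<in> \<D>"
    then obtain u v where "k = {u..v}" "k \<noteq> {}"
      using division_ofD(3,4)[OF assms] by (metis box_real(2))
    then show "Sup k - Inf k = measure lebesgue k" by auto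
  qed
  then show ?thesis using content_division[OF assms] by simp
qed

text \<open>The gauge integral accepts a derivative as integrand without any integrability
  hypothesis. Intervals tagged off \<open>N\<close> are compared with the differential at the tag;
  on \<open>N\<close> the integrand is replaced by 0, so only the increments of \<open>f\<close>
  remain to be estimated there.\<close>

lemma AC_has_integral:
  assumes "c \<le> d" and f: "AC c d f" and N: "negligible N"
    and g: "\<And>x. x \<in> {c..d} - N \<Longrightarrow> (f has_vector_derivative g x) (at x within {c..d})"
  shows "(g has_integral f d - f c) {c..d}"
proof -
  define g' where "g' x = (if x \<in> N then 0 else g x)" for x
  have "(g' has_integral f d - f c) {c..d}"
    unfolding has_integral_real
  proof (intro allI impI)
    fix e :: real assume "e > 0"
    \<comment> \<open>The total error off \<open>N\<close> is at most \<open>e1 * (d - c)\<close>;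
      the added 1 covers the degenerate case \<open>c = d\<close>.\<close>
    define e1 where "e1 = e / (2 * (d - c + 1))"
    have "e1 > 0" and e1: "e1 * (d - c) < e / 2"
      using \<open>e > 0\<close> \<open>c \<le> d\<close> by (auto simp: e1_def field_simps)
    obtain \<delta> where "\<delta> > 0" and \<delta>: "\<And>\<D>. \<D> division_of \<Union>\<D> \<Longrightarrow> \<Union>\<D> \<subseteq> {c..d} \<Longrightarrow> (\<Sum>k\<in>\<D>. Sup k - Inf k) < \<delta> \<Longrightarrow>
       (\<Sum>k\<in>\<D>. cmod (f (Sup k) - f (Inf k))) < e/2"
      by (rule AC_division[OF f half_gt_zero[OF \<open>e > 0\<close>]]) blast
    obtain U where U: "open U" "N \<subseteq> U" "U \<in> lmeasurable" "measure lebesgue U < \<delta>"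
      using negligible_outer_open[OF N \<open>\<delta> > 0\<close>] by blast
    have "\<forall>x. \<exists>\<rho>>0. x \<in> {c..d} - N \<longrightarrow>
         (\<forall>y\<in>{c..d}. norm (y-x) < \<rho> \<longrightarrow> norm (f y - f x - (y-x) *\<^sub>R g x) \<le> e1 * norm (y-x))"
      using g \<open>e1 > 0\<close> unfolding has_vector_derivative_def has_derivative_within_alt
      by (metis zero_less_one)
    then obtain \<rho> where \<rho>: "\<And>x. 0 < \<rho> x"
        "\<And>x y. \<lbrakk>x \<in> {c..d} - N; y \<in> {c..d}; norm (y-x) < \<rho> x\<rbrakk>
                        \<Longrightarrow> norm (f y - f x - (y-x) *\<^sub>R g x) \<le> e1 * norm (y-x)"
      by metis
    define \<gamma> where "\<gamma> x = (if x \<in> N then U else ball x (\<rho> x))" for x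
      \<comment> \<open>Intervals tagged in \<open>N\<close> have small total length, so absolute continuity controls their increments.\<close>
    have "gauge \<gamma>" using U \<rho>(1) by (auto simp: gauge_def \<gamma>_def)
    have main: "norm ((\<Sum>(x, k)\<in>\<D>. measure lborel k *\<^sub>R g' x) - (f d - f c)) < e"
      if tag: "\<D> tagged_division_of {c..d}" and fine: "\<gamma> fine \<D>" for \<D>
    proof -
      have fin: "finite \<D>" using tag by auto
      define P where "P = {(x,k)\<in>\<D>. x \<in> N}"
      define Q where "Q = {(x,k)\<in>\<D>. x \<notin> N}"
      have PQ: "\<D> = P \<union> Q" "P \<inter> Q = {}" "finite P" "finite Q"
        using fin by (auto simp: P_def Q_def intro: finite_subset[of _ \<D>])
      have el: "{Inf k, Sup k} \<subseteq> k \<and> Inf k \<le> x \<and> x \<le> Sup k \<and> c \<le> Inf k \<and> Sup k \<le> d \<and> measure lborel k = Sup k - Inf k" if "(x,k) \<in> \<D>" for x k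
      proof -
        obtain u v where uv: "k = {u..v}" using tagged_division_ofD(4)[OF tag \<open>(x,k) \<in> \<D>\<close>] by auto
        have "x \<in> k" "k \<subseteq> {c..d}" using tagged_division_ofD(2,3)[OF tag that] by auto
        then show ?thesis using uv by auto
      qed
      have "f d - f c = (\<Sum>(x,k)\<in>\<D>. f (Sup k) - f (Inf k))"
        using additive_tagged_division_1[OF \<open>c \<le> d\<close>, of \<D> f] tag by simp
      then have "norm ((\<Sum>(x, k)\<in>\<D>. measure lborel k *\<^sub>R g' x) - (f d - f c)) =
          norm (\<Sum>(x, k)\<in>\<D>. measure lborel k *\<^sub>R g' x - (f (Sup k) - f (Inf k)))"
        by (simp add: sum_subtractf split_def)
      also have "\<dots> \<le> (\<Sum>(x, k)\<in>\<D>. norm (measure lborel k *\<^sub>R g' x - (f (Sup k) - f (Inf k))))"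
        by (rule order_trans[OF norm_sum]) (simp add: split_def)
      also have "\<dots> = (\<Sum>(x, k)\<in>P. norm (measure lborel k *\<^sub>R g' x - (f (Sup k) - f (Inf k)))) +
          (\<Sum>(x, k)\<in>Q. norm (measure lborel k *\<^sub>R g' x - (f (Sup k) - f (Inf k))))"
        unfolding PQ(1) using PQ by (simp add: sum.union_disjoint)
      also have "(\<Sum>(x, k)\<in>Q. norm (measure lborel k *\<^sub>R g' x - (f (Sup k) - f (Inf k)))) \<le> (\<Sum>(x, k)\<in>Q. e1 * measure lborel k)"
      proof (intro sum_mono, clarify)
        fix x k assume "(x,k) \<in> Q"
        then have D: "(x,k) \<in> \<D>" and x: "x \<notin> N" by (auto simp: Q_def)
        have len: "measure lborel k = Sup k - Inf k" using el[OF D] by blast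
        have "k \<subseteq> \<gamma> x" using fine D unfolding fine_def by blast
        then have "k \<subseteq> ball x (\<rho> x)" using x by (simp add: \<gamma>_def)
        moreover have kk: "{Inf k, Sup k} \<subseteq> k" "Inf k \<le> x" "x \<le> Sup k" "c \<le> Inf k" "Sup k \<le> d"
          using el[OF D] by auto
        ultimately have "Inf k \<in> ball x (\<rho> x)" "Sup k \<in> ball x (\<rho> x)" by blast+
        then have b: "norm (Inf k - x) < \<rho> x" "norm (Sup k - x) < \<rho> x"
          by (simp_all add: dist_norm norm_minus_commute)
        have "norm (f (Inf k) - f x - (Inf k - x) *\<^sub>R g x) \<le> e1 * norm (Inf k - x)"
             "norm (f (Sup k) - f x - (Sup k - x) *\<^sub>R g x) \<le> e1 * norm (Sup k - x)"
          by (rule \<rho>(2)[OF _ _ b(1)] \<rho>(2)[OF _ _ b(2)]; use kk x in simp)+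
        \<comment> \<open>Straddle argument: the error over \<open>k\<close> is the difference of
          the two linearisation errors from the tag \<open>x\<close> to the endpoints of
          \<open>k\<close>, and the two distances add up to the length of \<open>k\<close>.\<close>
        moreover have "measure lborel k *\<^sub>R g' x - (f (Sup k) - f (Inf k)) =
           (f (Inf k) - f x - (Inf k - x) *\<^sub>R g x) - (f (Sup k) - f x - (Sup k - x) *\<^sub>R g x)"
          unfolding len using x by (simp add: g'_def algebra_simps)
        ultimately have "norm (measure lborel k *\<^sub>R g' x - (f (Sup k) - f (Inf k))) \<le> e1 * norm (Inf k - x) + e1 * norm (Sup k - x)"
          using norm_triangle_ineq4 by (smt (verit))
        also have "\<dots> = e1 * measure lborel k" unfolding len using kk by (simp add: algebra_simps)
        finally show "norm (measure lborel k *\<^sub>R g' x - (f (Sup k) - f (Inf k))) \<le> e1 * measure lborel k" .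
      qed
      also have "(\<Sum>(x, k)\<in>Q. e1 * measure lborel k) \<le> (\<Sum>(x, k)\<in>\<D>. e1 * measure lborel k)"
        using \<open>e1 > 0\<close> fin by (intro sum_mono2) (auto simp: Q_def)
      also have "\<dots> = e1 * (d - c)"
        using additive_content_tagged_division[of \<D> c d] tag \<open>c \<le> d\<close>
        by (simp add: split_def sum_distrib_left[symmetric])
      also have "(\<Sum>(x, k)\<in>P. norm (measure lborel k *\<^sub>R g' x - (f (Sup k) - f (Inf k)))) = (\<Sum>(x, k)\<in>P. norm (f (Sup k) - f (Inf k)))"
        by (intro sum.cong refl) (auto simp: P_def g'_def norm_minus_commute)
      also have "\<dots> < e / 2"
      proof -
        have tp: "P tagged_partial_division_of {c..d}"
          using tag tagged_partial_division_subset[of \<D> "{c..d}" P] PQ by (auto simp: tagged_division_of_def)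
        note div = partial_division_of_tagged_division[OF tp]
        note tself = tagged_partial_division_of_Union_self[OF tp]
        \<comment> \<open>An interval can occur with several tags only if its interior is empty; it
          is then a single point, where an expression with \<open>G u u = 0\<close> vanishes. So
          sums over tagged pairs and sums over intervals agree.\<close>
        have over: "(\<Sum>(x, k)\<in>P. G (Sup k) (Inf k)) = (\<Sum>k\<in>snd ` P. G (Sup k) (Inf k))"
          if G: "\<And>u. G u u = 0" for G :: "real \<Rightarrow> real \<Rightarrow> real"
        proof -
          have "(\<Sum>k\<in>snd ` P. G (Sup k) (Inf k)) = (\<Sum>p\<in>P. ((\<lambda>k. G (Sup k) (Inf k)) \<circ> snd) p)"
          proof (rule sum.reindex_nontrivial[OF PQ(3)])
            fix p q assume pq: "p \<in> P" "q \<in> P" "p \<noteq> q" "snd p = snd q"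
            obtain x y k where xyk: "p = (x,k)" "q = (y,k)" using pq(4) by (cases p, cases q) auto
            have xy: "(x,k) \<in> P" "(y,k) \<in> P" "(x,k) \<noteq> (y,k)" using pq xyk by auto
            then have "interior k = {}" using tagged_partial_division_ofD(5)[OF tp xy(1), of y k] by auto
            moreover obtain u v where uv: "k = {u..v}" using tagged_partial_division_ofD(4)[OF tp xy(1)] by auto
            moreover have "x \<in> k" using tagged_partial_division_ofD(2)[OF tp xy(1)] .
            ultimately have "u = v" by auto
            then show "G (Sup (snd p)) (Inf (snd p)) = 0" using G uv xyk by simp
          qed
          then show ?thesis by (simp add: case_prod_unfold)
        qed
        have "(\<Sum>k\<in>snd ` P. Sup k - Inf k) = measure lebesgue (\<Union> (snd ` P))"
          using sum_length_division[OF div] .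
        also have "\<dots> \<le> measure lebesgue U"
        proof (rule measure_mono_fmeasurable[OF _ _ U(3)])
          have "k \<subseteq> U" if "(x,k) \<in> P" for x k
            using fineD[OF fine, of x k] that by (simp add: P_def \<gamma>_def)
          then show "\<Union> (snd ` P) \<subseteq> U" by fastforce
          show "\<Union> (snd ` P) \<in> sets lebesgue"
            using lmeasurable_division[OF div] by (rule fmeasurableD)
        qed
        finally have lt: "(\<Sum>k\<in>snd ` P. Sup k - Inf k) < \<delta>" using U by simp
        have "(\<Sum>k\<in>snd ` P. norm (f (Sup k) - f (Inf k))) < e / 2"
        proof (rule \<delta>[OF div _ lt])
          have "k \<subseteq> {c..d}" if "(x,k) \<in> P" for x k
            using tagged_partial_division_ofD(3)[OF tp that] .
          then show "\<Union> (snd ` P) \<subseteq> {c..d}" by fastforce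
        qed
        then show ?thesis using over[of "\<lambda>u v. norm (f u - f v)"] by simp
      qed
      finally show ?thesis using e1 by simp
    qed
    show "\<exists>\<gamma>. gauge \<gamma> \<and> (\<forall>\<D>. \<D> tagged_division_of {c..d} \<and> \<gamma> fine \<D> \<longrightarrow>
              norm ((\<Sum>(x, k)\<in>\<D>. measure lborel k *\<^sub>R g' x) - (f d - f c)) < e)"
    proof (intro exI conjI allI impI)
      show "gauge \<gamma>" by fact
    qed (elim conjE, rule main)
  qed
  then show ?thesis
    by (rule has_integral_spike[OF N, rotated]) (auto simp: g'_def)
qed

text \<open>Absolute continuity of the integral by truncation: cutting \<open>h\<close> off at
  height \<open>m\<close> loses less than \<epsilon>/2 in total, and the truncated part contributes
  at most \<open>m\<close> times the total length of the intervals.\<close>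

lemma AC_of_integral_bound:
  fixes h :: "real \<Rightarrow> real"
  assumes h: "h absolutely_integrable_on {c..d}" and h0: "\<And>x. h x \<ge> 0"
    and F: "\<And>x y. c \<le> x \<Longrightarrow> x \<le> y \<Longrightarrow> y \<le> d \<Longrightarrow> cmod (F y - F x) \<le> integral {x..y} h"
  shows "AC c d F"
  unfolding AC_def
proof (intro allI impI)
  fix \<epsilon> :: real assume "\<epsilon> > 0"
  define H where "H x = indicator {c..d} x * h x" for x :: real
  have H: "integrable lebesgue H" using h unfolding set_integrable_def H_def by simp
  have H0: "H x \<ge> 0" for x using h0 by (auto simp: H_def indicator_def)
  have "(\<lambda>n. \<integral>x. H x - min (H x) (real n) \<partial>lebesgue) \<longlonglongrightarrow> (\<integral>x. 0 \<partial>(lebesgue::real measure))"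
  proof (rule integral_dominated_convergence[where w=H])
    show "AE x in lebesgue. (\<lambda>n. H x - min (H x) (real n)) \<longlonglongrightarrow> 0"
    proof (rule AE_I2)
      fix x
      obtain m where "H x \<le> real m" using real_arch_simple by blast
      then have "\<forall>\<^sub>F n in sequentially. H x - min (H x) (real n) = 0"
        by (intro eventually_sequentiallyI[of m]) auto
      then show "(\<lambda>n. H x - min (H x) (real n)) \<longlonglongrightarrow> 0" by (rule tendsto_eventually)
    qed
    show "AE x in lebesgue. norm (H x - min (H x) (real n)) \<le> H x" for n
      using H0 by (intro AE_I2) (auto simp: min_def)
  qed (use H in auto)
  then have "\<forall>\<^sub>F n in sequentially. (\<integral>x. H x - min (H x) (real n) \<partial>lebesgue) < \<epsilon>/2"
    using \<open>\<epsilon> > 0\<close> by (intro order_tendstoD(2)[where y=0]) auto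
  then obtain m :: nat where m: "(\<integral>x. H x - min (H x) (real m) \<partial>lebesgue) < \<epsilon>/2"
    using eventually_sequentially by auto
  show "\<exists>\<delta>>0. \<forall>(n::nat) \<alpha> \<beta>. (\<forall>i<n. c \<le> \<alpha> i \<and> \<alpha> i \<le> \<beta> i \<and> \<beta> i \<le> d) \<longrightarrow>
           disjoint_family_on (\<lambda>i. {\<alpha> i<..<\<beta> i}) {..<n} \<longrightarrow>
           (\<Sum>i<n. \<beta> i - \<alpha> i) < \<delta> \<longrightarrow> (\<Sum>i<n. cmod (F (\<beta> i) - F (\<alpha> i))) < \<epsilon>"
  proof (intro exI[of _ "\<epsilon> / (2 * (real m + 1))"] conjI allI impI)
    \<comment> \<open>The denominator has \<open>m + 1\<close> in place of \<open>m\<close> because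
      the truncation height may be 0.\<close>
    show "\<epsilon> / (2 * (real m + 1)) > 0" using \<open>\<epsilon> > 0\<close> by simp
    fix n :: nat and \<alpha> \<beta> :: "nat \<Rightarrow> real"
    assume ab: "\<forall>i<n. c \<le> \<alpha> i \<and> \<alpha> i \<le> \<beta> i \<and> \<beta> i \<le> d"
      and dj: "disjoint_family_on (\<lambda>i. {\<alpha> i<..<\<beta> i}) {..<n}"
      and small: "(\<Sum>i<n. \<beta> i - \<alpha> i) < \<epsilon> / (2 * (real m + 1))"
    define I :: "nat \<Rightarrow> real \<Rightarrow> real" where "I i x = indicator {\<alpha> i<..<\<beta> i} x" for i x
    have intI: "integrable lebesgue (\<lambda>x. I i x * g x)" if "integrable lebesgue g" for i and g :: "real \<Rightarrow> real"
      unfolding I_def using integrable_mult_indicator[of "{\<alpha> i<..<\<beta> i}" lebesgue g] that by auto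
    have int1: "integrable lebesgue (\<lambda>x. I i x)" for i
      unfolding I_def using lmeasurable_box[of "\<alpha> i" "\<beta> i"] by (auto simp: fmeasurable_def)
    have "(\<Sum>i<n. cmod (F (\<beta> i) - F (\<alpha> i))) \<le> (\<Sum>i<n. \<integral>x. I i x * H x \<partial>lebesgue)"
    proof (rule sum_mono)
      fix i assume "i \<in> {..<n}"
      then have i: "c \<le> \<alpha> i" "\<alpha> i \<le> \<beta> i" "\<beta> i \<le> d" using ab by auto
      have "cmod (F (\<beta> i) - F (\<alpha> i)) \<le> integral {\<alpha> i..\<beta> i} h" using F i by auto
      \<comment> \<open>Only the open intervals are disjoint, so only their indicators sum to at
        most 1 everywhere; dropping the endpoints does not change the integral.\<close>
      also have "\<dots> = integral {\<alpha> i<..<\<beta> i} h"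
        using integral_open_interval_real by metis
      also have "\<dots> = (LINT x:{\<alpha> i<..<\<beta> i}|lebesgue. h x)"
      proof (rule set_lebesgue_integral_eq_integral(2)[symmetric])
        show "set_integrable lebesgue {\<alpha> i<..<\<beta> i} h"
          by (rule set_integrable_subset[OF h]) (use i in auto)
      qed
      also have "\<dots> = (\<integral>x. I i x * H x \<partial>lebesgue)"
        unfolding set_lebesgue_integral_def I_def H_def using i
        by (intro Bochner_Integration.integral_cong) (auto simp: indicator_def)
      finally show "cmod (F (\<beta> i) - F (\<alpha> i)) \<le> (\<integral>x. I i x * H x \<partial>lebesgue)" .
    qed
    also have "\<dots> = (\<integral>x. (\<Sum>i<n. I i x * H x) \<partial>lebesgue)"
      using intI[OF H] by (simp add: Bochner_Integration.integral_sum)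
    also have "\<dots> \<le> (\<integral>x. (H x - min (H x) (real m)) + real m * (\<Sum>i<n. I i x) \<partial>lebesgue)"
    proof (rule integral_mono)
      show "integrable lebesgue (\<lambda>x. \<Sum>i<n. I i x * H x)" using intI[OF H] by auto
      show "integrable lebesgue (\<lambda>x. H x - min (H x) (real m) + real m * (\<Sum>i<n. I i x))"
      proof (intro Bochner_Integration.integrable_add Bochner_Integration.integrable_diff H integrable_mult_right)
        show "integrable lebesgue (\<lambda>x. min (H x) (real m))"
          by (rule Bochner_Integration.integrable_bound[OF H]) (use H H0 in auto)
      qed (use int1 in auto)
      fix x :: real
      have le1: "(\<Sum>i<n. I i x) \<le> 1"
      proof -
        have "(\<Sum>i<n. I i x) = card {i\<in>{..<n}. x \<in> {\<alpha> i<..<\<beta> i}}"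
          by (simp add: I_def indicator_def sum.If_cases Int_def)
        also have "card {i\<in>{..<n}. x \<in> {\<alpha> i<..<\<beta> i}} \<le> 1"
        proof -
          have "i = j" if "i < n" "j < n" "x \<in> {\<alpha> i<..<\<beta> i}" "x \<in> {\<alpha> j<..<\<beta> j}" for i j
            using dj that unfolding disjoint_family_on_def by (metis Int_iff empty_iff lessThan_iff)
          then show ?thesis by (simp add: card_le_Suc0_iff_eq)
        qed
        finally show ?thesis by simp
      qed
      have "(\<Sum>i<n. I i x * H x) = (\<Sum>i<n. I i x) * H x" by (simp add: sum_distrib_right)
      also have "\<dots> = (\<Sum>i<n. I i x) * (H x - min (H x) (real m)) + (\<Sum>i<n. I i x) * min (H x) (real m)"
        by (simp add: algebra_simps)
      also have "\<dots> \<le> 1 * (H x - min (H x) (real m)) + (\<Sum>i<n. I i x) * real m"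
        using le1 by (intro add_mono mult_right_mono mult_left_mono sum_nonneg) (auto simp: I_def)
      finally show "(\<Sum>i<n. I i x * H x) \<le> (H x - min (H x) (real m)) + real m * (\<Sum>i<n. I i x)"
        by (simp add: mult.commute)
    qed
    also have "\<dots> = (\<integral>x. H x - min (H x) (real m) \<partial>lebesgue) + real m * (\<Sum>i<n. \<beta> i - \<alpha> i)"
    proof -
      have 1: "integrable lebesgue (\<lambda>x. H x - min (H x) (real m))"
          by (rule Bochner_Integration.integrable_bound[OF H]) (use H H0 in \<open>auto simp: min_def\<close>)
      have "(\<integral>x. (\<Sum>i<n. I i x) \<partial>lebesgue) = (\<Sum>i<n. \<beta> i - \<alpha> i)"
        using ab int1 by (simp add: Bochner_Integration.integral_sum I_def)
      then show ?thesis using 1 int1 by (simp add: Bochner_Integration.integral_add)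
    qed
    also have "\<dots> < \<epsilon>/2 + \<epsilon>/2"
    proof (rule add_less_le_mono[OF m])
      have "(\<Sum>i<n. \<beta> i - \<alpha> i) \<ge> 0" using ab by (intro sum_nonneg) auto
      then have "real m * (\<Sum>i<n. \<beta> i - \<alpha> i) \<le> (real m + 1) * (\<Sum>i<n. \<beta> i - \<alpha> i)"
        by (simp add: algebra_simps)
      also have "\<dots> \<le> \<epsilon>/2" using small by (simp add: field_simps)
      finally show "real m * (\<Sum>i<n. \<beta> i - \<alpha> i) \<le> \<epsilon>/2" .
    qed
    finally show "(\<Sum>i<n. cmod (F (\<beta> i) - F (\<alpha> i))) < \<epsilon>" by simp
  qed
qed

text \<open>Lebesgue's differentiation theorem from the Henstock lemma: a point of
  \<open>E \<epsilon>\<close> is an endpoint of arbitrarily short intervals on which the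
  linearisation error exceeds \<epsilon> times the length. Disjoint intervals of this kind form a
  fine tagged family, so the Henstock lemma bounds their total length by \<open>e\<close>, and
  Vitali's theorem lets them cover almost all of \<open>E \<epsilon>\<close>.\<close>

lemma indefinite_integral_has_vector_derivative_AE:
  fixes f :: "real \<Rightarrow> 'a::euclidean_space"
  assumes f: "f integrable_on {c..d}"
  shows "negligible {x\<in>{c<..<d}. \<not> ((\<lambda>y. integral {c..y} f) has_vector_derivative f x) (at x)}"
proof -
  define F where "F y = integral {c..y} f" for y
  define E where "E \<epsilon> = {x\<in>{c<..<d}. \<forall>\<eta>>0. \<exists>y. y \<noteq> x \<and> \<bar>y - x\<bar> < \<eta> \<and>
      norm (F y - F x - (y - x) *\<^sub>R f x) > \<epsilon> * \<bar>y - x\<bar>}" for \<epsilon>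
  have incr: "integral {x..y} f = F y - F x" if "c \<le> x" "x \<le> y" "y \<le> d" for x y
    unfolding F_def using that f Henstock_Kurzweil_Integration.integral_combine[of c x y f]
      integrable_subinterval_real[of f c d c y] by (simp add: algebra_simps)
  have negE: "negligible (E \<epsilon>)" if "\<epsilon> > 0" for \<epsilon>
    unfolding negligible_outer_le
  proof (intro allI impI)
    fix e :: real assume "e > 0"
    \<comment> \<open>The total error below \<open>\<epsilon> * e\<close> is divided by \<epsilon>
      at the end, which leaves a total length of at most \<open>e\<close>.\<close>
    obtain \<gamma> where "gauge \<gamma>" and \<gamma>: "\<And>p. \<lbrakk>p tagged_partial_division_of (cbox c d); \<gamma> fine p\<rbrakk> \<Longrightarrow>
             sum (\<lambda>(x,k). norm(measure lborel k *\<^sub>R f x - integral k f)) p < \<epsilon> * e"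
      using Henstock_lemma[of f c d "\<epsilon> * e"] f \<open>\<epsilon> > 0\<close> \<open>e > 0\<close> by auto
    \<comment> \<open>Candidates for the covering: \<open>x\<close> is the tag and \<open>y\<close>
      the other endpoint, on either side of it, hence \<open>min\<close> and \<open>max\<close>.
      Containment in \<open>\<gamma> x\<close> makes the tagged interval fine.\<close>
    define K where "K = {(x,y). x \<in> {c<..<d} \<and> y \<noteq> x \<and> {min x y..max x y} \<subseteq> \<gamma> x \<inter> {c..d} \<and>
         norm (F y - F x - (y - x) *\<^sub>R f x) > \<epsilon> * \<bar>y - x\<bar>}"
    define a where "a = (\<lambda>(x,y). (x + y) / 2 :: real)"
    define r where "r = (\<lambda>(x,y). \<bar>y - x\<bar> / 2 :: real)"
    have cb: "cball (a (x,y)) (r (x,y)) = {min x y..max x y}" for x y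
      by (auto simp: a_def r_def cball_eq_atLeastAtMost min_def max_def field_simps)
    obtain C where C: "countable C" "C \<subseteq> K"
      "pairwise (\<lambda>i j. disjnt (cball (a i) (r i)) (cball (a j) (r j))) C"
      "negligible (E \<epsilon> - (\<Union>i\<in>C. cball (a i) (r i)))"
    proof (rule Vitali_covering_theorem_cballs[of K r "E \<epsilon>" a])
      show "0 < r i" if "i \<in> K" for i using that by (auto simp: K_def r_def)
      fix x \<rho> :: real assume x: "x \<in> E \<epsilon>" and "\<rho> > 0"
      have "open (\<gamma> x \<inter> {c<..<d})" "x \<in> \<gamma> x \<inter> {c<..<d}"
        using \<open>gauge \<gamma>\<close> x by (auto simp: gauge_def E_def)
      then obtain \<eta> where \<eta>: "\<eta> > 0" "cball x \<eta> \<subseteq> \<gamma> x \<inter> {c<..<d}"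
        unfolding open_contains_cball by blast
      then obtain y where y: "y \<noteq> x" "\<bar>y - x\<bar> < min \<eta> \<rho>" "norm (F y - F x - (y - x) *\<^sub>R f x) > \<epsilon> * \<bar>y - x\<bar>"
        using x \<open>\<rho> > 0\<close> unfolding E_def by (auto dest!: spec[of _ "min \<eta> \<rho>"])
      have "{min x y..max x y} \<subseteq> cball x \<eta>" using y by (auto simp: cball_eq_atLeastAtMost)
      then have "{min x y..max x y} \<subseteq> \<gamma> x \<inter> {c..d}"
        using \<eta>(2) greaterThanLessThan_subseteq_atLeastAtMost_iff[of c d c d] by (meson Int_mono order_refl order_trans)
      moreover have "x \<in> {c<..<d}" using x by (simp add: E_def)
      ultimately have "(x,y) \<in> K" using y unfolding K_def by blast
      moreover have "x \<in> cball (a (x,y)) (r (x,y))" by (simp add: cb)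
      moreover have "r (x,y) < \<rho>" using y \<open>\<rho> > 0\<close> by (simp add: r_def)
      ultimately show "\<exists>i. i \<in> K \<and> x \<in> cball (a i) (r i) \<and> r i < \<rho>" by blast
    qed
    define T where "T = (\<Union>i\<in>C. cball (a i) (r i)) \<union> (E \<epsilon> - (\<Union>i\<in>C. cball (a i) (r i)))"
    have fin: "measure lebesgue (\<Union>i\<in>B. cball (a i) (r i)) \<le> e" if B: "finite B" "B \<subseteq> C" for B
    proof -
      define p where "p = (\<lambda>(x,y). (x, {min x y..max x y})) ` B"
      \<comment> \<open>Members of \<open>C\<close> have disjoint intervals, so distinct pairs never
        give the same tagged interval and a sum over \<open>p\<close> can be read as a sum over
        \<open>B\<close>.\<close>
      have inj: "inj_on (\<lambda>(x,y). (x, {min x y..max x y})) B"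
      proof (rule inj_onI)
        fix p q assume pq: "p \<in> B" "q \<in> B"
          and "(case p of (x,y) \<Rightarrow> (x, {min x y..max x y})) = (case q of (x,y) \<Rightarrow> (x, {min x y..max x y}))"
        then obtain x y y' where xy: "p = (x,y)" "q = (x,y')" and eq: "{min x y..max x y} = {min x y'..max x y'}"
          by (cases p, cases q) auto
        have "disjnt {min x y..max x y} {min x y'..max x y'}" if "p \<noteq> q"
          using C(3) pq that B(2) unfolding pairwise_def xy by (metis cb subsetD)
        moreover have "\<not> disjnt {min x y..max x y} {min x y'..max x y'}"
          unfolding eq by (simp add: disjnt_def)
        ultimately show "p = q" by blast
      qed
      have BK: "x \<in> {c<..<d}" "y \<noteq> x" "{min x y..max x y} \<subseteq> \<gamma> x" "{min x y..max x y} \<subseteq> {c..d}"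
         "norm (F y - F x - (y - x) *\<^sub>R f x) > \<epsilon> * \<bar>y - x\<bar>" if "(x,y) \<in> B" for x y
        using that B C by (auto simp: K_def)
      have "p tagged_partial_division_of (cbox c d)"
        unfolding tagged_partial_division_of_def
      proof (intro conjI allI impI)
        show "finite p" using B by (simp add: p_def)
        fix x k assume "(x,k) \<in> p"
        then obtain y where y: "(x,y) \<in> B" "k = {min x y..max x y}" by (auto simp: p_def)
        show "x \<in> k" "k \<subseteq> cbox c d" using y BK[OF y(1)] by auto
        show "\<exists>a b. k = cbox a b" using y by auto
      next
        fix x1 k1 x2 k2 assume *: "(x1,k1) \<in> p \<and> (x2,k2) \<in> p \<and> (x1,k1) \<noteq> (x2,k2)"
        then obtain y1 y2 where y: "(x1,y1) \<in> B" "k1 = {min x1 y1..max x1 y1}" "(x2,y2) \<in> B" "k2 = {min x2 y2..max x2 y2}"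
          by (auto simp: p_def)
        then have "(x1,y1) \<noteq> (x2,y2)" using * by auto
        then have "disjnt k1 k2" using C(3) y B(2) unfolding pairwise_def by (metis cb subsetD)
        then show "interior k1 \<inter> interior k2 = {}"
          using interior_subset[of k1] interior_subset[of k2] by (auto simp: disjnt_def)
      qed
      moreover have "\<gamma> fine p"
      proof (rule fineI)
        fix x k assume "(x,k) \<in> p"
        then obtain y where "(x,y) \<in> B" "k = {min x y..max x y}" by (auto simp: p_def)
        then show "k \<subseteq> \<gamma> x" using BK(3) by simp
      qed
      ultimately have less: "sum (\<lambda>(x,k). norm(measure lborel k *\<^sub>R f x - integral k f)) p < \<epsilon> * e"
        using \<gamma> by blast
      have "measure lebesgue (\<Union>i\<in>B. cball (a i) (r i)) \<le> (\<Sum>i\<in>B. measure lebesgue (cball (a i) (r i)))"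
        by (intro measure_UNION_le B) auto
      also have "\<dots> = (\<Sum>(x,y)\<in>B. \<bar>y - x\<bar>)"
        by (intro sum.cong refl) (auto simp: cb)
      also have "\<epsilon> * \<dots> \<le> (\<Sum>(x,y)\<in>B. norm (measure lborel {min x y..max x y} *\<^sub>R f x - integral {min x y..max x y} f))"
        unfolding sum_distrib_left
      proof (intro sum_mono, clarify)
        fix x y assume xy: "(x,y) \<in> B"
        show "\<epsilon> * \<bar>y - x\<bar> \<le> norm (measure lborel {min x y..max x y} *\<^sub>R f x - integral {min x y..max x y} f)"
        proof (cases "x \<le> y")
          case True
          then show ?thesis using BK[OF xy] incr[of x y] by (simp add: min_def max_def norm_minus_commute)
        next
          case False
          then have "norm (measure lborel {min x y..max x y} *\<^sub>R f x - integral {min x y..max x y} f)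
            = norm ((x - y) *\<^sub>R f x - (F x - F y))"
            using BK[OF xy] incr[of y x] by (simp add: min_def max_def)
          also have "(x - y) *\<^sub>R f x - (F x - F y) = F y - F x - (y - x) *\<^sub>R f x" by (simp add: algebra_simps)
          finally show ?thesis using BK[OF xy] by simp
        qed
      qed
      also have "\<dots> = sum (\<lambda>(x,k). norm(measure lborel k *\<^sub>R f x - integral k f)) p"
        unfolding p_def by (subst sum.reindex[OF inj]) (simp add: case_prod_unfold)
      also note less
      finally show ?thesis using \<open>\<epsilon> > 0\<close> by (simp add: mult_less_cancel_left_pos)
    qed
    have m: "(\<Union>i\<in>C. cball (a i) (r i)) \<in> lmeasurable \<and> measure lebesgue (\<Union>i\<in>C. cball (a i) (r i)) \<le> e"
    proof
      show "(\<Union>i\<in>C. cball (a i) (r i)) \<in> lmeasurable"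
        by (rule fmeasurable_UN_bound[OF C(1) _ fin]) auto
      show "measure lebesgue (\<Union>i\<in>C. cball (a i) (r i)) \<le> e"
        by (rule measure_UN_bound[OF C(1) _ fin]) auto
    qed
    have "T \<in> lmeasurable \<and> measure lebesgue T = measure lebesgue (\<Union>i\<in>C. cball (a i) (r i))"
    proof -
      have null: "E \<epsilon> - (\<Union>i\<in>C. cball (a i) (r i)) \<in> null_sets lebesgue"
        using C(4) by (simp add: negligible_iff_null_sets)
      show ?thesis
      proof
        show "T \<in> lmeasurable"
          unfolding T_def by (rule fmeasurable.Un[OF conjunct1[OF m] fmeasurableI_null_sets[OF null]])
        show "measure lebesgue T = measure lebesgue (\<Union>i\<in>C. cball (a i) (r i))"
          unfolding T_def by (rule measure_Un_null_set[OF fmeasurableD[OF conjunct1[OF m]] null])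
      qed
    qed
    with m show "\<exists>T. E \<epsilon> \<subseteq> T \<and> T \<in> lmeasurable \<and> measure lebesgue T \<le> e"
      by (intro exI[of _ T] conjI) (simp_all add: T_def)
  qed
  have "negligible (\<Union>n. E (1 / real (Suc n)))"
    by (intro negligible_countable_Union) (auto intro: negE)
  moreover have "{x\<in>{c<..<d}. \<not> (F has_vector_derivative f x) (at x)} \<subseteq> (\<Union>n. E (1 / real (Suc n)))"
  proof (rule subsetI, rule ccontr)
    fix x assume "x \<in> {x\<in>{c<..<d}. \<not> (F has_vector_derivative f x) (at x)}"
    then have x: "x \<in> {c<..<d}" and nd: "\<not> (F has_vector_derivative f x) (at x)" by auto
    assume nE: "x \<notin> (\<Union>n. E (1 / real (Suc n)))"
    have "(F has_vector_derivative f x) (at x)"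
      unfolding has_vector_derivative_def has_derivative_at_alt
    proof (intro conjI allI impI bounded_linear_scaleR_left)
      fix e :: real assume "e > 0"
      then obtain n where n: "1 / real (Suc n) < e" using nat_approx_posE by blast
      from nE have "x \<notin> E (1 / real (Suc n))" by blast
      then obtain \<eta> where "\<eta> > 0" and \<eta>: "\<forall>y. y = x \<or> \<eta> \<le> \<bar>y - x\<bar> \<or> norm (F y - F x - (y - x) *\<^sub>R f x) \<le> 1 / real (Suc n) * \<bar>y - x\<bar>"
        using x by (auto simp: E_def not_less simp del: of_nat_Suc)
      show "\<exists>d>0. \<forall>y. norm (y - x) < d \<longrightarrow> norm (F y - F x - (y - x) *\<^sub>R f x) \<le> e * norm (y - x)"
      proof (intro exI[of _ \<eta>] conjI allI impI \<open>\<eta> > 0\<close>)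
        fix y assume "norm (y - x) < \<eta>"
        then have "norm (F y - F x - (y - x) *\<^sub>R f x) \<le> 1 / real (Suc n) * \<bar>y - x\<bar>"
          using \<eta>[rule_format, of y] by (cases "y = x") (auto simp del: of_nat_Suc)
        also have "\<dots> \<le> e * \<bar>y - x\<bar>" using n by (intro mult_right_mono) auto
        finally show "norm (F y - F x - (y - x) *\<^sub>R f x) \<le> e * norm (y - x)" by simp
      qed
    qed
    with nd show False by contradiction
  qed
  ultimately show ?thesis unfolding F_def by (rule negligible_subset)
qed

section \<open>Differentiability almost everywhere of absolutely continuous functions\<close>

text \<open>Vitali's theorem covers \<open>E\<close> up to a null set by countably many disjoint
  closed balls, read here as intervals about their midpoints. If every finite subfamily had measure
  at most \<open>measure lebesgue E - \<theta>\<close>, the bound would pass to the countable union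
  and contradict this.\<close>

lemma Vitali_finite_intervals:
  fixes Q :: "real \<Rightarrow> real \<Rightarrow> bool"
  assumes "open U" "E \<subseteq> U" "E \<in> lmeasurable" "\<theta> > 0"
    and Q: "\<And>x \<eta>. x \<in> E \<Longrightarrow> \<eta> > 0 \<Longrightarrow> \<exists>u v. u < v \<and> u \<le> x \<and> x \<le> v \<and> v - u < \<eta> \<and> Q u v"
  obtains \<J> where "finite \<J>" "pairwise disjnt \<J>"
    "\<forall>k\<in>\<J>. \<exists>u v. u < v \<and> k = {u..v} \<and> k \<subseteq> U \<and> Q u v"
    "measure lebesgue E - \<theta> < measure lebesgue (\<Union>\<J>)"
proof -
  define K where "K = {(u,v). u < v \<and> {u..v} \<subseteq> U \<and> Q u v}"
  define a where "a = (\<lambda>(x,y). (x + y) / 2 :: real)"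
  define r where "r = (\<lambda>(x,y). (y - x) / 2 :: real)"
  have cb: "cball (a (x,y)) (r (x,y)) = {x..y}" for x y
    by (auto simp: a_def r_def cball_eq_atLeastAtMost field_simps)
  obtain C where C: "countable C" "C \<subseteq> K"
    "pairwise (\<lambda>i j. disjnt (cball (a i) (r i)) (cball (a j) (r j))) C"
    "negligible (E - (\<Union>i\<in>C. cball (a i) (r i)))"
  proof (rule Vitali_covering_theorem_cballs[of K r "E" a])
    show "0 < r i" if "i \<in> K" for i using that by (auto simp: K_def r_def)
    fix x \<rho> :: real assume x: "x \<in> E" and "\<rho> > 0"
    obtain \<eta> where \<eta>: "\<eta> > 0" "cball x \<eta> \<subseteq> U"
      using \<open>open U\<close> \<open>E \<subseteq> U\<close> x unfolding open_contains_cball by blast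
    obtain u v where uv: "u < v" "u \<le> x" "x \<le> v" "v - u < min \<eta> \<rho>" "Q u v"
      using Q[OF x, of "min \<eta> \<rho>"] \<eta>(1) \<open>\<rho> > 0\<close> by auto
    have "{u..v} \<subseteq> cball x \<eta>" using uv by (auto simp: cball_eq_atLeastAtMost)
    then have "{u..v} \<subseteq> U" using \<eta>(2) by blast
    then have "(u,v) \<in> K" using uv by (simp add: K_def)
    moreover have "x \<in> cball (a (u,v)) (r (u,v))" using uv by (simp add: cb)
    moreover have "r (u,v) < \<rho>" using uv \<open>\<rho> > 0\<close> by (simp add: r_def)
    ultimately show "\<exists>i. i \<in> K \<and> x \<in> cball (a i) (r i) \<and> r i < \<rho>" by blast
  qed
  have "\<exists>B. B \<subseteq> C \<and> finite B \<and> measure lebesgue E - \<theta> < measure lebesgue (\<Union>i\<in>B. cball (a i) (r i))"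
  proof (rule ccontr)
    assume nex: "\<not> ?thesis"
    have bnd: "measure lebesgue (\<Union>i\<in>B. cball (a i) (r i)) \<le> measure lebesgue E - \<theta>" if "B \<subseteq> C" "finite B" for B
    proof (rule ccontr)
      assume "\<not> ?thesis"
      then have "B \<subseteq> C \<and> finite B \<and> measure lebesgue E - \<theta> < measure lebesgue (\<Union>i\<in>B. cball (a i) (r i))"
        using that by simp
      then show False by (rule notE[OF nex exI])
    qed
    have lm: "(\<Union>i\<in>C. cball (a i) (r i)) \<in> lmeasurable"
      by (rule fmeasurable_UN_bound[OF C(1) _ bnd]) simp_all
    have le: "measure lebesgue (\<Union>i\<in>C. cball (a i) (r i)) \<le> measure lebesgue E - \<theta>"
      by (rule measure_UN_bound[OF C(1) _ bnd]) simp_all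
    have null: "E - (\<Union>i\<in>C. cball (a i) (r i)) \<in> null_sets lebesgue"
      using C(4) by (simp add: negligible_iff_null_sets)
    have "measure lebesgue E \<le> measure lebesgue ((\<Union>i\<in>C. cball (a i) (r i)) \<union> (E - (\<Union>i\<in>C. cball (a i) (r i))))"
      by (rule measure_mono_fmeasurable[OF _ fmeasurableD[OF assms(3)] fmeasurable.Un[OF lm fmeasurableI_null_sets[OF null]]]) blast
    also have "\<dots> = measure lebesgue (\<Union>i\<in>C. cball (a i) (r i))"
      by (rule measure_Un_null_set[OF fmeasurableD[OF lm] null])
    finally show False using le \<open>\<theta> > 0\<close> by simp
  qed
  then obtain B where B: "B \<subseteq> C" "finite B" "measure lebesgue E - \<theta> < measure lebesgue (\<Union>i\<in>B. cball (a i) (r i))"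
    by (elim exE conjE) (rule that)
  show thesis
  proof (rule that[of "(\<lambda>i. cball (a i) (r i)) ` B"])
    show "pairwise disjnt ((\<lambda>i. cball (a i) (r i)) ` B)"
      by (intro pairwise_imageI pairwiseD[OF C(3)]) (use B(1) in auto)
    show "\<forall>k\<in>(\<lambda>i. cball (a i) (r i)) ` B. \<exists>u v. u < v \<and> k = {u..v} \<and> k \<subseteq> U \<and> Q u v"
    proof
      fix k assume "k \<in> (\<lambda>i. cball (a i) (r i)) ` B"
      then obtain u v where "(u,v) \<in> B" "k = {u..v}" by (auto simp: cb)
      then show "\<exists>u v. u < v \<and> k = {u..v} \<and> k \<subseteq> U \<and> Q u v"
        using B(1) C(2) unfolding K_def by blast
    qed
  qed (use B in auto)
qed

lemma division_of_disjoint_intervals: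
  fixes \<J> :: "real set set"
  assumes "finite \<J>" "pairwise disjnt \<J>" "\<And>k. k \<in> \<J> \<Longrightarrow> \<exists>u v. u < v \<and> k = {u..v}"
  shows "\<J> division_of \<Union>\<J>"
  unfolding division_of_def
proof (intro conjI ballI impI)
  fix k1 k2 assume "k1 \<in> \<J>" "k2 \<in> \<J>" "k1 \<noteq> k2"
  then have "k1 \<inter> k2 = {}" using assms(2) by (auto simp: pairwise_def disjnt_def)
  then show "interior k1 \<inter> interior k2 = {}" using interior_subset by blast
next
  fix k assume "k \<in> \<J>"
  then obtain u v where "u < v" "k = {u..v}" using assms(3) by blast
  then show "k \<noteq> {}" "\<exists>a b. k = cbox a b" by auto
qed (use assms(1) in auto)

text \<open>Telescoping: the left endpoints are inserted as tags, so that the rule for tagged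
  divisions applies.\<close>

lemma division_increments:
  fixes f :: "real \<Rightarrow> 'a::real_normed_vector"
  assumes q: "q division_of {u..v}" and "u \<le> v"
  shows "(\<Sum>k\<in>q. f (Sup k) - f (Inf k)) = f v - f u"
proof -
  define p where "p = (\<lambda>k. (Inf k, k)) ` q"
  have el: "Inf k \<in> k" if k: "k \<in> q" for k
  proof -
    obtain x y where "k = {x..y}" "k \<noteq> {}" using division_ofD(3,4)[OF q k] by auto
    then show ?thesis by auto
  qed
  have "p tagged_division_of {u..v}"
    unfolding tagged_division_of_def tagged_partial_division_of_def
  proof (intro conjI allI impI)
    show "finite p" using division_ofD(1)[OF q] by (simp add: p_def)
    have "{K. \<exists>x. (x, K) \<in> p} = q" by (auto simp: p_def)
    then show "\<Union> {K. \<exists>x. (x, K) \<in> p} = {u..v}"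
      using division_ofD(6)[OF q] by simp
  next
    fix x k assume "(x,k) \<in> p"
    then have k: "k \<in> q" "x = Inf k" by (auto simp: p_def)
    show "x \<in> k" using el k by simp
    show "k \<subseteq> {u..v}" "\<exists>a b. k = cbox a b" using division_ofD(2,4)[OF q k(1)] by auto
  next
    fix x1 k1 x2 k2 assume *: "(x1,k1) \<in> p \<and> (x2,k2) \<in> p \<and> (x1,k1) \<noteq> (x2,k2)"
    then have "k1 \<in> q" "k2 \<in> q" "k1 \<noteq> k2" by (auto simp: p_def)
    then show "interior k1 \<inter> interior k2 = {}" by (rule division_ofD(5)[OF q])
  qed
  then have "sum (\<lambda>(x,K). f(Sup K) - f(Inf K)) p = f v - f u"
    by (rule additive_tagged_division_1[OF \<open>u \<le> v\<close>])
  then show ?thesis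
    unfolding p_def by (subst (asm) sum.reindex) (auto simp: inj_on_def)
qed

text \<open>Cover almost all of \<open>E\<close> by finitely many disjoint intervals of mean slope at least \<open>h\<close>, and then almost
  all of \<open>E\<close> inside them by disjoint intervals over which \<open>f\<close> does not increase. The gaps left by the
  latter have small total length but carry the whole increase of \<open>f\<close>, contradicting absolute continuity.\<close>

lemma AC_oscillation_null:
  fixes f :: "real \<Rightarrow> real"
  assumes f: "AC c d (\<lambda>x. complex_of_real (f x))" and E: "E \<in> lmeasurable" "E \<subseteq> {c<..<d}" and "h > 0"
    and up: "\<And>x \<eta>. x \<in> E \<Longrightarrow> \<eta> > 0 \<Longrightarrow> \<exists>u v. u < v \<and> u \<le> x \<and> x \<le> v \<and> v - u < \<eta> \<and> f v - f u \<ge> h * (v - u)"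
    and dn: "\<And>x \<eta>. x \<in> E \<Longrightarrow> \<eta> > 0 \<Longrightarrow> \<exists>u v. u < v \<and> u \<le> x \<and> x \<le> v \<and> v - u < \<eta> \<and> f v - f u \<le> 0"
  shows "negligible E"
proof (rule ccontr)
  assume "\<not> negligible E"
  define \<mu> where "\<mu> = measure lebesgue E"
  have "\<mu> \<noteq> 0" using E \<open>\<not> negligible E\<close> by (auto simp: \<mu>_def negligible_iff_measure)
  then have "\<mu> > 0" using zero_less_measure_iff[of lebesgue E] by (simp add: \<mu>_def)
  have "h * \<mu> / 2 > 0" using \<open>h > 0\<close> \<open>\<mu> > 0\<close> by simp
  obtain \<delta>0 where "\<delta>0 > 0" and \<delta>0: "\<And>\<D>. \<D> division_of \<Union>\<D> \<Longrightarrow> \<Union>\<D> \<subseteq> {c..d} \<Longrightarrow> (\<Sum>k\<in>\<D>. Sup k - Inf k) < \<delta>0 \<Longrightarrow>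
       (\<Sum>k\<in>\<D>. cmod (complex_of_real (f (Sup k)) - complex_of_real (f (Inf k)))) < h * \<mu> / 2"
    by (rule AC_division[OF f \<open>h * \<mu> / 2 > 0\<close>]) blast
  \<comment> \<open>At most \<open>\<delta>0\<close> for the sake of absolute continuity, and at
    most \<mu> so that the rising intervals keep more than half of the measure of
    \<open>E\<close>.\<close>
  define \<delta> where "\<delta> = min \<delta>0 \<mu>"
  have "\<delta> > 0" "\<delta> \<le> \<delta>0" "\<delta> \<le> \<mu>" using \<open>\<delta>0 > 0\<close> \<open>\<mu> > 0\<close> by (auto simp: \<delta>_def)
  obtain T where T: "open T" "E \<subseteq> T" "(T - E) \<in> lmeasurable" "emeasure lebesgue (T - E) < ennreal (\<delta>/4)"
    using sets_lebesgue_outer_open[OF fmeasurableD[OF E(1)], of "\<delta>/4"] \<open>\<delta> > 0\<close> by auto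
  define U where "U = T \<inter> {c<..<d}"
  have "open U" "E \<subseteq> U" "U \<subseteq> {c<..<d}" using T E by (auto simp: U_def)
  have Ul: "U \<in> lmeasurable"
    by (rule fmeasurableI2[of "{c<..<d}"]) (use \<open>open U\<close> \<open>U \<subseteq> {c<..<d}\<close> in auto)
  have mU: "measure lebesgue U < \<mu> + \<delta>/4"
  proof -
    have "measure lebesgue U \<le> measure lebesgue (E \<union> (T - E))"
      by (rule measure_mono_fmeasurable[OF _ fmeasurableD[OF Ul] fmeasurable.Un[OF E(1) T(3)]]) (auto simp: U_def)
    also have "\<dots> \<le> \<mu> + measure lebesgue (T - E)"
      unfolding \<mu>_def by (rule measure_Un_le) (use E T in auto)
    also have "measure lebesgue (T - E) < \<delta>/4"
      using T(3,4) \<open>\<delta> > 0\<close> by (simp add: emeasure_eq_measure2 ennreal_less_iff)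
    finally show ?thesis by simp
  qed
  have "\<delta>/4 > 0" using \<open>\<delta> > 0\<close> by simp
  obtain \<I> where \<I>: "finite \<I>" "pairwise disjnt \<I>"
    "\<forall>k\<in>\<I>. \<exists>u v. u < v \<and> k = {u..v} \<and> k \<subseteq> U \<and> f v - f u \<ge> h * (v - u)"
    "measure lebesgue E - \<delta>/4 < measure lebesgue (\<Union>\<I>)"
    by (rule Vitali_finite_intervals[OF \<open>open U\<close> \<open>E \<subseteq> U\<close> E(1) \<open>\<delta>/4 > 0\<close> up]) blast
  have div\<I>: "\<I> division_of \<Union>\<I>"
    by (rule division_of_disjoint_intervals[OF \<I>(1,2)]) (use \<I>(3) in blast)
  \<comment> \<open>Interiors only, so that every interval of the second covering can be placed
    inside a single member of \<open>\<I>\<close>.\<close>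
  define U' where "U' = (\<Union>k\<in>\<I>. interior k)"
  have "open U'" by (auto simp: U'_def)
  have U'sub: "U' \<subseteq> \<Union>\<I>" unfolding U'_def using interior_subset by blast
  have ILU: "\<Union>\<I> \<subseteq> U" using \<I>(3) by blast
  have U'm: "measure lebesgue U' = measure lebesgue (\<Union>\<I>)"
  proof -
    have "\<Union>\<I> - U' \<subseteq> (\<Union>k\<in>\<I>. {Inf k, Sup k})"
    proof
      fix x assume "x \<in> \<Union>\<I> - U'"
      then obtain k where k: "k \<in> \<I>" "x \<in> k" "x \<notin> interior k" by (auto simp: U'_def)
      then obtain u v where "u < v" "k = {u..v}" using \<I>(3) by blast
      then have "x = Inf k \<or> x = Sup k" using k by auto
      then show "x \<in> (\<Union>k\<in>\<I>. {Inf k, Sup k})" using k by blast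
    qed
    then have "finite (\<Union>\<I> - U')" by (rule finite_subset) (use \<I>(1) in auto)
    then have null: "\<Union>\<I> - U' \<in> null_sets lebesgue"
      using negligible_finite negligible_iff_null_sets by blast
    have "measure lebesgue (U' \<union> (\<Union>\<I> - U')) = measure lebesgue U'"
      by (rule measure_Un_null_set[OF _ null]) (use \<open>open U'\<close> in auto)
    moreover have "U' \<union> (\<Union>\<I> - U') = \<Union>\<I>" using U'sub by auto
    ultimately show ?thesis by simp
  qed
  have U'l: "U' \<in> lmeasurable"
    by (rule fmeasurableI2[OF Ul]) (use \<open>open U'\<close> U'sub ILU in auto)
  define E' where "E' = E \<inter> U'"
  have E'l: "E' \<in> lmeasurable" using E U'l by (auto simp: E'_def)
  \<comment> \<open>\<open>U\<close> exceeds \<open>E\<close> by less than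
    \<open>\<delta>/4\<close>, so \<open>E\<close> fills the rising intervals up to that
    amount.\<close>
  have mE': "measure lebesgue E' > measure lebesgue (\<Union>\<I>) - \<delta>/4"
  proof -
    have "\<mu> \<le> measure lebesgue (E' \<union> (U - U'))"
      unfolding \<mu>_def
      by (rule measure_mono_fmeasurable[OF _ fmeasurableD[OF E(1)] fmeasurable.Un[OF E'l fmeasurable.Diff[OF Ul U'l]]])
         (use \<open>E \<subseteq> U\<close> in \<open>auto simp: E'_def\<close>)
    also have "\<dots> \<le> measure lebesgue E' + measure lebesgue (U - U')"
      by (rule measure_Un_le) (use E'l Ul U'l in auto)
    also have "measure lebesgue (U - U') = measure lebesgue U - measure lebesgue U'"
      by (rule measurable_measure_Diff[OF Ul fmeasurableD[OF U'l]]) (use U'sub ILU in blast)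
    finally show ?thesis using mU U'm by simp
  qed
  have "\<exists>u v. u < v \<and> u \<le> x \<and> x \<le> v \<and> v - u < \<eta> \<and> (f v - f u \<le> 0 \<and> (\<exists>k\<in>\<I>. {u..v} \<subseteq> interior k))"
    if x: "x \<in> E'" and "\<eta> > 0" for x \<eta>
  proof -
    obtain k where k: "k \<in> \<I>" "x \<in> interior k" using x by (auto simp: E'_def U'_def)
    then obtain \<rho> where \<rho>: "\<rho> > 0" "cball x \<rho> \<subseteq> interior k"
      using open_interior[of k] unfolding open_contains_cball by blast
    obtain u v where uv: "u < v" "u \<le> x" "x \<le> v" "v - u < min \<eta> \<rho>" "f v - f u \<le> 0"
      using dn[of x "min \<eta> \<rho>"] x \<open>\<eta> > 0\<close> \<rho>(1) by (auto simp: E'_def)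
    have "{u..v} \<subseteq> cball x \<rho>" using uv by (auto simp: cball_eq_atLeastAtMost)
    then have "{u..v} \<subseteq> interior k" using \<rho>(2) by blast
    then show ?thesis using uv k by (intro exI[of _ u] exI[of _ v]) auto
  qed
  note Jex = this
  have "E' \<subseteq> U'" by (auto simp: E'_def)
  obtain \<J> where \<J>: "finite \<J>" "pairwise disjnt \<J>"
    "\<forall>j\<in>\<J>. \<exists>u v. u < v \<and> j = {u..v} \<and> j \<subseteq> U' \<and> (f v - f u \<le> 0 \<and> (\<exists>k\<in>\<I>. {u..v} \<subseteq> interior k))"
    "measure lebesgue E' - \<delta>/4 < measure lebesgue (\<Union>\<J>)"
    by (rule Vitali_finite_intervals[OF \<open>open U'\<close> \<open>E' \<subseteq> U'\<close> E'l \<open>\<delta>/4 > 0\<close> Jex]) blast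
  have div\<J>: "\<J> division_of \<Union>\<J>"
    by (rule division_of_disjoint_intervals[OF \<J>(1,2)]) (use \<J>(3) in blast)
  define J where "J k = {j\<in>\<J>. j \<subseteq> interior k}" for k
  have disjJ: "J k \<inter> J k' = {}" if "k \<in> \<I>" "k' \<in> \<I>" "k \<noteq> k'" for k k'
  proof -
    have "k \<inter> k' = {}" using that \<I>(2) by (auto simp: pairwise_def disjnt_def)
    then have "interior k \<inter> interior k' = {}" using interior_subset by blast
    then have "j = {}" if "j \<in> J k" "j \<in> J k'" for j using that unfolding J_def by blast
    moreover have "j \<noteq> {}" if "j \<in> J k" for j
    proof -
      have "j \<in> \<J>" using that by (simp add: J_def)
      from bspec[OF \<J>(3) this] show ?thesis by auto
    qed
    ultimately show ?thesis by (auto simp only: disjoint_iff)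
  qed
  have JU: "\<J> = (\<Union>k\<in>\<I>. J k)"
  proof (intro equalityI subsetI)
    fix j assume j: "j \<in> \<J>"
    from bspec[OF \<J>(3) this] obtain k where "k \<in> \<I>" "j \<subseteq> interior k" by blast
    then show "j \<in> (\<Union>k\<in>\<I>. J k)" using j by (auto simp: J_def)
  qed (auto simp: J_def)
  have finJ: "finite (J k)" for k using \<J>(1) by (simp add: J_def)
  \<comment> \<open>Completing the falling intervals inside \<open>k\<close> to a division of
    \<open>k\<close> turns the gaps into intervals as well; \<open>R\<close> will collect
    them.\<close>
  have "\<exists>q. J k \<subseteq> q \<and> q division_of k" if kI: "k \<in> \<I>" for k
  proof -
    obtain u v where uv: "k = {u..v}" using bspec[OF \<I>(3) kI] by blast
    have "J k division_of \<Union>(J k)"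
      by (rule division_of_subset[OF div\<J>]) (auto simp: J_def)
    moreover have "\<Union>(J k) \<subseteq> cbox u v" using interior_subset uv unfolding J_def by auto
    ultimately show ?thesis using partial_division_extend_interval[of "J k" u v] uv by (metis box_real(2))
  qed
  then obtain q where q: "\<And>k. k \<in> \<I> \<Longrightarrow> J k \<subseteq> q k" "\<And>k. k \<in> \<I> \<Longrightarrow> q k division_of k" by metis
  have finq: "finite (q k)" if "k \<in> \<I>" for k using division_ofD(1)[OF q(2)[OF that]] .
  define R where "R = (\<Union>k\<in>\<I>. q k - J k)"
  have disjq: "q k \<inter> q k' = {}" if "k \<in> \<I>" "k' \<in> \<I>" "k \<noteq> k'" for k k'
  proof -
    have "k \<inter> k' = {}" using that \<I>(2) by (auto simp: pairwise_def disjnt_def)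
    then show ?thesis using division_ofD(2,3)[OF q(2)[OF that(1)]] division_ofD(2,3)[OF q(2)[OF that(2)]] by blast
  qed
  have Rel: "\<exists>k\<in>\<I>. l \<in> q k \<and> l \<subseteq> k" if "l \<in> R" for l
    using that division_ofD(2)[OF q(2)] unfolding R_def by blast
  have divR: "R division_of \<Union>R"
    unfolding division_of_def
  proof (intro conjI ballI impI)
    show "finite R" using finq \<I>(1) by (auto simp: R_def)
    fix l assume l: "l \<in> R"
    then obtain k where k: "k \<in> \<I>" "l \<in> q k" using Rel by blast
    show "l \<noteq> {}" "\<exists>a b. l = cbox a b" using division_ofD(3,4)[OF q(2)[OF k(1)] k(2)] by auto
  next
    fix l l' assume l: "l \<in> R" "l' \<in> R" "l \<noteq> l'"
    obtain k where k: "k \<in> \<I>" "l \<in> q k" "l \<subseteq> k" using Rel l by blast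
    obtain k' where k': "k' \<in> \<I>" "l' \<in> q k'" "l' \<subseteq> k'" using Rel l by blast
    show "interior l \<inter> interior l' = {}"
    proof (cases "k = k'")
      case True then show ?thesis using division_ofD(5)[OF q(2)[OF k(1)]] k k' l by blast
    next
      case False
      then have "k \<inter> k' = {}" using k k' \<I>(2) by (auto simp: pairwise_def disjnt_def)
      then show ?thesis using k k' interior_subset[of l] interior_subset[of l'] by blast
    qed
  qed auto
  have sumR: "(\<Sum>l\<in>R. g l) = (\<Sum>k\<in>\<I>. (\<Sum>l\<in>q k. g l) - (\<Sum>l\<in>J k. g l))" for g :: "real set \<Rightarrow> real"
  proof -
    have "(\<Sum>l\<in>R. g l) = (\<Sum>k\<in>\<I>. \<Sum>l\<in>q k - J k. g l)"
      unfolding R_def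
    proof (rule sum.UNION_disjoint[OF \<I>(1)])
      show "\<forall>i\<in>\<I>. finite (q i - J i)" using finq by simp
      show "\<forall>i\<in>\<I>. \<forall>j\<in>\<I>. i \<noteq> j \<longrightarrow> (q i - J i) \<inter> (q j - J j) = {}"
      proof (intro ballI impI)
        fix i j assume "i \<in> \<I>" "j \<in> \<I>" "i \<noteq> j"
        from disjq[OF this] show "(q i - J i) \<inter> (q j - J j) = {}" by blast
      qed
    qed
    also have "\<dots> = (\<Sum>k\<in>\<I>. (\<Sum>l\<in>q k. g l) - (\<Sum>l\<in>J k. g l))"
      by (rule sum.cong[OF refl], rule sum_diff) (simp_all add: finq q(1))
    finally show ?thesis .
  qed
  have sumJ: "(\<Sum>j\<in>\<J>. g j) = (\<Sum>k\<in>\<I>. \<Sum>l\<in>J k. g l)" for g :: "real set \<Rightarrow> real"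
    unfolding JU by (rule sum.UNION_disjoint[OF \<I>(1)]) (simp_all add: finJ disjJ)
  have lenk: "(\<Sum>l\<in>q k. g (Sup l) - g (Inf l)) = g (Sup k) - g (Inf k)" if k: "k \<in> \<I>" for k and g :: "real \<Rightarrow> real"
  proof -
    obtain u v where "u < v" "k = {u..v}" using bspec[OF \<I>(3) k] by blast
    then show ?thesis using division_increments[of "q k" u v g] q(2)[OF k] by simp
  qed
  have "(\<Sum>l\<in>R. Sup l - Inf l) = (\<Sum>k\<in>\<I>. (\<Sum>l\<in>q k. Sup l - Inf l) - (\<Sum>l\<in>J k. Sup l - Inf l))"
    by (rule sumR)
  also have "\<dots> = (\<Sum>k\<in>\<I>. (Sup k - Inf k) - (\<Sum>l\<in>J k. Sup l - Inf l))"
    by (rule sum.cong[OF refl], simp only: lenk[of _ "\<lambda>x. x"])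
  also have "\<dots> = (\<Sum>k\<in>\<I>. Sup k - Inf k) - (\<Sum>j\<in>\<J>. Sup j - Inf j)"
    unfolding sumJ by (rule sum_subtractf)
  also have "\<dots> = measure lebesgue (\<Union>\<I>) - measure lebesgue (\<Union>\<J>)"
    by (simp only: sum_length_division[OF div\<I>] sum_length_division[OF div\<J>])
  also have "\<dots> < \<delta>0" using \<J>(4) mE' \<open>\<delta> \<le> \<delta>0\<close> \<open>\<delta> > 0\<close> by simp
  finally have small: "(\<Sum>l\<in>R. Sup l - Inf l) < \<delta>0" .
  have "\<Union>R \<subseteq> {c..d}"
  proof
    fix x assume "x \<in> \<Union>R"
    then obtain l where l: "x \<in> l" "l \<in> R" by (rule UnionE)
    from Rel[OF l(2)] obtain k where "k \<in> \<I>" "l \<subseteq> k" by (elim bexE conjE)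
    with l(1) have "x \<in> \<Union>\<I>" by (intro UnionI[of k]) auto
    then have "x \<in> U" by (rule subsetD[OF ILU])
    then show "x \<in> {c..d}" using \<open>U \<subseteq> {c<..<d}\<close> by auto
  qed
  from \<delta>0[OF divR this small] have R_small: "(\<Sum>l\<in>R. \<bar>f (Sup l) - f (Inf l)\<bar>) < h * \<mu> / 2"
    by (simp add: norm_of_real flip: of_real_diff)
  \<comment> \<open>The members of \<open>\<I>\<close> rise by at least \<open>h\<close> times their
    length and the members of \<open>J k\<close> contribute at most 0, so the gaps \<open>R\<close>
    carry the whole rise although their total length is below \<open>\<delta>0\<close>.\<close>
  have "h * (\<Sum>k\<in>\<I>. Sup k - Inf k) \<le> (\<Sum>k\<in>\<I>. f (Sup k) - f (Inf k))"
    unfolding sum_distrib_left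
  proof (rule sum_mono)
    fix k assume "k \<in> \<I>"
    then obtain u v where "u < v" "k = {u..v}" "f v - f u \<ge> h * (v - u)" using \<I>(3) by blast
    then show "h * (Sup k - Inf k) \<le> f (Sup k) - f (Inf k)" by simp
  qed
  also have "\<dots> \<le> (\<Sum>k\<in>\<I>. (\<Sum>l\<in>q k. f (Sup l) - f (Inf l)) - (\<Sum>l\<in>J k. f (Sup l) - f (Inf l)))"
  proof (rule sum_mono)
    fix k assume k: "k \<in> \<I>"
    have "(\<Sum>l\<in>J k. f (Sup l) - f (Inf l)) \<le> 0"
    proof (rule sum_nonpos)
      fix l assume "l \<in> J k"
      then obtain u v where "u < v" "l = {u..v}" "f v - f u \<le> 0" using \<J>(3) by (auto simp: J_def)
      then show "f (Sup l) - f (Inf l) \<le> 0" by simp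
    qed
    then show "f (Sup k) - f (Inf k) \<le> (\<Sum>l\<in>q k. f (Sup l) - f (Inf l)) - (\<Sum>l\<in>J k. f (Sup l) - f (Inf l))"
      using lenk[OF k, of f] by simp
  qed
  also have "\<dots> = (\<Sum>l\<in>R. f (Sup l) - f (Inf l))" by (rule sumR[symmetric])
  also have "\<dots> \<le> (\<Sum>l\<in>R. \<bar>f (Sup l) - f (Inf l)\<bar>)" by (rule sum_mono) simp
  finally have "h * measure lebesgue (\<Union>\<I>) < h * \<mu> / 2"
    using R_small sum_length_division[OF div\<I>] by simp
  moreover have "measure lebesgue (\<Union>\<I>) > \<mu> / 2" using \<I>(4) \<open>\<delta> \<le> \<mu>\<close> \<open>\<mu> > 0\<close> \<mu>_def by simp
  then have "h * measure lebesgue (\<Union>\<I>) > h * (\<mu> / 2)" using \<open>h > 0\<close> by simp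
  ultimately show False by simp
qed

text \<open>Over non-overlapping intervals of total length below \<delta> the increments of
  \<open>f\<close> add up to less than 1. Inside an interval of length \<open>\<delta>/2\<close>
  every disjoint family is that short, yet covering half of a piece of \<open>E\<close> of positive
  measure with slope \<open>n\<close> forces a total above 1 once \<open>n\<close> is large.\<close>

lemma AC_infinite_slope_null:
  fixes f :: "real \<Rightarrow> real"
  assumes f: "AC c d (\<lambda>x. complex_of_real (f x))" and E: "E \<in> lmeasurable" "E \<subseteq> {c<..<d}"
    and up: "\<And>x \<eta> n. x \<in> E \<Longrightarrow> \<eta> > 0 \<Longrightarrow> \<exists>u v. u < v \<and> u \<le> x \<and> x \<le> v \<and> v - u < \<eta> \<and> f v - f u \<ge> real n * (v - u)"
  shows "negligible E"
proof -
  obtain \<delta> where "\<delta> > 0" and \<delta>: "\<And>\<D>. \<D> division_of \<Union>\<D> \<Longrightarrow> \<Union>\<D> \<subseteq> {c..d} \<Longrightarrow> (\<Sum>k\<in>\<D>. Sup k - Inf k) < \<delta> \<Longrightarrow>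
       (\<Sum>k\<in>\<D>. cmod (complex_of_real (f (Sup k)) - complex_of_real (f (Inf k)))) < 1"
    by (rule AC_division[OF f zero_less_one]) blast
  define F where "F t = E \<inter> {t<..<t+\<delta>/2}" for t
  have neg: "negligible (F t)" for t
  proof (rule ccontr)
    assume nn: "\<not> negligible (F t)"
    have Fl: "F t \<in> lmeasurable" using E by (auto simp: F_def)
    define \<mu> where "\<mu> = measure lebesgue (F t)"
    have "\<mu> \<noteq> 0" using Fl nn by (auto simp: \<mu>_def negligible_iff_measure)
    then have "\<mu> > 0" using zero_less_measure_iff[of lebesgue "F t"] by (simp add: \<mu>_def)
    obtain n :: nat where "2 / \<mu> < real n" using reals_Archimedean2 by blast
    then have n: "1 < real n * (\<mu> / 2)" using \<open>\<mu> > 0\<close> by (simp add: field_simps)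
    define U where "U = {c<..<d} \<inter> {t<..<t+\<delta>/2}"
    have "open U" by (auto simp: U_def)
    have FU: "F t \<subseteq> U" using E by (auto simp: F_def U_def)
    have "\<mu>/2 > 0" using \<open>\<mu> > 0\<close> by simp
    have upF: "\<exists>u v. u < v \<and> u \<le> x \<and> x \<le> v \<and> v - u < \<eta> \<and> f v - f u \<ge> real n * (v - u)"
      if "x \<in> F t" "\<eta> > 0" for x \<eta> using up[of x \<eta> n] that by (simp add: F_def)
    obtain \<J> where \<J>: "finite \<J>" "pairwise disjnt \<J>"
      "\<forall>k\<in>\<J>. \<exists>u v. u < v \<and> k = {u..v} \<and> k \<subseteq> U \<and> f v - f u \<ge> real n * (v - u)"
      "measure lebesgue (F t) - \<mu>/2 < measure lebesgue (\<Union>\<J>)"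
      by (rule Vitali_finite_intervals[OF \<open>open U\<close> FU Fl \<open>\<mu>/2 > 0\<close> upF]) blast
    have div: "\<J> division_of \<Union>\<J>"
      by (rule division_of_disjoint_intervals[OF \<J>(1,2)]) (use \<J>(3) in blast)
    have JU: "\<Union>\<J> \<subseteq> U" using \<J>(3) by blast
    have "measure lebesgue (\<Union>\<J>) \<le> measure lebesgue {t<..<t+\<delta>/2}"
      using JU lmeasurable_division[OF div] by (intro measure_mono_fmeasurable) (auto simp: U_def)
    then have len: "(\<Sum>k\<in>\<J>. Sup k - Inf k) < \<delta>"
      unfolding sum_length_division[OF div] using \<open>\<delta> > 0\<close> by simp
    have "(\<Sum>k\<in>\<J>. cmod (complex_of_real (f (Sup k)) - complex_of_real (f (Inf k)))) < 1"
      by (rule \<delta>[OF div _ len]) (use JU in \<open>auto simp: U_def\<close>)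
    then have lt1: "(\<Sum>k\<in>\<J>. \<bar>f (Sup k) - f (Inf k)\<bar>) < 1"
      by (simp add: norm_of_real flip: of_real_diff)
    have "1 < real n * (\<mu> / 2)" by (rule n)
    also have "\<dots> \<le> real n * measure lebesgue (\<Union>\<J>)"
      using \<J>(4) by (intro mult_left_mono) (auto simp: \<mu>_def)
    also have "\<dots> = (\<Sum>k\<in>\<J>. real n * (Sup k - Inf k))"
      unfolding sum_length_division[OF div, symmetric] by (simp add: sum_distrib_left)
    also have "\<dots> \<le> (\<Sum>k\<in>\<J>. \<bar>f (Sup k) - f (Inf k)\<bar>)"
    proof (rule sum_mono)
      fix k assume "k \<in> \<J>"
      then obtain u v where "u < v" "k = {u..v}" "f v - f u \<ge> real n * (v - u)" using \<J>(3) by blast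
      then show "real n * (Sup k - Inf k) \<le> \<bar>f (Sup k) - f (Inf k)\<bar>" by simp
    qed
    finally show False using lt1 by simp
  qed
  have "negligible (\<Union>t\<in>\<rat>. F t)"
    by (rule negligible_countable_Union) (use countable_rat neg in auto)
  moreover have "E \<subseteq> (\<Union>t\<in>\<rat>. F t)"
  proof
    fix x assume "x \<in> E"
    have "x - \<delta>/2 < x" using \<open>\<delta> > 0\<close> by simp
    from Rats_dense_in_real[OF this] obtain t where t: "t \<in> \<rat>" "x - \<delta>/2 < t" "t < x" by blast
    then have "x \<in> F t" using \<open>x \<in> E\<close> by (simp add: F_def)
    then show "x \<in> (\<Union>t\<in>\<rat>. F t)" using t(1) by blast
  qed
  ultimately show ?thesis by (rule negligible_subset)
qed

text \<open>Points that lie inside arbitrarily short open intervals over which \<open>f\<close> has mean slope above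
  \<open>\<beta>\<close>. The intervals need not have the point as an endpoint, so the set is a \<open>G\<^sub>\<delta>\<close>.\<close>

definition steep_points :: "real \<Rightarrow> real \<Rightarrow> (real \<Rightarrow> real) \<Rightarrow> real \<Rightarrow> real set" where
  "steep_points c d f \<beta> = {c<..<d} \<inter>
     (\<Inter>n::nat. \<Union>(u,v)\<in>{(u,v). u < v \<and> v - u < 1 / real (Suc n) \<and> f v - f u > \<beta> * (v - u)}. {u<..<v})"

lemma steep_points_lmeasurable: "steep_points c d f \<beta> \<in> lmeasurable"
proof (rule fmeasurableI2[of "{c<..<d}"])
  have op: "open (\<Union>(u,v)\<in>{(u,v). u < v \<and> v - u < 1 / real (Suc n) \<and> f v - f u > \<beta> * (v - u)}. {u<..<v})" for n
    by auto
  show "steep_points c d f \<beta> \<in> sets lebesgue"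
    unfolding steep_points_def
    by (intro sets.Int sets.countable_INT lborelD borel_open sets_completionI_sets) (use op in \<open>auto simp del: of_nat_Suc\<close>)
qed (auto simp: steep_points_def)

lemma steep_pointsD:
  assumes "x \<in> steep_points c d f \<beta>" "\<eta> > 0"
  shows "\<exists>u v. u < v \<and> u \<le> x \<and> x \<le> v \<and> v - u < \<eta> \<and> f v - f u > \<beta> * (v - u)"
proof -
  obtain n where n: "1 / real (Suc n) < \<eta>" using nat_approx_posE[OF assms(2)] by blast
  have "x \<in> (\<Union>(u,v)\<in>{(u,v). u < v \<and> v - u < 1 / real (Suc n) \<and> f v - f u > \<beta> * (v - u)}. {u<..<v})"
    using assms(1) unfolding steep_points_def by blast
  then obtain u v where uv: "u < v" "v - u < 1 / real (Suc n)" "f v - f u > \<beta> * (v - u)" "u < x" "x < v"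
    by auto
  show ?thesis
    by (rule exI[of _ u], rule exI[of _ v]) (use uv n in linarith)
qed

text \<open>A steep difference quotient at \<open>x\<close> gives an interval with \<open>x\<close>
  as an endpoint. The inequality is strict and \<open>f\<close> is continuous at \<open>x\<close>,
  so that endpoint can be pushed slightly past \<open>x\<close>, which puts \<open>x\<close> into
  the interior.\<close>

lemma steep_pointsI:
  fixes f :: "real \<Rightarrow> real"
  assumes x: "x \<in> {c<..<d}" and cont: "isCont f x"
    and fr: "\<exists>\<^sub>F y in at x. (f y - f x) / (y - x) > \<beta>"
  shows "x \<in> steep_points c d f \<beta>"
  unfolding steep_points_def
proof (intro IntI x INT_I)
  fix n :: nat
  define ee where "ee = 1 / real (Suc n)"
  have ee: "ee > 0" by (simp add: ee_def)
  have "\<forall>\<^sub>F y in at x. dist y x < ee / 2 \<and> y \<noteq> x"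
    unfolding eventually_at by (rule exI[of _ "ee / 2"]) (use ee in auto)
  from this have "\<exists>\<^sub>F y in at x. (f y - f x) / (y - x) > \<beta> \<and> (dist y x < ee / 2 \<and> y \<noteq> x)"
    by (intro frequently_rev_mp[OF fr]) (erule eventually_mono, simp del: of_nat_Suc)
  then obtain y where y: "(f y - f x) / (y - x) > \<beta>" "dist y x < ee / 2" "y \<noteq> x"
    by (blast dest: frequently_ex)
  have "\<exists>u v. u < v \<and> v - u < ee \<and> f v - f u > \<beta> * (v - u) \<and> u < x \<and> x < v"
  proof (cases "y > x")
    case True
    have c: "isCont (\<lambda>u. (f y - f u) - \<beta> * (y - u)) x" using cont by (intro continuous_intros)
    have "(f y - f x) - \<beta> * (y - x) > 0" using y True by (simp add: field_simps)
    then have "\<forall>\<^sub>F u in nhds x. (f y - f u) - \<beta> * (y - u) > 0"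
      unfolding eventually_nhds_conv_at by (intro conjI order_tendstoD(1)[OF c[unfolded isCont_def]])
    then obtain e where e: "e > 0" "\<And>u. dist u x < e \<Longrightarrow> (f y - f u) - \<beta> * (y - u) > 0"
      unfolding eventually_nhds_metric by blast
    have "0 < min e (ee / 2)" using e(1) ee by simp
    from dense[OF this] obtain m where "0 < m" "m < min e (ee / 2)" by blast
    then have m: "m > 0" "m < e" "m \<le> ee / 2" by (simp_all only: min_less_iff_conj less_imp_le)
    define u where "u = x - m"
    have u: "u < x" "dist u x < e" "x - u \<le> ee/2" using m unfolding u_def dist_real_def by linarith+
    show ?thesis
      by (rule exI[of _ u], rule exI[of _ y]) (use u e(2)[OF u(2)] y(2) True in \<open>auto simp: dist_real_def\<close>)
  next
    case False
    then have yx: "y < x" using y by auto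
    have c: "isCont (\<lambda>v. (f v - f y) - \<beta> * (v - y)) x" using cont by (intro continuous_intros)
    have "(f x - f y) - \<beta> * (x - y) > 0" using y yx by (simp add: field_simps)
    then have "\<forall>\<^sub>F v in nhds x. (f v - f y) - \<beta> * (v - y) > 0"
      unfolding eventually_nhds_conv_at by (intro conjI order_tendstoD(1)[OF c[unfolded isCont_def]])
    then obtain e where e: "e > 0" "\<And>u. dist u x < e \<Longrightarrow> (f u - f y) - \<beta> * (u - y) > 0"
      unfolding eventually_nhds_metric by blast
    have "0 < min e (ee / 2)" using e(1) ee by simp
    from dense[OF this] obtain m where "0 < m" "m < min e (ee / 2)" by blast
    then have m: "m > 0" "m < e" "m \<le> ee / 2" by (simp_all only: min_less_iff_conj less_imp_le)
    define v where "v = x + m"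
    have v: "x < v" "dist v x < e" "v - x \<le> ee/2" using m unfolding v_def dist_real_def by linarith+
    show ?thesis
      by (rule exI[of _ y], rule exI[of _ v]) (use v e(2)[OF v(2)] y(2) yx in \<open>auto simp: dist_real_def\<close>)
  qed
  then show "x \<in> (\<Union>(u,v)\<in>{(u,v). u < v \<and> v - u < 1 / real (Suc n) \<and> f v - f u > \<beta> * (v - u)}. {u<..<v})"
    unfolding ee_def by (auto simp del: of_nat_Suc)
qed

lemma AC_id: "AC c d (\<lambda>x. complex_of_real x)"
proof (rule AC_of_integral_bound[where h="\<lambda>_. 1"])
  show "(\<lambda>_::real. 1::real) absolutely_integrable_on {c..d}" by (rule absolutely_integrable_on_const) auto
  fix x y :: real assume "x \<le> y"
  then show "cmod (complex_of_real y - complex_of_real x) \<le> integral {x..y} (\<lambda>_. 1)"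
    by (simp add: norm_of_real flip: of_real_diff)
qed simp

lemma AC_uminus: "AC c d f \<Longrightarrow> AC c d (\<lambda>x. - f x)"
  by (rule AC_dominated[of c d f f 1 0]) (auto simp: norm_minus_commute)

text \<open>Subtracting \<open>\<alpha> * x\<close> turns slopes above \<beta> into slopes above the
  positive number \<open>\<beta> - \<alpha>\<close> and slopes below \<alpha> into decrease, which
  is the situation of \<open>AC_oscillation_null\<close>. The second set consists of points lying in
  arbitrarily short intervals of arbitrarily large slope.\<close>

lemma AC_steep_points_null:
  fixes f :: "real \<Rightarrow> real"
  assumes f: "AC c d (\<lambda>x. complex_of_real (f x))"
  shows "\<alpha> < \<beta> \<Longrightarrow> negligible (steep_points c d f \<beta> \<inter> steep_points c d (\<lambda>x. - f x) (- \<alpha>))"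
    and "negligible (\<Inter>n::nat. steep_points c d f (real n))"
proof -
  assume ab: "\<alpha> < \<beta>"
  let ?E = "steep_points c d f \<beta> \<inter> steep_points c d (\<lambda>x. - f x) (- \<alpha>)"
  have g: "AC c d (\<lambda>x. complex_of_real (f x - \<alpha> * x))"
    using AC_add[OF f AC_cmult[OF AC_id, of c d "- complex_of_real \<alpha>"]] by simp
  show "negligible ?E"
  proof (rule AC_oscillation_null[OF g, of _ "\<beta> - \<alpha>"])
    show "?E \<in> lmeasurable" by (intro fmeasurable.Int steep_points_lmeasurable)
    show "?E \<subseteq> {c<..<d}" by (auto simp: steep_points_def)
    fix x \<eta> :: real assume x: "x \<in> ?E" and \<eta>: "\<eta> > 0"
    obtain u v where "u < v" "u \<le> x" "x \<le> v" "v - u < \<eta>" "f v - f u > \<beta> * (v - u)"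
      using steep_pointsD[OF IntD1[OF x] \<eta>] by blast
    then show "\<exists>u v. u < v \<and> u \<le> x \<and> x \<le> v \<and> v - u < \<eta> \<and> (\<beta> - \<alpha>) * (v - u) \<le> f v - \<alpha> * v - (f u - \<alpha> * u)"
      by (intro exI[of _ u] exI[of _ v]) (simp add: algebra_simps)
    obtain u v where "u < v" "u \<le> x" "x \<le> v" "v - u < \<eta>" "- f v - - f u > - \<alpha> * (v - u)"
      using steep_pointsD[OF IntD2[OF x] \<eta>] by blast
    then show "\<exists>u v. u < v \<and> u \<le> x \<and> x \<le> v \<and> v - u < \<eta> \<and> f v - \<alpha> * v - (f u - \<alpha> * u) \<le> 0"
      by (intro exI[of _ u] exI[of _ v]) (simp add: algebra_simps)
  qed (use ab in simp)
next
  show "negligible (\<Inter>n::nat. steep_points c d f (real n))"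
  proof (rule AC_infinite_slope_null[OF f])
    show "(\<Inter>n::nat. steep_points c d f (real n)) \<in> lmeasurable"
    proof (rule fmeasurableI2[OF steep_points_lmeasurable])
      show "(\<Inter>n::nat. steep_points c d f (real n)) \<in> sets lebesgue"
        using fmeasurableD[OF steep_points_lmeasurable] by (intro sets.countable_INT) auto
      show "(\<Inter>n::nat. steep_points c d f (real n)) \<subseteq> steep_points c d f (real 0)" by (rule INT_lower) simp
    qed
    show "(\<Inter>n::nat. steep_points c d f (real n)) \<subseteq> {c<..<d}" by (auto simp: steep_points_def)
    fix x \<eta> :: real and n assume x: "x \<in> (\<Inter>n::nat. steep_points c d f (real n))" and \<eta>: "\<eta> > 0"
    have "x \<in> steep_points c d f (real n)" using x by blast
    from steep_pointsD[OF this \<eta>]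
    show "\<exists>u v. u < v \<and> u \<le> x \<and> x \<le> v \<and> v - u < \<eta> \<and> real n * (v - u) \<le> f v - f u"
      by (meson less_imp_le)
  qed
qed

text \<open>Compare the lower and upper limits of the difference quotient as extended reals. If they
  differ, rationals \<alpha> < \<beta> separate them, and the point is steep for \<open>f\<close> at
  \<beta> and for \<open>- f\<close> at \<open>- \<alpha>\<close>; if they agree, the only
  obstruction is an infinite value. Taking \<alpha> and \<beta> rational leaves countably many
  exceptional sets.\<close>

lemma AC_real_differentiable_AE:
  fixes f :: "real \<Rightarrow> real"
  assumes f: "AC c d (\<lambda>x. complex_of_real (f x))"
  shows "negligible {x\<in>{c<..<d}. \<not> f differentiable (at x)}"
proof -
  have f': "AC c d (\<lambda>x. complex_of_real (- f x))" using AC_uminus[OF f] by simp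
  define N where "N = (\<Union>(\<alpha>,\<beta>)\<in>{(\<alpha>,\<beta>)\<in>\<rat>\<times>\<rat>. \<alpha> < \<beta>}. steep_points c d f \<beta> \<inter> steep_points c d (\<lambda>x. - f x) (- \<alpha>))
     \<union> (\<Inter>n::nat. steep_points c d f (real n)) \<union> (\<Inter>n::nat. steep_points c d (\<lambda>x. - f x) (real n))"
  have "negligible N"
    unfolding N_def
  proof (intro negligible_Un AC_steep_points_null(2)[OF f] AC_steep_points_null(2)[OF f'] negligible_countable_Union)
    have "countable {(\<alpha>::real,\<beta>)\<in>\<rat>\<times>\<rat>. \<alpha> < \<beta>}"
      by (rule countable_subset[of _ "\<rat> \<times> \<rat>"]) (auto intro: countable_rat)
    then show "countable ((\<lambda>(\<alpha>,\<beta>). steep_points c d f \<beta> \<inter> steep_points c d (\<lambda>x. - f x) (- \<alpha>)) ` {(\<alpha>,\<beta>)\<in>\<rat>\<times>\<rat>. \<alpha> < \<beta>})"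
      by (rule countable_image)
  qed (auto intro: AC_steep_points_null(1)[OF f])
  moreover have "{x\<in>{c<..<d}. \<not> f differentiable (at x)} \<subseteq> N"
  proof (rule subsetI, rule ccontr)
    fix x assume "x \<in> {x\<in>{c<..<d}. \<not> f differentiable (at x)}"
    then have x: "x \<in> {c<..<d}" and nd: "\<not> f differentiable (at x)" by auto
    assume "x \<notin> N"
    then have nN: "\<And>\<alpha> \<beta>. \<alpha> \<in> \<rat> \<Longrightarrow> \<beta> \<in> \<rat> \<Longrightarrow> \<alpha> < \<beta> \<Longrightarrow> x \<in> steep_points c d f \<beta> \<Longrightarrow> x \<in> steep_points c d (\<lambda>x. - f x) (- \<alpha>) \<Longrightarrow> False"
      and nI: "x \<notin> (\<Inter>n::nat. steep_points c d f (real n))" "x \<notin> (\<Inter>n::nat. steep_points c d (\<lambda>x. - f x) (real n))"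
      unfolding N_def by blast+
    have "continuous_on {c<..<d} (\<lambda>x. complex_of_real (f x))"
      by (rule continuous_on_subset[OF AC_imp_continuous_on[OF f]]) auto
    then have "continuous_on {c<..<d} (\<lambda>x. Re (complex_of_real (f x)))" by (rule continuous_on_Re)
    then have cont: "isCont f x"
      using x by (simp add: continuous_on_eq_continuous_at)
    then have cont': "isCont (\<lambda>x. - f x) x" by (intro continuous_intros)
    define Q where "Q y = (f y - f x) / (y - x)" for y
    have Qneg: "(- f y - - f x) / (y - x) = - Q y" for y unfolding Q_def by (simp add: divide_simps)
    have up: "x \<in> steep_points c d f \<beta>" if "ereal \<beta> < Limsup (at x) (\<lambda>y. ereal (Q y))" for \<beta>
    proof (rule steep_pointsI[OF x cont], rule ccontr)
      assume "\<not> (\<exists>\<^sub>F y in at x. (f y - f x) / (y - x) > \<beta>)"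
      then have "\<forall>\<^sub>F y in at x. ereal (Q y) \<le> ereal \<beta>" by (simp add: not_frequently not_less Q_def)
      then have "Limsup (at x) (\<lambda>y. ereal (Q y)) \<le> ereal \<beta>" by (rule Limsup_bounded)
      then show False using that by simp
    qed
    have dn: "x \<in> steep_points c d (\<lambda>x. - f x) (- \<alpha>)" if "Liminf (at x) (\<lambda>y. ereal (Q y)) < ereal \<alpha>" for \<alpha>
    proof (rule steep_pointsI[OF x cont'], rule ccontr)
      assume "\<not> (\<exists>\<^sub>F y in at x. (- f y - - f x) / (y - x) > - \<alpha>)"
      then have "\<forall>\<^sub>F y in at x. ereal \<alpha> \<le> ereal (Q y)" unfolding Qneg by (simp add: not_frequently not_less)
      then have "ereal \<alpha> \<le> Liminf (at x) (\<lambda>y. ereal (Q y))" by (rule Liminf_bounded)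
      then show False using that by simp
    qed
    have eq: "Liminf (at x) (\<lambda>y. ereal (Q y)) = Limsup (at x) (\<lambda>y. ereal (Q y))"
    proof (rule ccontr)
      assume "\<not> ?thesis"
      then have "Liminf (at x) (\<lambda>y. ereal (Q y)) < Limsup (at x) (\<lambda>y. ereal (Q y))"
        using Liminf_le_Limsup[of "at x" "\<lambda>y. ereal (Q y)"] by (simp add: order_less_le)
      then obtain a1 where a1: "Liminf (at x) (\<lambda>y. ereal (Q y)) < ereal a1" "ereal a1 < Limsup (at x) (\<lambda>y. ereal (Q y))"
        using ereal_dense2 by blast
      then obtain b1 where b1: "ereal a1 < ereal b1" "ereal b1 < Limsup (at x) (\<lambda>y. ereal (Q y))"
        using ereal_dense2 by blast
      have ab1: "a1 < b1" using b1(1) by simp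
      obtain \<alpha> where \<alpha>: "\<alpha> \<in> \<rat>" "a1 < \<alpha>" "\<alpha> < b1" using Rats_dense_in_real[OF ab1] by blast
      obtain \<beta> where \<beta>: "\<beta> \<in> \<rat>" "\<alpha> < \<beta>" "\<beta> < b1" using Rats_dense_in_real[OF \<alpha>(3)] by blast
      have "ereal a1 < ereal \<alpha>" "ereal \<beta> < ereal b1" using \<alpha> \<beta> by auto
      then show False
        using nN[OF \<alpha>(1) \<beta>(1) \<beta>(2) up dn] a1(1) b1(2) by (meson less_trans)
    qed
    define L where "L = Limsup (at x) (\<lambda>y. ereal (Q y))"
    have lim: "((\<lambda>y. ereal (Q y)) \<longlongrightarrow> L) (at x)"
      using eq by (subst tendsto_iff_Liminf_eq_Limsup) (auto simp: L_def)
    show False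
    proof (cases L)
      case (real l)
      then have "(Q \<longlongrightarrow> l) (at x)" using lim by simp
      then have "(f has_field_derivative l) (at x)" unfolding has_field_derivative_iff Q_def .
      then show False using nd by (auto simp: real_differentiable_def)
    next
      case PInf
      then have "x \<in> steep_points c d f (real n)" for n
        by (intro up) (simp add: L_def[symmetric])
      then show False using nI(1) by blast
    next
      case MInf
      then have "x \<in> steep_points c d (\<lambda>x. - f x) (- (- real n))" for n
        by (intro dn) (simp add: L_def[symmetric] eq)
      then show False using nI(2) by simp
    qed
  qed
  ultimately show ?thesis by (rule negligible_subset)
qed

lemma AC_differentiable_AE:
  assumes f: "AC c d f"
  shows "negligible {x\<in>{c<..<d}. \<not> (f has_vector_derivative vector_derivative f (at x)) (at x)}"
proof (rule negligible_subset[OF negligible_Un[OF AC_real_differentiable_AE[OF AC_of_real_Re[OF f]] AC_real_differentiable_AE[OF AC_of_real_Im[OF f]]]])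
  have "f differentiable (at x)" if "(\<lambda>x. Re (f x)) differentiable (at x)" "(\<lambda>x. Im (f x)) differentiable (at x)" for x
  proof -
    obtain a b where "((\<lambda>x. Re (f x)) has_vector_derivative a) (at x)" "((\<lambda>x. Im (f x)) has_vector_derivative b) (at x)"
      using \<open>(\<lambda>x. Re (f x)) differentiable (at x)\<close> \<open>(\<lambda>x. Im (f x)) differentiable (at x)\<close>
      by (auto simp: vector_derivative_works)
    then have "(f has_vector_derivative Complex a b) (at x)"
      by (simp add: has_vector_derivative_complex_iff has_real_derivative_iff_has_vector_derivative)
    then show ?thesis by (rule differentiableI_vector)
  qed
  then show "{x\<in>{c<..<d}. \<not> (f has_vector_derivative vector_derivative f (at x)) (at x)} \<subseteq>
    {x\<in>{c<..<d}. \<not> (\<lambda>x. Re (f x)) differentiable (at x)} \<union> {x\<in>{c<..<d}. \<not> (\<lambda>x. Im (f x)) differentiable (at x)}"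
    by (auto simp flip: vector_derivative_works)
qed

section \<open>From compact subintervals to the open interval\<close>

lemma einterval_compact_subset: "a < ereal l \<Longrightarrow> ereal h < b \<Longrightarrow> {l..h} \<subseteq> einterval a b"
proof
  fix x assume "a < ereal l" "ereal h < b" "x \<in> {l..h}"
  then have "a < ereal x" "ereal x < b"
    using less_le_trans[of a "ereal l" "ereal x"] le_less_trans[of "ereal x" "ereal h" b] by auto
  then show "x \<in> einterval a b" by (simp add: einterval_def)
qed

lemma AE_lebesgue_on_iff_negligible:
  assumes "S \<in> sets lebesgue"
  shows "(AE x in lebesgue_on S. P x) \<longleftrightarrow> negligible {x\<in>S. \<not> P x}"
proof -
  have "(AE x in lebesgue_on S. P x) \<longleftrightarrow> (AE x in lebesgue. x \<in> S \<longrightarrow> P x)"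
    using assms by (intro AE_restrict_space_iff) auto
  also have "\<dots> \<longleftrightarrow> negligible {x\<in>S. \<not> P x}"
  proof
    assume "AE x in lebesgue. x \<in> S \<longrightarrow> P x"
    then obtain N where N: "{x \<in> space lebesgue. \<not> (x \<in> S \<longrightarrow> P x)} \<subseteq> N" "N \<in> null_sets lebesgue"
      by (auto elim!: AE_E2 simp: eventually_ae_filter)
    have "negligible N" using N(2) by (simp add: negligible_iff_null_sets)
    then show "negligible {x\<in>S. \<not> P x}" by (rule negligible_subset) (use N(1) in auto)
  next
    assume "negligible {x\<in>S. \<not> P x}"
    then have "{x\<in>S. \<not> P x} \<in> null_sets lebesgue" by (simp add: negligible_iff_null_sets)
    then show "AE x in lebesgue. x \<in> S \<longrightarrow> P x" by (rule AE_I') auto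
  qed
  finally show ?thesis .
qed

lemma einterval_lebesgue: "einterval a b \<in> sets lebesgue"
  by (intro sets_completionI_sets) auto

text \<open>Countably many intervals with rational endpoints exhaust the open interval, also when an
  endpoint is infinite.\<close>

lemma AE_einterval_compactI:
  assumes "\<And>l h. a < ereal l \<Longrightarrow> l < h \<Longrightarrow> ereal h < b \<Longrightarrow> negligible {x\<in>{l<..<h}. \<not> P x}"
  shows "AE x in lebesgue_on (einterval a b). P x"
  unfolding AE_lebesgue_on_iff_negligible[OF einterval_lebesgue]
proof -
  define R where "R = {(l,h)\<in>\<rat>\<times>\<rat>. a < ereal l \<and> l < h \<and> ereal h < b}"
  have "countable R" unfolding R_def
    by (rule countable_subset[of _ "\<rat> \<times> \<rat>"]) (auto intro: countable_rat)
  then have "negligible (\<Union>(l,h)\<in>R. {x\<in>{l<..<h}. \<not> P x})"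
    by (intro negligible_countable_Union countable_image) (use assms in \<open>auto simp: R_def\<close>)
  moreover have "{x\<in>einterval a b. \<not> P x} \<subseteq> (\<Union>(l,h)\<in>R. {x\<in>{l<..<h}. \<not> P x})"
  proof
    fix x assume x: "x \<in> {x\<in>einterval a b. \<not> P x}"
    then have ax: "a < ereal x" "ereal x < b" by (auto simp: einterval_def)
    obtain l1 where l1: "a < ereal l1" "ereal l1 < ereal x" using ereal_dense2[OF ax(1)] by blast
    obtain h1 where h1: "ereal x < ereal h1" "ereal h1 < b" using ereal_dense2[OF ax(2)] by blast
    have "l1 < x" "x < h1" using l1 h1 by auto
    obtain l where l: "l \<in> \<rat>" "l1 < l" "l < x" using Rats_dense_in_real[OF \<open>l1 < x\<close>] by blast
    obtain h where h: "h \<in> \<rat>" "x < h" "h < h1" using Rats_dense_in_real[OF \<open>x < h1\<close>] by blast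
    have "a < ereal l" using l1(1) l(2) by (metis ereal_less_eq(3) less_imp_le less_le_trans)
    moreover have "ereal h < b" using h1(2) h(3) by (metis ereal_less_eq(3) less_imp_le le_less_trans)
    ultimately have "(l,h) \<in> R" using l h by (simp add: R_def)
    then show "x \<in> (\<Union>(l,h)\<in>R. {x\<in>{l<..<h}. \<not> P x})" using x l h by auto
  qed
  ultimately show "negligible {x\<in>einterval a b. \<not> P x}" by (rule negligible_subset)
qed

lemma AC_locD: "AC_loc a b f \<Longrightarrow> a < ereal l \<Longrightarrow> ereal h < b \<Longrightarrow> l \<le> h \<Longrightarrow> AC l h f"
  by (auto simp: AC_loc_def)

lemma AC_loc_continuous_on:
  assumes "AC_loc a b f" shows "continuous_on (einterval a b) f"
proof (rule continuous_at_imp_continuous_on, rule ballI)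
  fix x assume x: "x \<in> einterval a b"
  then have ax: "a < ereal x" "ereal x < b" by (auto simp: einterval_def)
  obtain l where l: "a < ereal l" "ereal l < ereal x" using ereal_dense2[OF ax(1)] by blast
  obtain h where h: "ereal x < ereal h" "ereal h < b" using ereal_dense2[OF ax(2)] by blast
  have "continuous_on {l..h} f" using AC_imp_continuous_on[OF AC_locD[OF assms l(1) h(2)]] l h by auto
  then have "continuous_on {l<..<h} f" by (rule continuous_on_subset) auto
  then show "isCont f x" using l h by (simp add: continuous_on_eq_continuous_at)
qed

lemma AC_loc_differentiable_AE:
  assumes "AC_loc a b f"
  shows "AE x in lebesgue_on (einterval a b). (f has_vector_derivative vector_derivative f (at x)) (at x)"
  by (rule AE_einterval_compactI) (intro AC_differentiable_AE AC_locD[OF assms]; simp)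

lemma AC_loc_has_integral:
  assumes f: "AC_loc a b f" and lh: "a < ereal l" "ereal h < b" "l \<le> h"
    and g: "AE x in lebesgue_on (einterval a b). (f has_vector_derivative g x) (at x)"
  shows "(g has_integral f h - f l) {l..h}"
proof (rule AC_has_integral[OF lh(3) AC_locD[OF f lh]])
  show "negligible {x\<in>einterval a b. \<not> (f has_vector_derivative g x) (at x)}"
    using g by (simp add: AE_lebesgue_on_iff_negligible[OF einterval_lebesgue])
  show "(f has_vector_derivative g x) (at x within {l..h})"
    if "x \<in> {l..h} - {x\<in>einterval a b. \<not> (f has_vector_derivative g x) (at x)}" for x
    using that einterval_compact_subset[OF lh(1,2)] by (auto intro: has_vector_derivative_at_within)
qed

lemma
  assumes "AC_loc a b f" "AC_loc a b g"
  shows AC_loc_add: "AC_loc a b (\<lambda>x. f x + g x)" and AC_loc_mult: "AC_loc a b (\<lambda>x. f x * g x)"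
    and AC_loc_cnj: "AC_loc a b (\<lambda>x. cnj (f x))" and AC_loc_cmult: "AC_loc a b (\<lambda>x. k * f x)"
  using assms by (auto simp: AC_loc_def AC_add AC_mult AC_cnj AC_cmult)

lemma AC_loc_cong:
  assumes "\<And>x. x \<in> einterval a b \<Longrightarrow> f x = g x" shows "AC_loc a b f \<longleftrightarrow> AC_loc a b g"
  unfolding AC_loc_def using assms AC_cong[of _ _ f g] einterval_compact_subset[of a _ _ b] by blast

section \<open>Linear Volterra equations\<close>

definition signed_integral :: "real \<Rightarrow> real \<Rightarrow> (real \<Rightarrow> 'a::euclidean_space) \<Rightarrow> 'a" where
  "signed_integral c x f = (if c \<le> x then integral {c..x} f else - integral {x..c} f)"

lemma signed_integral_diff:
  fixes f :: "real \<Rightarrow> 'a::euclidean_space"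
  assumes f: "f integrable_on {l..h}" and "l \<le> c" "c \<le> h" "l \<le> x" "x \<le> y" "y \<le> h"
  shows "signed_integral c y f - signed_integral c x f = integral {x..y} f"
proof -
  have comb: "integral {u..v} f + integral {v..w} f = integral {u..w} f" if "l \<le> u" "u \<le> v" "v \<le> w" "w \<le> h" for u v w
    using that by (intro Henstock_Kurzweil_Integration.integral_combine integrable_subinterval_real[OF f]) auto
  consider "c \<le> x" | "x < c" "c \<le> y" | "y < c" by linarith
  then show ?thesis
  proof cases
    case 1 then show ?thesis using comb[of c x y] assms by (simp add: signed_integral_def algebra_simps)
  next
    case 2 then show ?thesis using comb[of x c y] assms by (simp add: signed_integral_def algebra_simps)
  next
    case 3 then show ?thesis using comb[of x y c] assms by (simp add: signed_integral_def algebra_simps)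
  qed
qed

text \<open>The coefficients of the system are only locally integrable, so the Lipschitz constant of
  classical Picard iteration is replaced by an integrable function \<phi> of the independent
  variable. The base point \<open>c\<close> is interior, and the endpoints may be infinite.\<close>

locale linear_volterra =
  fixes a b :: ereal and c :: real and \<phi> :: "real \<Rightarrow> real" and B :: "real \<Rightarrow> 'v::euclidean_space \<Rightarrow> 'v"
  assumes ac: "a < ereal c" and cb: "ereal c < b"
    and \<phi>: "\<And>l h. a < ereal l \<Longrightarrow> ereal h < b \<Longrightarrow> \<phi> absolutely_integrable_on {l..h}"
    and \<phi>_nonneg: "\<And>x. \<phi> x \<ge> 0"
    and B_linear: "\<And>x. linear (B x)"
    and B_bound: "\<And>x y. norm (B x y) \<le> \<phi> x * norm y"
    and B_integrable: "\<And>l h Y. a < ereal l \<Longrightarrow> ereal h < b \<Longrightarrow> continuous_on {l..h} Y \<Longrightarrow>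
         (\<lambda>x. B x (Y x)) absolutely_integrable_on {l..h}"
begin

primrec picard :: "'v \<Rightarrow> nat \<Rightarrow> real \<Rightarrow> 'v" where
  "picard y0 0 = (\<lambda>x. y0)"
| "picard y0 (Suc n) = (\<lambda>x. signed_integral c x (\<lambda>t. B t (picard y0 n t)))"

text \<open>In the classical bound \<open>(L * (x - c)) ^ n / fact n\<close> for the Picard terms,
  \<open>P x\<close> takes the place of \<open>L * (x - c)\<close>.\<close>

definition P :: "real \<Rightarrow> real" where "P x = signed_integral c x \<phi>"

lemma P_diff:
  assumes "a < ereal l" "ereal h < b" "l \<le> c" "c \<le> h" "l \<le> x" "x \<le> y" "y \<le> h"
  shows "P y - P x = integral {x..y} \<phi>"
  unfolding P_def using assms \<phi>[OF assms(1,2)]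
  by (intro signed_integral_diff) (auto intro: set_lebesgue_integral_eq_integral(1))

lemma P_mono:
  assumes "a < ereal l" "ereal h < b" "l \<le> c" "c \<le> h" "l \<le> x" "x \<le> y" "y \<le> h"
  shows "P x \<le> P y"
proof -
  have "\<phi> integrable_on {l..h}" by (rule set_lebesgue_integral_eq_integral(1)[OF \<phi>[OF assms(1,2)]])
  then have "\<phi> integrable_on {x..y}" by (rule integrable_subinterval_real) (use assms in auto)
  then have "integral {x..y} \<phi> \<ge> 0" by (rule integral_nonneg) (auto simp: \<phi>_nonneg)
  then show ?thesis using P_diff[OF assms] by simp
qed

lemma P_c [simp]: "P c = 0" by (simp add: P_def signed_integral_def)

text \<open>\<open>P\<close> is absolutely continuous, hence so is \<open>P ^ Suc n\<close>, and the
  chain rule holds almost everywhere. Integrating its derivative produces the factor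
  \<open>1 / Suc n\<close> from which the factorials of the Picard bound arise.\<close>

lemma P_power_integral:
  assumes lh: "a < ereal l" "ereal h < b" "l \<le> c" "c \<le> h" "l \<le> x" "x \<le> y" "y \<le> h"
  shows "((\<lambda>t. \<phi> t * P t ^ n) has_integral (P y ^ Suc n - P x ^ Suc n) / real (Suc n)) {x..y}"
proof -
  define f where "f t = complex_of_real (P t)" for t
  have \<phi>lh: "\<phi> absolutely_integrable_on {l..h}" by (rule \<phi>[OF lh(1,2)])
  have "AC l h f"
  proof (rule AC_of_integral_bound[OF \<phi>lh \<phi>_nonneg])
    fix x y assume "l \<le> x" "x \<le> y" "y \<le> h"
    then show "cmod (f y - f x) \<le> integral {x..y} \<phi>"
      using P_diff[of l h x y] P_mono[of l h x y] lh unfolding f_def by (simp add: norm_of_real flip: of_real_diff)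
  qed
  then have "AC x y f" by (rule AC_subset) (use lh in auto)
  then have "AC x y (\<lambda>t. f t ^ k)" for k
    by (induction k) (auto simp: AC_const AC_mult)
  then have ac: "AC x y (\<lambda>t. f t ^ Suc n)" .
  \<comment> \<open>The endpoints join the exceptional set because the differentiation theorem
    speaks only of interior points.\<close>
  define N where "N = {t\<in>{l<..<h}. \<not> ((\<lambda>t. integral {l..t} \<phi>) has_vector_derivative \<phi> t) (at t)} \<union> {l,h}"
  have "negligible N" unfolding N_def
    using indefinite_integral_has_vector_derivative_AE[OF set_lebesgue_integral_eq_integral(1)[OF \<phi>lh]] by (intro negligible_Un) auto
  have "((\<lambda>t. of_real (real (Suc n) * (\<phi> t * P t ^ n))) has_integral (f y ^ Suc n - f x ^ Suc n)) {x..y}"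
  proof (rule AC_has_integral[OF \<open>x \<le> y\<close> ac \<open>negligible N\<close>])
    fix t assume "t \<in> {x..y} - N"
    then have t: "t \<in> {l<..<h}" "((\<lambda>t. integral {l..t} \<phi>) has_vector_derivative \<phi> t) (at t)"
      using lh by (auto simp: N_def)
    have "(P has_vector_derivative \<phi> t) (at t)"
    proof (rule has_vector_derivative_transform_within_open[of "\<lambda>t. integral {l..t} \<phi> + P l" _ _ "{l<..<h}"])
      show "((\<lambda>t. integral {l..t} \<phi> + P l) has_vector_derivative \<phi> t) (at t)"
        using has_vector_derivative_add[OF t(2) has_vector_derivative_const, of "P l"] by simp
      fix u assume "u \<in> {l<..<h}"
      then show "integral {l..u} \<phi> + P l = P u" using P_diff[of l h l u] lh by auto
    qed (use t in auto)
    then have "(P has_real_derivative \<phi> t) (at t)" by (simp add: has_real_derivative_iff_has_vector_derivative)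
    then have "((\<lambda>t. P t ^ Suc n) has_real_derivative real (Suc n) * (\<phi> t * P t ^ n)) (at t)"
      using DERIV_power[of P "\<phi> t" t UNIV "Suc n"] by simp
    then have "((\<lambda>t. complex_of_real (P t ^ Suc n)) has_vector_derivative of_real (real (Suc n) * (\<phi> t * P t ^ n))) (at t)"
      by (intro has_vector_derivative_of_real) (simp only: has_real_derivative_iff_has_vector_derivative)
    then show "((\<lambda>t. f t ^ Suc n) has_vector_derivative of_real (real (Suc n) * (\<phi> t * P t ^ n))) (at t within {x..y})"
      unfolding f_def of_real_power[symmetric] by (rule has_vector_derivative_at_within)
  qed
  from has_integral_linear[OF this bounded_linear_Re]
  have "((\<lambda>t. real (Suc n) * (\<phi> t * P t ^ n)) has_integral (P y ^ Suc n - P x ^ Suc n)) {x..y}"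
    by (simp add: o_def f_def flip: of_real_power of_real_diff del: of_nat_Suc power_Suc)
  from has_integral_mult_right[OF this, of "1 / real (Suc n)"] show ?thesis
    by (simp add: field_simps del: of_nat_Suc power_Suc)
qed

lemma picard_continuous_bound:
  assumes lh: "a < ereal l" "ereal h < b" "l \<le> c" "c \<le> h"
  shows "continuous_on {l..h} (picard y0 n) \<and> (\<forall>x\<in>{l..h}. norm (picard y0 n x) \<le> norm y0 * \<bar>P x\<bar> ^ n / fact n)"
proof (induction n)
  case (Suc n)
  define g where "g t = B t (picard y0 n t)" for t
  have gi: "g integrable_on {l..h}"
    unfolding g_def using B_integrable[OF lh(1,2), of "picard y0 n"] Suc by (auto intro: set_lebesgue_integral_eq_integral(1))
  have gsub: "g integrable_on {x..y}" if "l \<le> x" "y \<le> h" for x y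
    by (rule integrable_subinterval_real[OF gi]) (use that in auto)
  have pd: "picard y0 (Suc n) y - picard y0 (Suc n) x = integral {x..y} g" if "l \<le> x" "x \<le> y" "y \<le> h" for x y
    using signed_integral_diff[OF gi lh(3,4) that] by (simp add: g_def[abs_def])
  have gb: "norm (g t) \<le> norm y0 / fact n * (\<phi> t * \<bar>P t\<bar> ^ n)" if "t \<in> {l..h}" for t
  proof -
    have "norm (g t) \<le> \<phi> t * norm (picard y0 n t)" unfolding g_def by (rule B_bound)
    also have "\<dots> \<le> \<phi> t * (norm y0 * \<bar>P t\<bar> ^ n / fact n)"
      using Suc that \<phi>_nonneg by (intro mult_left_mono) auto
    finally show ?thesis by (simp add: field_simps)
  qed
  have "continuous_on {l..h} (\<lambda>x. picard y0 (Suc n) l + integral {l..x} g)"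
    by (intro continuous_intros indefinite_integral_continuous_1 gi)
  moreover have "picard y0 (Suc n) l + integral {l..x} g = picard y0 (Suc n) x" if "x \<in> {l..h}" for x
    using pd[of l x] that by (simp add: algebra_simps)
  ultimately have cont: "continuous_on {l..h} (picard y0 (Suc n))"
    using continuous_on_cong[of "{l..h}" "{l..h}"] by (metis (no_types, lifting))
  have p0: "picard y0 (Suc n) c = 0" by (simp add: signed_integral_def)
  have "norm (picard y0 (Suc n) x) \<le> norm y0 * \<bar>P x\<bar> ^ Suc n / fact (Suc n)" if x: "x \<in> {l..h}" for x
  proof (cases "c \<le> x")
    case True
    have i: "((\<lambda>t. norm y0 / fact n * (\<phi> t * P t ^ n)) has_integral norm y0 / fact n * ((P x ^ Suc n - P c ^ Suc n) / real (Suc n))) {c..x}"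
      by (rule has_integral_mult_right, rule P_power_integral[OF lh]) (use True x lh in auto)
    have P0: "P t \<ge> 0" if "t \<in> {c..x}" for t using P_mono[OF lh, of c t] that x lh by auto
    have "norm (picard y0 (Suc n) x) = norm (integral {c..x} g)" using pd[of c x] p0 True x lh by simp
    also have "\<dots> \<le> integral {c..x} (\<lambda>t. norm y0 / fact n * (\<phi> t * P t ^ n))"
    proof (rule integral_norm_bound_integral[OF gsub has_integral_integrable[OF i]])
      fix t assume t: "t \<in> {c..x}"
      then show "norm (g t) \<le> norm y0 / fact n * (\<phi> t * P t ^ n)" using gb[of t] P0[of t] x lh by auto
    qed (use x lh in auto)
    also have "\<dots> = norm y0 / fact n * ((P x ^ Suc n - P c ^ Suc n) / real (Suc n))" using i by (rule integral_unique)
    also have "\<dots> = norm y0 * \<bar>P x\<bar> ^ Suc n / fact (Suc n)"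
      using P0[of x] True by (simp add: field_simps)
    finally show ?thesis .
  next
    case False
    \<comment> \<open>To the left of \<open>c\<close> the values of \<open>P\<close> are
      nonpositive, and the factor \<open>(-1) ^ n\<close> turns \<open>P t ^ n\<close> into
      \<open>\<bar>P t\<bar> ^ n\<close>.\<close>
    have i: "((\<lambda>t. norm y0 / fact n * (-1) ^ n * (\<phi> t * P t ^ n)) has_integral norm y0 / fact n * (-1) ^ n * ((P c ^ Suc n - P x ^ Suc n) / real (Suc n))) {x..c}"
      by (rule has_integral_mult_right, rule P_power_integral[OF lh]) (use False x lh in auto)
    have P0: "P t \<le> 0" if "t \<in> {x..c}" for t using P_mono[OF lh, of t c] that x lh by auto
    have ab: "\<bar>P t\<bar> ^ k = (-1) ^ k * P t ^ k" if "t \<in> {x..c}" for t k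
      using P0[OF that] by (simp add: power_minus[symmetric])
    have "- picard y0 (Suc n) x = integral {x..c} g" using pd[of x c] p0 False x lh by (simp del: picard.simps)
    then have "norm (picard y0 (Suc n) x) = norm (integral {x..c} g)" by (metis norm_minus_cancel)
    also have "\<dots> \<le> integral {x..c} (\<lambda>t. norm y0 / fact n * (-1) ^ n * (\<phi> t * P t ^ n))"
    proof (rule integral_norm_bound_integral[OF gsub has_integral_integrable[OF i]])
      fix t assume t: "t \<in> {x..c}"
      then show "norm (g t) \<le> norm y0 / fact n * (-1) ^ n * (\<phi> t * P t ^ n)" using gb[of t] ab[OF t, of n] x lh by (auto simp: algebra_simps)
    qed (use x lh in auto)
    also have "\<dots> = norm y0 / fact n * (-1) ^ n * ((P c ^ Suc n - P x ^ Suc n) / real (Suc n))" using i by (rule integral_unique)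
    also have "\<dots> = norm y0 / (fact n * real (Suc n)) * ((-1) ^ Suc n * P x ^ Suc n)" by (simp add: field_simps)
    also have "(-1) ^ Suc n * P x ^ Suc n = \<bar>P x\<bar> ^ Suc n" using ab[of x "Suc n"] False by simp
    finally show ?thesis by (simp add: field_simps)
  qed
  with cont show ?case by blast
qed simp

theorem solution_exists:
  obtains Y where "Y c = y0"
    "\<And>l h. a < ereal l \<Longrightarrow> ereal h < b \<Longrightarrow> continuous_on {l..h} Y"
    "\<And>l h. a < ereal l \<Longrightarrow> ereal h < b \<Longrightarrow> l \<le> h \<Longrightarrow> Y h - Y l = integral {l..h} (\<lambda>t. B t (Y t))"
proof -
  \<comment> \<open>The series does not refer to \<open>l\<close> and \<open>h\<close>, so one
    function works on all compact subintervals and no gluing is required.\<close>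
  define Y where "Y x = (\<Sum>n. picard y0 n x)" for x
  define S where "S N x = (\<Sum>n<N. picard y0 n x)" for N x
  have main: "continuous_on {l..h} Y \<and> (\<forall>x\<in>{l..h}. Y x = y0 + signed_integral c x (\<lambda>t. B t (Y t)))"
    if lh: "a < ereal l" "ereal h < b" "l \<le> c" "c \<le> h" for l h
  proof -
    \<comment> \<open>\<open>P\<close> is monotone, so its largest modulus on the interval is taken
      at an endpoint.\<close>
    define K where "K = max \<bar>P l\<bar> \<bar>P h\<bar>"
    have PK: "\<bar>P x\<bar> \<le> K" if "x \<in> {l..h}" for x
      using P_mono[OF lh, of l x] P_mono[OF lh, of x h] that by (auto simp: K_def)
    have pc: "continuous_on {l..h} (picard y0 n)" for n using picard_continuous_bound[OF lh] by blast
    have ul: "uniform_limit {l..h} S Y sequentially"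
      unfolding S_def Y_def
    proof (rule Weierstrass_m_test[where M="\<lambda>n. norm y0 * (K ^ n / fact n)"])
      fix n x assume x: "x \<in> {l..h}"
      have "norm (picard y0 n x) \<le> norm y0 * \<bar>P x\<bar> ^ n / fact n" using picard_continuous_bound[OF lh] x by blast
      also have "\<dots> \<le> norm y0 * K ^ n / fact n"
        using PK[OF x] by (intro divide_right_mono mult_left_mono power_mono) auto
      finally show "norm (picard y0 n x) \<le> norm y0 * (K ^ n / fact n)" by simp
    next
      show "summable (\<lambda>n. norm y0 * (K ^ n / fact n))"
        using summable_exp_generic[of K] by (intro summable_mult) (simp add: divide_inverse mult.commute)
    qed
    have Scont: "continuous_on {l..h} (S N)" for N unfolding S_def by (intro continuous_on_sum pc)
    have Yc: "continuous_on {l..h} Y"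
      by (rule uniform_limit_theorem[OF _ ul]) (auto simp: Scont)
    have int: "(\<lambda>t. B t (Z t)) integrable_on {u..v}" if "continuous_on {l..h} Z" "l \<le> u" "v \<le> h" for Z u v
      by (rule integrable_subinterval_real[OF set_lebesgue_integral_eq_integral(1)[OF B_integrable[OF lh(1,2) that(1)]]]) (use that in auto)
    have S_Suc: "S (Suc N) x = y0 + signed_integral c x (\<lambda>t. B t (S N t))" if x: "x \<in> {l..h}" for N x
    proof (induction N)
      case 0 then show ?case using linear_0[OF B_linear] by (simp add: S_def signed_integral_def)
    next
      case (Suc N)
      have "signed_integral c x (\<lambda>t. B t (S (Suc N) t)) = signed_integral c x (\<lambda>t. B t (S N t) + B t (picard y0 N t))"
        unfolding S_def by (simp add: linear_add[OF B_linear])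
      also have "\<dots> = signed_integral c x (\<lambda>t. B t (S N t)) + signed_integral c x (\<lambda>t. B t (picard y0 N t))"
        unfolding signed_integral_def using x lh int[OF Scont] int[OF pc]
        by (auto simp: Henstock_Kurzweil_Integration.integral_add)
      finally show ?case using Suc unfolding S_def by (simp add: algebra_simps)
    qed
    have "Y x = y0 + signed_integral c x (\<lambda>t. B t (Y t))" if x: "x \<in> {l..h}" for x
    proof -
      have lim1: "(\<lambda>N. S (Suc N) x) \<longlonglongrightarrow> Y x"
        using tendsto_uniform_limitI[OF ul x] by (rule LIMSEQ_Suc)
      \<comment> \<open>Uniform convergence passes through the integral because \<open>B\<close> is
        dominated by \<phi>: the error is at most \<open>I\<close> times the uniform
        distance.\<close>
      have "(\<lambda>N. signed_integral c x (\<lambda>t. B t (S N t))) \<longlonglongrightarrow> signed_integral c x (\<lambda>t. B t (Y t))"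
      proof (rule tendstoI)
        fix e :: real assume "e > 0"
        define I where "I = integral {l..h} \<phi>"
        have \<phi>i: "\<phi> integrable_on {l..h}" using \<phi>[OF lh(1,2)] by (rule set_lebesgue_integral_eq_integral(1))
        have I0: "I \<ge> 0" unfolding I_def by (rule integral_nonneg[OF \<phi>i]) (simp add: \<phi>_nonneg)
        define e' where "e' = e / (I + 1)"
        have e': "e' > 0" using \<open>e > 0\<close> I0 by (simp add: e'_def)
        have ev: "\<forall>\<^sub>F N in sequentially. \<forall>t\<in>{l..h}. dist (S N t) (Y t) < e'"
          using ul e' unfolding uniform_limit_iff by blast
        show "\<forall>\<^sub>F N in sequentially. dist (signed_integral c x (\<lambda>t. B t (S N t))) (signed_integral c x (\<lambda>t. B t (Y t))) < e"
        proof (rule eventually_mono[OF ev])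
          fix N assume close: "\<forall>t\<in>{l..h}. dist (S N t) (Y t) < e'"
          have bnd: "norm (integral {u..v} (\<lambda>t. B t (S N t)) - integral {u..v} (\<lambda>t. B t (Y t))) \<le> I * e'"
            if uv: "l \<le> u" "v \<le> h" for u v
          proof -
            have sub: "{u..v} \<subseteq> {l..h}" using uv by auto
            have "integral {u..v} (\<lambda>t. B t (S N t)) - integral {u..v} (\<lambda>t. B t (Y t)) = integral {u..v} (\<lambda>t. B t (S N t) - B t (Y t))"
              by (rule Henstock_Kurzweil_Integration.integral_diff[symmetric]) (use int[OF Scont uv] int[OF Yc uv] in auto)
            also have "norm \<dots> \<le> integral {u..v} (\<lambda>t. \<phi> t * e')"
            proof (rule integral_norm_bound_integral)
              show "(\<lambda>t. B t (S N t) - B t (Y t)) integrable_on {u..v}"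
                using int[OF Scont uv] int[OF Yc uv] by (rule integrable_diff)
              show "(\<lambda>t. \<phi> t * e') integrable_on {u..v}"
                by (rule integrable_on_mult_left[OF integrable_subinterval_real[OF \<phi>i sub]])
              fix t assume t: "t \<in> {u..v}"
              have "norm (B t (S N t) - B t (Y t)) = norm (B t (S N t - Y t))" by (simp add: linear_diff[OF B_linear])
              also have "\<dots> \<le> \<phi> t * norm (S N t - Y t)" by (rule B_bound)
              also have "\<dots> \<le> \<phi> t * e'"
              proof (rule mult_left_mono[OF _ \<phi>_nonneg])
                have "t \<in> {l..h}" using t sub by blast
                then show "norm (S N t - Y t) \<le> e'" using close by (simp add: dist_norm less_imp_le)
              qed
              finally show "norm (B t (S N t) - B t (Y t)) \<le> \<phi> t * e'" .
            qed
            also have "\<dots> = integral {u..v} \<phi> * e'" by simp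
            also have "\<dots> \<le> I * e'" unfolding I_def
              using e' by (intro mult_right_mono integral_subset_le[OF sub integrable_subinterval_real[OF \<phi>i sub] \<phi>i]) (auto simp: \<phi>_nonneg)
            finally show ?thesis .
          qed
          have "I * e' < e" using \<open>e > 0\<close> I0 by (simp add: e'_def field_simps)
          moreover have "dist (signed_integral c x (\<lambda>t. B t (S N t))) (signed_integral c x (\<lambda>t. B t (Y t))) \<le> I * e'"
          proof (cases "c \<le> x")
            case True then show ?thesis using bnd[of c x] x lh by (simp add: signed_integral_def dist_norm)
          next
            case False then show ?thesis using bnd[of x c] x lh by (simp add: signed_integral_def dist_norm norm_minus_commute)
          qed
          ultimately show "dist (signed_integral c x (\<lambda>t. B t (S N t))) (signed_integral c x (\<lambda>t. B t (Y t))) < e"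
            by linarith
        qed
      qed
      then have "(\<lambda>N. S (Suc N) x) \<longlonglongrightarrow> y0 + signed_integral c x (\<lambda>t. B t (Y t))"
        unfolding S_Suc[OF x] by (intro tendsto_intros)
      with lim1 show ?thesis by (rule LIMSEQ_unique)
    qed
    with Yc show ?thesis by blast
  qed
  show thesis
  proof (rule that)
    have "Y c = y0 + signed_integral c c (\<lambda>t. B t (Y t))" using main[of c c] ac cb by simp
    then show "Y c = y0" by (simp add: signed_integral_def)
  next
    fix l h assume lh: "a < ereal l" "ereal h < b"
    \<comment> \<open>The claim \<open>main\<close> is about intervals containing the base point
      \<open>c\<close>, so \<open>{l..h}\<close> is enlarged to reach it.\<close>
    have m: "a < ereal (min l c)" "ereal (max h c) < b" using lh ac cb by (auto simp: min_def max_def)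
    have cont: "continuous_on {min l c..max h c} Y" using main[OF m] by auto
    then show "continuous_on {l..h} Y" by (rule continuous_on_subset) auto
    assume "l \<le> h"
    have i: "(\<lambda>t. B t (Y t)) integrable_on {min l c..max h c}"
      by (rule set_lebesgue_integral_eq_integral(1)[OF B_integrable[OF m cont]])
    have "l \<in> {min l c..max h c}" "h \<in> {min l c..max h c}" using \<open>l \<le> h\<close> by auto
    then have "Y l = y0 + signed_integral c l (\<lambda>t. B t (Y t))" "Y h = y0 + signed_integral c h (\<lambda>t. B t (Y t))"
      using main[OF m] by auto
    then show "Y h - Y l = integral {l..h} (\<lambda>t. B t (Y t))"
      using signed_integral_diff[OF i, of c l h] \<open>l \<le> h\<close> by simp
  qed
qed

end

section \<open>The Sturm-Liouville system\<close>

text \<open>The set where two continuous functions differ is open, and an open null set is empty.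
  This makes the representative chosen in \<open>quasi_deriv\<close> unique on the interval.\<close>

lemma AC_loc_eq_if_AE_eq:
  assumes f: "AC_loc a b f" and g: "AC_loc a b g"
    and eq: "AE x in lebesgue_on (einterval a b). f x = g x" and x: "x \<in> einterval a b"
  shows "f x = g x"
proof (rule ccontr)
  assume ne: "f x \<noteq> g x"
  define V where "V = einterval a b \<inter> (\<lambda>x. f x - g x) -` (- {0})"
  have "open V" unfolding V_def
    by (intro continuous_open_preimage continuous_intros AC_loc_continuous_on f g open_einterval open_Compl closed_singleton)
  moreover have "x \<in> V" using x ne by (simp add: V_def)
  moreover have "negligible V"
    by (rule negligible_subset[OF eq[unfolded AE_lebesgue_on_iff_negligible[OF einterval_lebesgue]]]) (auto simp: V_def)
  ultimately show False using open_not_negligible by blast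
qed

lemma absolutely_integrable_of_real_mult:
  fixes Y :: "real \<Rightarrow> complex"
  assumes k: "k absolutely_integrable_on {l..h}" and Y: "continuous_on {l..h} Y"
  shows "(\<lambda>t. of_real (k t) * Y t) absolutely_integrable_on {l..h}"
proof -
  have "(\<lambda>t. k t *\<^sub>R Y t) absolutely_integrable_on {l..h}"
  proof (rule absolutely_integrable_bounded_measurable_product[where h="\<lambda>y k. k *\<^sub>R y" and f=Y and g=k, OF _ _ _ _ k])
    show "bilinear (\<lambda>(y::complex) (k::real). k *\<^sub>R y)"
      by (auto simp: bilinear_def linear_iff algebra_simps)
    show "Y \<in> borel_measurable (lebesgue_on {l..h})"
      using Y by (intro continuous_imp_measurable_on_sets_lebesgue) auto
    show "bounded (Y ` {l..h})"
      using Y by (auto intro!: compact_imp_bounded compact_continuous_image)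
  qed auto
  then show ?thesis by (simp add: scaleR_conv_of_real)
qed

lemma absolutely_integrable_Pair:
  fixes f :: "real \<Rightarrow> 'a::euclidean_space" and g :: "real \<Rightarrow> 'b::euclidean_space"
  assumes "f absolutely_integrable_on S" "g absolutely_integrable_on S"
  shows "(\<lambda>x. (f x, g x)) absolutely_integrable_on S"
proof -
  have "bounded_linear (\<lambda>x::'a. (x, 0::'b))" "bounded_linear (\<lambda>y::'b. (0::'a, y))"
    by (intro bounded_linear_Pair bounded_linear_ident bounded_linear_zero)+
  from absolutely_integrable_linear[OF assms(1) this(1)] absolutely_integrable_linear[OF assms(2) this(2)]
  have "(\<lambda>x. (f x, 0) + (0, g x)) absolutely_integrable_on S"
    by (intro set_integral_add) (auto simp: o_def)
  then show ?thesis by simp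
qed

locale sturm_liouville =
  fixes a b :: ereal and p q r s :: "real \<Rightarrow> real"
  assumes ab: "a < b"
    and r_measurable: "r \<in> borel_measurable (lebesgue_on (einterval a b))"
    and p_loc: "locally_integrable a b (\<lambda>x. 1 / p x)" and q_loc: "locally_integrable a b q"
    and r_loc: "locally_integrable a b r" and s_loc: "locally_integrable a b s"
    and r_pos: "AE x in lebesgue_on (einterval a b). r x > 0"
    and p_nonzero: "AE x in lebesgue_on (einterval a b). p x \<noteq> 0"
begin

abbreviation "I \<equiv> einterval a b"
abbreviation "M \<equiv> weighted a b r"

text \<open>\<open>u\<close> solves \<open>(\<tau> - z) u = g\<close>, written as a first-order system for \<open>u\<close> and its quasi-derivative \<open>u1\<close>.\<close>

definition sl_pair :: "complex \<Rightarrow> (real \<Rightarrow> complex) \<Rightarrow> (real \<Rightarrow> complex) \<Rightarrow> (real \<Rightarrow> complex) \<Rightarrow> bool" where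
  "sl_pair z u u1 g \<longleftrightarrow> AC_loc a b u \<and> AC_loc a b u1 \<and>
     (AE x in lebesgue_on I.
        (u has_vector_derivative (of_real (1 / p x) * u1 x - of_real (s x) * u x)) (at x) \<and>
        (u1 has_vector_derivative (of_real (s x) * u1 x + of_real (q x) * u x - of_real (r x) * (z * u x + g x))) (at x))"

section \<open>Algebra of the first-order system and the Lagrange identity\<close>

lemma sl_pair_lincomb:
  assumes "sl_pair z u u1 g" "sl_pair z v v1 h"
  shows "sl_pair z (\<lambda>x. c * u x + d * v x) (\<lambda>x. c * u1 x + d * v1 x) (\<lambda>x. c * g x + d * h x)"
  unfolding sl_pair_def
proof (intro conjI)
  show "AC_loc a b (\<lambda>x. c * u x + d * v x)" "AC_loc a b (\<lambda>x. c * u1 x + d * v1 x)"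
    using assms by (auto simp: sl_pair_def intro!: AC_loc_add AC_loc_cmult)
  have ders: "AE x in lebesgue_on I.
        ((u has_vector_derivative (of_real (1 / p x) * u1 x - of_real (s x) * u x)) (at x) \<and>
        (u1 has_vector_derivative (of_real (s x) * u1 x + of_real (q x) * u x - of_real (r x) * (z * u x + g x))) (at x)) \<and>
        ((v has_vector_derivative (of_real (1 / p x) * v1 x - of_real (s x) * v x)) (at x) \<and>
        (v1 has_vector_derivative (of_real (s x) * v1 x + of_real (q x) * v x - of_real (r x) * (z * v x + h x))) (at x))"
    using assms unfolding sl_pair_def by (simp only: eventually_conj_iff simp_thms)
  show "AE x in lebesgue_on I.
        ((\<lambda>x. c * u x + d * v x) has_vector_derivative (of_real (1 / p x) * (c * u1 x + d * v1 x) - of_real (s x) * (c * u x + d * v x))) (at x) \<and>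
        ((\<lambda>x. c * u1 x + d * v1 x) has_vector_derivative (of_real (s x) * (c * u1 x + d * v1 x) + of_real (q x) * (c * u x + d * v x)
            - of_real (r x) * (z * (c * u x + d * v x) + (c * g x + d * h x)))) (at x)"
    using ders
  proof (rule eventually_mono, elim conjE, intro conjI)
    fix x assume du: "(u has_vector_derivative (of_real (1 / p x) * u1 x - of_real (s x) * u x)) (at x)"
      and dv: "(v has_vector_derivative (of_real (1 / p x) * v1 x - of_real (s x) * v x)) (at x)"
    show "((\<lambda>x. c * u x + d * v x) has_vector_derivative (of_real (1 / p x) * (c * u1 x + d * v1 x) - of_real (s x) * (c * u x + d * v x))) (at x)"
      by (rule has_vector_derivative_eq_rhs[OF has_vector_derivative_add[OF has_vector_derivative_mult_right[OF du] has_vector_derivative_mult_right[OF dv]]])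
         (simp add: algebra_simps)
  next
    fix x assume du: "(u1 has_vector_derivative (of_real (s x) * u1 x + of_real (q x) * u x - of_real (r x) * (z * u x + g x))) (at x)"
      and dv: "(v1 has_vector_derivative (of_real (s x) * v1 x + of_real (q x) * v x - of_real (r x) * (z * v x + h x))) (at x)"
    show "((\<lambda>x. c * u1 x + d * v1 x) has_vector_derivative (of_real (s x) * (c * u1 x + d * v1 x) + of_real (q x) * (c * u x + d * v x)
            - of_real (r x) * (z * (c * u x + d * v x) + (c * g x + d * h x)))) (at x)"
      by (rule has_vector_derivative_eq_rhs[OF has_vector_derivative_add[OF has_vector_derivative_mult_right[OF du] has_vector_derivative_mult_right[OF dv]]])
         (simp add: algebra_simps)
  qed
qed

lemma sl_pair_cnj:
  assumes "sl_pair z u u1 g"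
  shows "sl_pair (cnj z) (\<lambda>x. cnj (u x)) (\<lambda>x. cnj (u1 x)) (\<lambda>x. cnj (g x))"
  unfolding sl_pair_def
proof (intro conjI)
  show "AC_loc a b (\<lambda>x. cnj (u x))" "AC_loc a b (\<lambda>x. cnj (u1 x))"
    using assms by (auto simp: sl_pair_def intro!: AC_loc_cnj)
  have cn: "((\<lambda>x. cnj (f x)) has_vector_derivative D') (at x)" if "(f has_vector_derivative D) (at x)" "D' = cnj D" for f D D' and x :: real
    using bounded_linear.has_vector_derivative[OF bounded_linear_cnj that(1)] that(2) by simp
  have "AE x in lebesgue_on I.
        (u has_vector_derivative (of_real (1 / p x) * u1 x - of_real (s x) * u x)) (at x) \<and>
        (u1 has_vector_derivative (of_real (s x) * u1 x + of_real (q x) * u x - of_real (r x) * (z * u x + g x))) (at x)"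
    using assms by (simp add: sl_pair_def)
  then show "AE x in lebesgue_on I.
        ((\<lambda>x. cnj (u x)) has_vector_derivative (of_real (1 / p x) * cnj (u1 x) - of_real (s x) * cnj (u x))) (at x) \<and>
        ((\<lambda>x. cnj (u1 x)) has_vector_derivative (of_real (s x) * cnj (u1 x) + of_real (q x) * cnj (u x) - of_real (r x) * (cnj z * cnj (u x) + cnj (g x)))) (at x)"
  proof (rule eventually_mono)
    fix x
    assume *: "(u has_vector_derivative (of_real (1 / p x) * u1 x - of_real (s x) * u x)) (at x) \<and>
        (u1 has_vector_derivative (of_real (s x) * u1 x + of_real (q x) * u x - of_real (r x) * (z * u x + g x))) (at x)"
    show "((\<lambda>x. cnj (u x)) has_vector_derivative (of_real (1 / p x) * cnj (u1 x) - of_real (s x) * cnj (u x))) (at x) \<and>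
        ((\<lambda>x. cnj (u1 x)) has_vector_derivative (of_real (s x) * cnj (u1 x) + of_real (q x) * cnj (u x) - of_real (r x) * (cnj z * cnj (u x) + cnj (g x)))) (at x)"
      by (intro conjI cn[OF conjunct1[OF *]] cn[OF conjunct2[OF *]]) simp_all
  qed
qed

text \<open>Lagrange identity: in the derivative of the Wronskian all terms with \<open>p\<close>,
  \<open>q\<close>, \<open>s\<close> and \<open>z\<close> cancel, since both functions have the same
  \<open>z\<close> and neither is conjugated. Only the inhomogeneity survives.\<close>

lemma sl_pair_wronskian:
  assumes u: "sl_pair z u u1 (\<lambda>_. 0)" and v: "sl_pair z v v1 g"
    and lh: "a < ereal l" "ereal h < b" "l \<le> h"
  shows "((\<lambda>x. - (of_real (r x) * (u x * g x))) has_integral (u h * v1 h - u1 h * v h) - (u l * v1 l - u1 l * v l)) {l..h}"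
proof -
  have "((\<lambda>x. - (of_real (r x) * (u x * g x))) has_integral
      (u h * v1 h + (-1) * (u1 h * v h)) - (u l * v1 l + (-1) * (u1 l * v l))) {l..h}"
  proof (rule AC_loc_has_integral[OF _ lh])
    show "AC_loc a b (\<lambda>x. u x * v1 x + (-1) * (u1 x * v x))"
      using u v by (intro AC_loc_add AC_loc_cmult AC_loc_mult) (auto simp: sl_pair_def)
    have ders: "AE x in lebesgue_on I.
        ((u has_vector_derivative (of_real (1 / p x) * u1 x - of_real (s x) * u x)) (at x) \<and>
        (u1 has_vector_derivative (of_real (s x) * u1 x + of_real (q x) * u x - of_real (r x) * (z * u x + 0))) (at x)) \<and>
        ((v has_vector_derivative (of_real (1 / p x) * v1 x - of_real (s x) * v x)) (at x) \<and>
        (v1 has_vector_derivative (of_real (s x) * v1 x + of_real (q x) * v x - of_real (r x) * (z * v x + g x))) (at x))"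
      using u v unfolding sl_pair_def by (simp only: eventually_conj_iff simp_thms)
    show "AE x in lebesgue_on I. ((\<lambda>x. u x * v1 x + (-1) * (u1 x * v x)) has_vector_derivative - (of_real (r x) * (u x * g x))) (at x)"
      using ders
    proof (rule eventually_mono, elim conjE)
      fix x assume du: "(u has_vector_derivative (of_real (1 / p x) * u1 x - of_real (s x) * u x)) (at x)"
        and dv: "(v has_vector_derivative (of_real (1 / p x) * v1 x - of_real (s x) * v x)) (at x)"
        and du1: "(u1 has_vector_derivative (of_real (s x) * u1 x + of_real (q x) * u x - of_real (r x) * (z * u x + 0))) (at x)"
        and dv1: "(v1 has_vector_derivative (of_real (s x) * v1 x + of_real (q x) * v x - of_real (r x) * (z * v x + g x))) (at x)"
      show "((\<lambda>x. u x * v1 x + (-1) * (u1 x * v x)) has_vector_derivative - (of_real (r x) * (u x * g x))) (at x)"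
        by (rule has_vector_derivative_eq_rhs[OF has_vector_derivative_add[OF has_vector_derivative_mult[OF du dv1]
              has_vector_derivative_mult_right[OF has_vector_derivative_mult[OF du1 dv]]]])
           (simp add: algebra_simps)
    qed
  qed
  then show ?thesis by simp
qed

lemma wronskian_constant:
  assumes u: "sl_pair z u u1 (\<lambda>_. 0)" and v: "sl_pair z v v1 (\<lambda>_. 0)" and "x \<in> I" "y \<in> I"
  shows "u x * v1 x - u1 x * v x = u y * v1 y - u1 y * v y"
proof -
  have "u h * v1 h - u1 h * v h = u l * v1 l - u1 l * v l" if "l \<in> I" "h \<in> I" "l \<le> h" for l h
    using has_integral_unique[OF sl_pair_wronskian[OF u v, of l h] , of 0] that by (simp add: einterval_def)
  then show ?thesis using assms(3,4) by (metis linear)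
qed

text \<open>\<open>vector_derivative\<close> carries information only at points of
  differentiability; absolute continuity supplies these almost everywhere for \<open>h\<close> and
  its quasi-derivative, and \<open>p x \<noteq> 0\<close> and \<open>r x > 0\<close> permit solving
  for the two derivatives.\<close>

lemma tau_domain_imp_sl_pair:
  assumes h: "h \<in> tau_domain a b p s"
    and eq: "AE x in lebesgue_on I. tau a b p q r s h x = z * h x + g x"
  shows "sl_pair z h (quasi_deriv a b p s h) g"
proof -
  define h1 where "h1 = quasi_deriv a b p s h"
  have h1: "is_quasi_deriv a b p s h h1"
  proof -
    obtain g where qd: "is_quasi_deriv a b p s h g" using h by (auto simp: tau_domain_def)
    show ?thesis unfolding h1_def quasi_deriv_def
      by (rule someI_ex[OF exI[of "is_quasi_deriv a b p s h", OF qd]])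
  qed
  have ac: "AC_loc a b h" "AC_loc a b h1" using h h1 by (auto simp: tau_domain_def is_quasi_deriv_def)
  have q: "AE x in lebesgue_on I. h1 x = of_real (p x) * (vector_derivative h (at x) + of_real (s x) * h x)"
    using h1 by (simp add: is_quasi_deriv_def)
  have all: "AE x in lebesgue_on I. (tau a b p q r s h x = z * h x + g x) \<and>
      (h1 x = of_real (p x) * (vector_derivative h (at x) + of_real (s x) * h x)) \<and>
      ((h has_vector_derivative vector_derivative h (at x)) (at x)) \<and> ((h1 has_vector_derivative vector_derivative h1 (at x)) (at x)) \<and> r x > 0 \<and> p x \<noteq> 0"
    using eq q AC_loc_differentiable_AE[OF ac(1)] AC_loc_differentiable_AE[OF ac(2)] r_pos p_nonzero
    by (simp only: eventually_conj_iff simp_thms)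
  show ?thesis
    unfolding sl_pair_def h1_def[symmetric]
  proof (intro conjI ac, rule eventually_mono[OF all], elim conjE, intro conjI)
    fix x assume A: "h1 x = of_real (p x) * (vector_derivative h (at x) + of_real (s x) * h x)" "p x \<noteq> 0"
      and d: "(h has_vector_derivative vector_derivative h (at x)) (at x)"
    show "(h has_vector_derivative of_real (1 / p x) * h1 x - of_real (s x) * h x) (at x)"
      by (rule has_vector_derivative_eq_rhs[OF d]) (use A in \<open>simp add: field_simps\<close>)
  next
    fix x assume t: "tau a b p q r s h x = z * h x + g x" "r x > 0"
      and d: "(h1 has_vector_derivative vector_derivative h1 (at x)) (at x)"
    show "(h1 has_vector_derivative of_real (s x) * h1 x + of_real (q x) * h x - of_real (r x) * (z * h x + g x)) (at x)"
    proof (rule has_vector_derivative_eq_rhs[OF d])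
      have "(- vector_derivative h1 (at x) + of_real (s x) * h1 x + of_real (q x) * h x) / of_real (r x) = z * h x + g x"
        using t(1) by (simp add: tau_def h1_def Let_def)
      then have eq: "- vector_derivative h1 (at x) + of_real (s x) * h1 x + of_real (q x) * h x = of_real (r x) * (z * h x + g x)"
        using t(2) by (simp add: field_simps)
      show "vector_derivative h1 (at x) = of_real (s x) * h1 x + of_real (q x) * h x - of_real (r x) * (z * h x + g x)"
        unfolding eq[symmetric] by simp
    qed
  qed
qed

lemma vector_derivative_cong_open:
  assumes "open S" "x \<in> S" "\<And>y. y \<in> S \<Longrightarrow> f y = g y"
  shows "vector_derivative f (at x) = vector_derivative g (at x)"
proof (rule vector_derivative_cong_eq)
  show "\<forall>\<^sub>F y in nhds x. y \<in> UNIV \<longrightarrow> f y = g y"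
    using assms by (auto simp: eventually_nhds)
qed (use assms in auto)

lemma sl_pair_is_quasi_deriv:
  assumes "sl_pair z u u1 g" shows "is_quasi_deriv a b p s u u1"
proof -
  have "AE x in lebesgue_on I. (u has_vector_derivative (of_real (1 / p x) * u1 x - of_real (s x) * u x)) (at x) \<and> p x \<noteq> 0"
    using assms p_nonzero by (auto simp: sl_pair_def)
  then have "AE x in lebesgue_on I. u1 x = of_real (p x) * (vector_derivative u (at x) + of_real (s x) * u x)"
  proof (rule eventually_mono)
    fix x assume "(u has_vector_derivative (of_real (1 / p x) * u1 x - of_real (s x) * u x)) (at x) \<and> p x \<noteq> 0"
    then show "u1 x = of_real (p x) * (vector_derivative u (at x) + of_real (s x) * u x)"
      by (auto simp: vector_derivative_at)
  qed
  then show ?thesis using assms by (simp add: is_quasi_deriv_def sl_pair_def)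
qed

text \<open>\<open>quasi_deriv\<close> is a choice, so it has to be identified with the given
  \<open>u1\<close>: both agree almost everywhere with the expression \<open>p (u' + s u)\<close>,
  and hence on all of \<open>I\<close> by continuity.\<close>

lemma sl_pair_imp_tau_solution:
  assumes u: "sl_pair z u u1 (\<lambda>_. 0)" shows "tau_solution a b p q r s z u"
proof -
  note qd = sl_pair_is_quasi_deriv[OF u]
  define f1 where "f1 = quasi_deriv a b p s u"
  have f1: "is_quasi_deriv a b p s u f1" unfolding f1_def quasi_deriv_def
    by (rule someI_ex[OF exI[of "is_quasi_deriv a b p s u", OF qd]])
  have "AE x in lebesgue_on I. f1 x = u1 x"
  proof -
    have "AE x in lebesgue_on I. (f1 x = of_real (p x) * (vector_derivative u (at x) + of_real (s x) * u x)) \<and>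
       (u1 x = of_real (p x) * (vector_derivative u (at x) + of_real (s x) * u x))"
      using f1 qd by (simp add: is_quasi_deriv_def)
    then show ?thesis by (rule eventually_mono) simp
  qed
  then have eq: "f1 x = u1 x" if "x \<in> I" for x
    using AC_loc_eq_if_AE_eq[of a b f1 u1 x] f1 qd that by (simp add: is_quasi_deriv_def)
  have "AE x in lebesgue_on I. ((u1 has_vector_derivative (of_real (s x) * u1 x + of_real (q x) * u x - of_real (r x) * (z * u x + 0))) (at x) \<and> r x > 0) \<and> x \<in> I"
    using u r_pos AE_space[of "lebesgue_on I"] by (auto simp: sl_pair_def)
  then have "AE x in lebesgue_on I. tau a b p q r s u x - z * u x = 0"
  proof (rule eventually_mono)
    fix x assume x: "((u1 has_vector_derivative (of_real (s x) * u1 x + of_real (q x) * u x - of_real (r x) * (z * u x + 0))) (at x) \<and> r x > 0) \<and> x \<in> I"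
    have "vector_derivative f1 (at x) = vector_derivative u1 (at x)"
      using x eq by (intro vector_derivative_cong_open[of I]) auto
    also have "\<dots> = of_real (s x) * u1 x + of_real (q x) * u x - of_real (r x) * (z * u x)"
      using x by (auto simp: vector_derivative_at)
    finally show "tau a b p q r s u x - z * u x = 0"
      using x eq by (simp add: tau_def Let_def f1_def[symmetric])
  qed
  moreover have "u \<in> tau_domain a b p s" using u qd by (auto simp: tau_domain_def sl_pair_def)
  ultimately show ?thesis by (simp add: tau_solution_def)
qed

text \<open>Derivatives at points of the open set \<open>I\<close> depend only on values there. This
  serves the kernel integral, which equals a domain element on \<open>I\<close> but may differ from
  it outside.\<close>

lemma tau_domain_cong:
  assumes f: "f \<in> tau_domain a b p s" and eq: "\<And>x. x \<in> I \<Longrightarrow> g x = f x"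
  shows "g \<in> tau_domain a b p s"
proof -
  obtain f1 where f1: "is_quasi_deriv a b p s f f1" using f by (auto simp: tau_domain_def)
  have "AE x in lebesgue_on I. (f1 x = of_real (p x) * (vector_derivative f (at x) + of_real (s x) * f x)) \<and> x \<in> I"
    using f1 AE_space[of "lebesgue_on I"] by (simp add: is_quasi_deriv_def)
  then have "AE x in lebesgue_on I. f1 x = of_real (p x) * (vector_derivative g (at x) + of_real (s x) * g x)"
  proof (rule eventually_mono)
    fix x assume x: "(f1 x = of_real (p x) * (vector_derivative f (at x) + of_real (s x) * f x)) \<and> x \<in> I"
    have "vector_derivative g (at x) = vector_derivative f (at x)"
      using x eq by (intro vector_derivative_cong_open[of I]) auto
    then show "f1 x = of_real (p x) * (vector_derivative g (at x) + of_real (s x) * g x)"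
      using x eq by simp
  qed
  moreover have "AC_loc a b g" using f eq AC_loc_cong[of a b g f] by (simp add: tau_domain_def)
  ultimately show ?thesis using f1 by (auto simp: tau_domain_def is_quasi_deriv_def)
qed

lemma initial_value_problem:
  fixes z \<alpha> \<beta> :: complex
  assumes c: "c \<in> I"
  obtains u u1 where "sl_pair z u u1 (\<lambda>_. 0)" "u c = \<alpha>" "u1 c = \<beta>"
proof -
  \<comment> \<open>Sum of the moduli of the entries of the coefficient matrix, hence a bound for
    its norm; \<open>s\<close> occurs in both rows.\<close>
  define \<phi> where "\<phi> t = \<bar>1 / p t\<bar> + 2 * \<bar>s t\<bar> + \<bar>q t\<bar> + \<bar>r t\<bar> * cmod z" for t
  define B where "B t y = (of_real (1 / p t) * snd y - of_real (s t) * fst y,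
      of_real (s t) * snd y + of_real (q t) * fst y - of_real (r t) * (z * fst y))" for t and y :: "complex \<times> complex"
  have loc: "(\<lambda>t. 1 / p t) absolutely_integrable_on {l..h}" "q absolutely_integrable_on {l..h}"
    "r absolutely_integrable_on {l..h}" "s absolutely_integrable_on {l..h}" if "a < ereal l" "ereal h < b" for l h
    using p_loc q_loc r_loc s_loc that unfolding locally_integrable_def by blast+
  interpret linear_volterra a b c \<phi> B
  proof (rule linear_volterra.intro)
    show "a < ereal c" "ereal c < b" using c by (auto simp: einterval_def)
    show "\<phi> absolutely_integrable_on {l..h}" if "a < ereal l" "ereal h < b" for l h
      unfolding \<phi>_def using loc[OF that]
      by (intro set_integral_add set_integrable_mult_right set_integrable_mult_left set_integrable_abs) auto
    show "\<phi> x \<ge> 0" for x by (simp add: \<phi>_def)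
    show "linear (B x)" for x
      by (rule linearI) (auto simp: B_def algebra_simps scaleR_conv_of_real add_divide_distrib)
    show "norm (B x y) \<le> \<phi> x * norm y" for x y
    proof -
      have f: "cmod (fst y) \<le> norm y" and s: "cmod (snd y) \<le> norm y" using norm_fst_le[of "fst y" "snd y"] norm_snd_le[of "snd y" "fst y"] by simp_all
      have "norm (B x y) \<le> cmod (of_real (1 / p x) * snd y - of_real (s x) * fst y)
          + cmod (of_real (s x) * snd y + of_real (q x) * fst y - of_real (r x) * (z * fst y))"
        unfolding B_def by (rule norm_Pair_le)
      also have "\<dots> \<le> (cmod (of_real (1 / p x) * snd y) + cmod (of_real (s x) * fst y))
         + (cmod (of_real (s x) * snd y) + cmod (of_real (q x) * fst y) + cmod (of_real (r x) * (z * fst y)))"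
        by (intro add_mono norm_triangle_ineq4 order_trans[OF norm_triangle_ineq4] norm_triangle_ineq order_refl)
      also have "\<dots> = (\<bar>1 / p x\<bar> * cmod (snd y) + \<bar>s x\<bar> * cmod (fst y))
         + (\<bar>s x\<bar> * cmod (snd y) + \<bar>q x\<bar> * cmod (fst y) + \<bar>r x\<bar> * (cmod z * cmod (fst y)))"
        by (simp add: norm_mult norm_divide)
      also have "\<dots> \<le> (\<bar>1 / p x\<bar> * norm y + \<bar>s x\<bar> * norm y) + (\<bar>s x\<bar> * norm y + \<bar>q x\<bar> * norm y + \<bar>r x\<bar> * (cmod z * norm y))"
        using f s by (intro add_mono mult_left_mono) auto
      also have "\<dots> = \<phi> x * norm y" by (simp add: \<phi>_def algebra_simps)
      finally show ?thesis .
    qed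
    show "(\<lambda>x. B x (Y x)) absolutely_integrable_on {l..h}" if "a < ereal l" "ereal h < b" "continuous_on {l..h} Y" for l h and Y :: "real \<Rightarrow> complex \<times> complex"
    proof -
      note loc = loc[OF that(1,2)]
      have c: "continuous_on {l..h} (\<lambda>x. fst (Y x))" "continuous_on {l..h} (\<lambda>x. snd (Y x))" "continuous_on {l..h} (\<lambda>x. z * fst (Y x))"
        using that(3) by (auto intro!: continuous_intros)
      show ?thesis unfolding B_def
        by (intro absolutely_integrable_Pair set_integral_diff set_integral_add absolutely_integrable_of_real_mult loc c)
    qed
  qed
  obtain Y where Yc: "Y c = (\<alpha>, \<beta>)" and Ycont: "\<And>l h. a < ereal l \<Longrightarrow> ereal h < b \<Longrightarrow> continuous_on {l..h} Y"
    and Yint: "\<And>l h. a < ereal l \<Longrightarrow> ereal h < b \<Longrightarrow> l \<le> h \<Longrightarrow> Y h - Y l = integral {l..h} (\<lambda>t. B t (Y t))"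
    by (rule solution_exists[of "(\<alpha>,\<beta>)"]) blast
  have AC: "AC l h (\<lambda>x. fst (Y x)) \<and> AC l h (\<lambda>x. snd (Y x))" if lh: "a < ereal l" "ereal h < b" for l h
  proof -
    have BY: "(\<lambda>t. B t (Y t)) absolutely_integrable_on {l..h}" by (rule B_integrable[OF lh Ycont[OF lh]])
    have n: "(\<lambda>t. norm (B t (Y t))) absolutely_integrable_on {l..h}"
      using absolutely_integrable_norm[OF BY] by (simp add: o_def)
    have bound: "norm (Y y - Y x) \<le> integral {x..y} (\<lambda>t. norm (B t (Y t)))" if "l \<le> x" "x \<le> y" "y \<le> h" for x y
    proof -
      have "a < ereal x" "ereal y < b" using that lh
        by (meson ereal_less_eq(3) less_le_trans le_less_trans)+
      then have "norm (Y y - Y x) = norm (integral {x..y} (\<lambda>t. B t (Y t)))" using Yint that by simp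
      also have "\<dots> \<le> integral {x..y} (\<lambda>t. norm (B t (Y t)))"
        by (rule integral_norm_bound_integral; (rule integrable_subinterval_real[OF set_lebesgue_integral_eq_integral(1)[OF BY]] integrable_subinterval_real[OF set_lebesgue_integral_eq_integral(1)[OF n]])?)
           (use that in auto)
      finally show ?thesis .
    qed
    show ?thesis
    proof
      show "AC l h (\<lambda>x. fst (Y x))"
      proof (rule AC_of_integral_bound[OF n])
        fix x y assume *: "l \<le> x" "x \<le> y" "y \<le> h"
        have "cmod (fst (Y y) - fst (Y x)) \<le> norm (Y y - Y x)" using norm_fst_le[of "fst (Y y - Y x)" "snd (Y y - Y x)"] unfolding prod.collapse by simp
        then show "cmod (fst (Y y) - fst (Y x)) \<le> integral {x..y} (\<lambda>t. norm (B t (Y t)))" using bound[OF *] by linarith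
      qed auto
      show "AC l h (\<lambda>x. snd (Y x))"
      proof (rule AC_of_integral_bound[OF n])
        fix x y assume *: "l \<le> x" "x \<le> y" "y \<le> h"
        have "cmod (snd (Y y) - snd (Y x)) \<le> norm (Y y - Y x)" using norm_snd_le[of "snd (Y y - Y x)" "fst (Y y - Y x)"] unfolding prod.collapse by simp
        then show "cmod (snd (Y y) - snd (Y x)) \<le> integral {x..y} (\<lambda>t. norm (B t (Y t)))" using bound[OF *] by linarith
      qed auto
    qed
  qed
  \<comment> \<open>The integral equation becomes a differential equation almost everywhere by the
    differentiation theorem for indefinite integrals.\<close>
  have dY: "AE x in lebesgue_on I. (Y has_vector_derivative B x (Y x)) (at x)"
  proof (rule AE_einterval_compactI)
    fix l h assume lh: "a < ereal l" "l < h" "ereal h < b"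
    have i: "(\<lambda>t. B t (Y t)) integrable_on {l..h}"
      by (rule set_lebesgue_integral_eq_integral(1)[OF B_integrable[OF lh(1,3) Ycont[OF lh(1,3)]]])
    show "negligible {x \<in> {l<..<h}. \<not> (Y has_vector_derivative B x (Y x)) (at x)}"
    proof (rule negligible_subset[OF indefinite_integral_has_vector_derivative_AE[OF i]], rule subsetI, rule ccontr)
      fix x assume "x \<in> {x \<in> {l<..<h}. \<not> (Y has_vector_derivative B x (Y x)) (at x)}"
        "x \<notin> {x \<in> {l<..<h}. \<not> ((\<lambda>y. integral {l..y} (\<lambda>t. B t (Y t))) has_vector_derivative B x (Y x)) (at x)}"
      then have x: "x \<in> {l<..<h}" and d: "((\<lambda>y. integral {l..y} (\<lambda>t. B t (Y t))) has_vector_derivative B x (Y x)) (at x)"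
        and nd: "\<not> (Y has_vector_derivative B x (Y x)) (at x)" by auto
      have "(Y has_vector_derivative B x (Y x)) (at x)"
      proof (rule has_vector_derivative_transform_within_open[of "\<lambda>y. integral {l..y} (\<lambda>t. B t (Y t)) + Y l" _ _ "{l<..<h}"])
        show "((\<lambda>y. integral {l..y} (\<lambda>t. B t (Y t)) + Y l) has_vector_derivative B x (Y x)) (at x)"
          using has_vector_derivative_add[OF d has_vector_derivative_const, of "Y l"] by simp
        fix y assume y: "y \<in> {l<..<h}"
        then have "ereal y < b" using le_less_trans[of "ereal y" "ereal h" b] lh by auto
        then have "Y y - Y l = integral {l..y} (\<lambda>t. B t (Y t))" using Yint[of l y] lh y by simp
        then show "integral {l..y} (\<lambda>t. B t (Y t)) + Y l = Y y" by (simp add: algebra_simps)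
      qed (use x in auto)
      with nd show False ..
    qed
  qed
  have "sl_pair z (\<lambda>x. fst (Y x)) (\<lambda>x. snd (Y x)) (\<lambda>_. 0)"
    unfolding sl_pair_def
  proof (intro conjI)
    show "AC_loc a b (\<lambda>x. fst (Y x))" "AC_loc a b (\<lambda>x. snd (Y x))" using AC by (auto simp: AC_loc_def)
    show "AE x in lebesgue_on I. ((\<lambda>x. fst (Y x)) has_vector_derivative (of_real (1 / p x) * snd (Y x) - of_real (s x) * fst (Y x))) (at x) \<and>
        ((\<lambda>x. snd (Y x)) has_vector_derivative (of_real (s x) * snd (Y x) + of_real (q x) * fst (Y x) - of_real (r x) * (z * fst (Y x) + 0))) (at x)"
      using dY
    proof (rule eventually_mono)
      fix x assume d: "(Y has_vector_derivative B x (Y x)) (at x)"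
      show "((\<lambda>x. fst (Y x)) has_vector_derivative (of_real (1 / p x) * snd (Y x) - of_real (s x) * fst (Y x))) (at x) \<and>
        ((\<lambda>x. snd (Y x)) has_vector_derivative (of_real (s x) * snd (Y x) + of_real (q x) * fst (Y x) - of_real (r x) * (z * fst (Y x) + 0))) (at x)"
        using bounded_linear.has_vector_derivative[OF bounded_linear_fst d] bounded_linear.has_vector_derivative[OF bounded_linear_snd d]
        by (simp add: B_def)
    qed
  qed
  then show thesis using Yc by (intro that[of "\<lambda>x. fst (Y x)" "\<lambda>x. snd (Y x)"]) simp_all
qed

text \<open>Initial values forming the identity matrix give Wronskian 1 at one point, and the
  Wronskian is constant.\<close>

lemma fundamental_system:
  obtains u1 v1 u2 v2 where "sl_pair z u1 v1 (\<lambda>_. 0)" "sl_pair z u2 v2 (\<lambda>_. 0)"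
    "\<And>x. x \<in> I \<Longrightarrow> u1 x * v2 x - v1 x * u2 x = 1"
proof -
  obtain c where "a < ereal c" "ereal c < b" using ereal_dense2[OF ab] by blast
  then have c: "c \<in> I" by (simp add: einterval_def)
  obtain u1 v1 where 1: "sl_pair z u1 v1 (\<lambda>_. 0)" "u1 c = 1" "v1 c = 0" using initial_value_problem[OF c] by metis
  obtain u2 v2 where 2: "sl_pair z u2 v2 (\<lambda>_. 0)" "u2 c = 0" "v2 c = 1" using initial_value_problem[OF c] by metis
  show thesis
  proof (rule that[OF 1(1) 2(1)])
    fix x assume "x \<in> I"
    from wronskian_constant[OF 1(1) 2(1) this c] 1 2 show "u1 x * v2 x - v1 x * u2 x = 1" by simp
  qed
qed

end

section \<open>Square integrable functions and Hilbert-Schmidt operators\<close>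

lemma L2_mult_integrable:
  assumes "f \<in> L2 M" "g \<in> L2 M" shows "integrable M (\<lambda>x. f x * g x)"
proof (rule Bochner_Integration.integrable_bound)
  show "integrable M (\<lambda>x. (cmod (f x))\<^sup>2 + (cmod (g x))\<^sup>2)"
    using assms by (auto simp: L2_def)
  show "(\<lambda>x. f x * g x) \<in> borel_measurable M" using assms by (auto simp: L2_def)
  have "cmod (f x) * cmod (g x) \<le> (cmod (f x))\<^sup>2 + (cmod (g x))\<^sup>2" for x
    using sum_squares_bound[of "cmod (f x)" "cmod (g x)"] mult_nonneg_nonneg[OF norm_ge_zero[of "f x"] norm_ge_zero[of "g x"]] by linarith
  then show "AE x in M. norm (f x * g x) \<le> norm ((cmod (f x))\<^sup>2 + (cmod (g x))\<^sup>2)"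
    by (simp add: norm_mult)
qed

lemma L2_cmult: "f \<in> L2 M \<Longrightarrow> (\<lambda>x. c * f x) \<in> L2 M"
  by (auto simp: L2_def norm_mult power_mult_distrib)

lemma L2_cnj: "f \<in> L2 M \<Longrightarrow> (\<lambda>x. cnj (f x)) \<in> L2 M"
  using measurable_compose[OF _ borel_measurable_continuous_onI[OF continuous_on_cnj[OF continuous_on_id]], of f M]
  by (simp add: L2_def)

lemma L2_add:
  assumes "f \<in> L2 M" "g \<in> L2 M" shows "(\<lambda>x. f x + g x) \<in> L2 M"
  unfolding L2_def
proof (intro CollectI conjI)
  show "integrable M (\<lambda>x. (cmod (f x + g x))\<^sup>2)"
  proof (rule Bochner_Integration.integrable_bound)
    show "integrable M (\<lambda>x. 2 * (cmod (f x))\<^sup>2 + 2 * (cmod (g x))\<^sup>2)"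
      using assms by (auto simp: L2_def)
    show "(\<lambda>x. (cmod (f x + g x))\<^sup>2) \<in> borel_measurable M" using assms by (auto simp: L2_def)
    have "(cmod (f x + g x))\<^sup>2 \<le> 2 * (cmod (f x))\<^sup>2 + 2 * (cmod (g x))\<^sup>2" for x
    proof -
      have "(cmod (f x + g x))\<^sup>2 \<le> (cmod (f x) + cmod (g x))\<^sup>2"
        by (intro power_mono norm_triangle_ineq) auto
      also have "\<dots> \<le> 2 * (cmod (f x))\<^sup>2 + 2 * (cmod (g x))\<^sup>2"
        using sum_squares_bound[of "cmod (f x)" "cmod (g x)"] by (simp add: power2_sum)
      finally show ?thesis .
    qed
    then show "AE x in M. norm ((cmod (f x + g x))\<^sup>2) \<le> norm (2 * (cmod (f x))\<^sup>2 + 2 * (cmod (g x))\<^sup>2)"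
      by simp
  qed
qed (use assms in \<open>auto simp: L2_def\<close>)

lemma L2_cong_AE:
  assumes "f \<in> L2 M" "g \<in> borel_measurable M" "AE x in M. g x = f x" shows "g \<in> L2 M"
proof -
  have "integrable M (\<lambda>x. (cmod (f x))\<^sup>2) \<longleftrightarrow> integrable M (\<lambda>x. (cmod (g x))\<^sup>2)"
    using assms by (intro integrable_cong_AE) (auto simp: L2_def elim: eventually_mono)
  then show ?thesis using assms by (auto simp: L2_def)
qed

section \<open>Orthonormal systems and Bessel's inequality\<close>

lemma L2_inner_self: "f \<in> L2 M \<Longrightarrow> L2_inner M f f = of_real (\<integral>x. (cmod (f x))\<^sup>2 \<partial>M)"
  unfolding L2_inner_def
  by (subst integral_complex_of_real[symmetric]) (simp add: complex_norm_square mult.commute flip: of_real_power)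

lemma L2_inner_commute: "L2_inner M f g = cnj (L2_inner M g f)"
proof -
  have "cnj (L2_inner M g f) = (\<integral>x. cnj (cnj (g x) * f x) \<partial>M)"
    unfolding L2_inner_def by (rule Bochner_Integration.integral_cnj[symmetric])
  then show ?thesis by (simp add: L2_inner_def mult.commute)
qed

text \<open>Zorn's lemma: a function orthogonal to a maximal orthonormal set and not almost
  everywhere zero could be normalised and added. Two representatives of the same vector never both
  belong to an orthonormal set, because their inner product would be 1 instead of 0.\<close>

lemma L2_orthonormal_basis_exists: "\<exists>E. L2_orthonormal_basis M E"
proof -
  define ON where "ON E \<longleftrightarrow> E \<subseteq> L2 M \<and> (\<forall>e\<in>E. \<forall>e'\<in>E. L2_inner M e e' = (if e = e' then 1 else 0))" for E
  have "\<exists>E\<in>{E. ON E}. \<forall>X\<in>{E. ON E}. E \<subseteq> X \<longrightarrow> X = E"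
  proof (rule subset_Zorn_nonempty)
    show "{E. ON E} \<noteq> {}" by (auto simp: ON_def intro: exI[of _ "{}"])
    fix \<C> assume "\<C> \<noteq> {}" and ch: "subset.chain {E. ON E} \<C>"
    have mem: "ON E" if "E \<in> \<C>" for E using ch that by (auto simp: subset.chain_def)
    show "\<Union>\<C> \<in> {E. ON E}"
      unfolding mem_Collect_eq ON_def
    proof (intro conjI ballI)
      show "\<Union>\<C> \<subseteq> L2 M" using mem by (auto simp: ON_def)
      fix e e' assume "e \<in> \<Union>\<C>" "e' \<in> \<Union>\<C>"
      then obtain E E' where E: "E \<in> \<C>" "e \<in> E" "E' \<in> \<C>" "e' \<in> E'" by (elim UnionE)
      have "E \<subseteq> E' \<or> E' \<subseteq> E" using ch E(1,3) by (simp add: subset_chain_def)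
      then show "L2_inner M e e' = (if e = e' then 1 else 0)"
      proof
        assume "E \<subseteq> E'"
        then have "e \<in> E'" using E(2) by (rule subsetD)
        then show ?thesis using mem[OF E(3)] E(4) by (simp add: ON_def)
      next
        assume "E' \<subseteq> E"
        then have "e' \<in> E" using E(4) by (rule subsetD)
        then show ?thesis using mem[OF E(1)] E(2) by (simp add: ON_def)
      qed
    qed
  qed
  then obtain E where E: "ON E" and max: "\<And>X. ON X \<Longrightarrow> E \<subseteq> X \<Longrightarrow> X = E" by blast
  have "AE x in M. f x = 0" if f: "f \<in> L2 M" and orth: "\<forall>e\<in>E. L2_inner M e f = 0" for f
  proof (rule ccontr)
    assume nz: "\<not> (AE x in M. f x = 0)"
    define N where "N = (\<integral>x. (cmod (f x))\<^sup>2 \<partial>M)"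
    have "N \<noteq> 0"
      using integral_nonneg_eq_0_iff_AE[of M "\<lambda>x. (cmod (f x))\<^sup>2"] f nz by (auto simp: N_def L2_def)
    moreover have "N \<ge> 0" unfolding N_def by (rule integral_nonneg_AE) simp
    ultimately have N: "N > 0" by simp
    define k where "k = complex_of_real (1 / sqrt N)"
    define f' where "f' x = k * f x" for x
    have f'L: "f' \<in> L2 M" unfolding f'_def by (rule L2_cmult[OF f])
    have "L2_inner M f' f' = cnj k * k * L2_inner M f f"
      unfolding L2_inner_def f'_def by (subst integral_mult_right_zero[symmetric]) (simp add: algebra_simps)
    also have "\<dots> = of_real (1 / sqrt N * (1 / sqrt N) * N)"
      unfolding L2_inner_self[OF f] N_def[symmetric] by (simp only: k_def complex_cnj_complex_of_real of_real_mult)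
    also have "1 / sqrt N * (1 / sqrt N) * N = 1" using N by simp
    finally have one: "L2_inner M f' f' = 1" by simp
    have zero: "L2_inner M e f' = 0" if "e \<in> E" for e
    proof -
      have "L2_inner M e f' = k * L2_inner M e f"
        unfolding L2_inner_def f'_def by (subst integral_mult_right_zero[symmetric]) (simp add: algebra_simps)
      then show ?thesis using orth that by simp
    qed
    have zero': "L2_inner M f' e = 0" if "e \<in> E" for e
      using zero[OF that] by (subst L2_inner_commute) simp
    have "f' \<notin> E" using one zero by auto
    have "ON (insert f' E)"
      unfolding ON_def using E f'L one zero zero' \<open>f' \<notin> E\<close> by (auto simp: ON_def)
    then have "insert f' E = E" by (rule max) auto
    with \<open>f' \<notin> E\<close> show False by blast
  qed
  then have "L2_orthonormal_basis M E" using E unfolding L2_orthonormal_basis_def ON_def by blast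
  then show ?thesis ..
qed

text \<open>The pairing of \<open>k\<close> with \<open>e\<close> is bilinear because a row of an
  integral kernel acts on a basis vector in this way; the usual inequality is applied to the
  conjugate of \<open>k\<close>.\<close>

lemma bessel_inequality:
  assumes F: "finite F" "F \<subseteq> L2 M" "\<And>e e'. e \<in> F \<Longrightarrow> e' \<in> F \<Longrightarrow> L2_inner M e e' = (if e = e' then 1 else 0)"
    and k: "k \<in> L2 M"
  shows "(\<Sum>e\<in>F. (cmod (\<integral>x. k x * e x \<partial>M))\<^sup>2) \<le> (\<integral>x. (cmod (k x))\<^sup>2 \<partial>M)"
proof -
  define w where "w x = cnj (k x)" for x
  have w: "w \<in> L2 M" unfolding w_def by (rule L2_cnj[OF k])
  define d where "d e = L2_inner M e w" for e
  have dk: "cmod (\<integral>x. k x * e x \<partial>M) = cmod (d e)" for e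
  proof -
    have "(\<integral>x. k x * e x \<partial>M) = L2_inner M w e" by (simp add: L2_inner_def w_def)
    then show ?thesis unfolding d_def by (subst (asm) L2_inner_commute) simp
  qed
  \<comment> \<open>Orthogonal projection of \<open>w\<close> onto the span of \<open>F\<close>;
    expanding the squared distance of \<open>S\<close> from \<open>w\<close> gives the squared norm
    of \<open>w\<close> minus \<open>D\<close>.\<close>
  define S where "S x = (\<Sum>e\<in>F. d e * e x)" for x
  have inner_int: "integrable M (\<lambda>x. cnj (f x) * g x)" if "f \<in> L2 M" "g \<in> L2 M" for f g
    using L2_mult_integrable[OF L2_cnj[OF that(1)] that(2)] .
  have sum_L2: "(\<lambda>x. \<Sum>e\<in>A. d e * e x) \<in> L2 M" if "A \<subseteq> F" for A
  proof -
    have "finite A" using that F(1) by (rule finite_subset)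
    then show ?thesis using that
    proof (induction A)
      case empty then show ?case by (simp add: L2_def)
    next
      case (insert e A) then show ?case using F(2) by (auto intro!: L2_add L2_cmult)
    qed
  qed
  have S: "S \<in> L2 M" unfolding S_def by (rule sum_L2) simp
  have innerS: "L2_inner M S g = (\<Sum>e\<in>F. cnj (d e) * L2_inner M e g)" if g: "g \<in> L2 M" for g
  proof -
    have "L2_inner M S g = (\<integral>x. (\<Sum>e\<in>F. cnj (d e) * (cnj (e x) * g x)) \<partial>M)"
      unfolding L2_inner_def S_def by (simp add: sum_distrib_right mult.assoc)
    also have "\<dots> = (\<Sum>e\<in>F. \<integral>x. cnj (d e) * (cnj (e x) * g x) \<partial>M)"
      by (rule Bochner_Integration.integral_sum) (use inner_int g F(2) in auto)
    finally show ?thesis by (simp add: L2_inner_def)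
  qed
  define D where "D = (\<Sum>e\<in>F. (cmod (d e))\<^sup>2)"
  have Sw: "L2_inner M S w = of_real D"
    unfolding innerS[OF w] D_def unfolding d_def[symmetric] by (simp add: complex_norm_square mult.commute flip: of_real_power)
  have eS: "L2_inner M e S = d e" if e: "e \<in> F" for e
  proof -
    have eL: "e \<in> L2 M" using e F(2) by blast
    have "L2_inner M e S = cnj (L2_inner M S e)" by (rule L2_inner_commute)
    also have "\<dots> = (\<Sum>e'\<in>F. d e' * cnj (L2_inner M e' e))" unfolding innerS[OF eL] by simp
    also have "\<dots> = (\<Sum>e'\<in>F. if e' = e then d e else 0)"
      by (intro sum.cong refl) (use F(3) e in auto)
    also have "\<dots> = d e" using e F(1) by simp
    finally show ?thesis .
  qed
  have SS: "L2_inner M S S = of_real D"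
    unfolding innerS[OF S] D_def by (simp add: eS complex_norm_square mult.commute flip: of_real_power)
  have wS: "L2_inner M w S = of_real D" by (subst L2_inner_commute) (simp add: Sw)
  have "of_real (\<integral>x. (cmod (w x + (-1) * S x))\<^sup>2 \<partial>M) = L2_inner M (\<lambda>x. w x + (-1) * S x) (\<lambda>x. w x + (-1) * S x)"
    by (rule L2_inner_self[symmetric], rule L2_add[OF w L2_cmult[OF S]])
  also have "\<dots> = (\<integral>x. cnj (w x) * w x - cnj (w x) * S x - cnj (S x) * w x + cnj (S x) * S x \<partial>M)"
    unfolding L2_inner_def by (simp add: algebra_simps)
  also have "\<dots> = L2_inner M w w - L2_inner M w S - L2_inner M S w + L2_inner M S S"
    unfolding L2_inner_def using inner_int[OF w w] inner_int[OF w S] inner_int[OF S w] inner_int[OF S S] by simp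
  also have "\<dots> = of_real ((\<integral>x. (cmod (w x))\<^sup>2 \<partial>M) - D)"
    unfolding Sw SS wS L2_inner_self[OF w] by simp
  finally have "(\<integral>x. (cmod (w x + (-1) * S x))\<^sup>2 \<partial>M) = (\<integral>x. (cmod (w x))\<^sup>2 \<partial>M) - D"
    unfolding of_real_eq_iff .
  moreover have "(\<integral>x. (cmod (w x + (-1) * S x))\<^sup>2 \<partial>M) \<ge> 0" by (rule integral_nonneg_AE) simp
  ultimately have "D \<le> (\<integral>x. (cmod (w x))\<^sup>2 \<partial>M)" by linarith
  then show ?thesis unfolding D_def dk by (simp add: w_def)
qed

text \<open>Bessel's inequality for almost every row \<open>G x\<close> bounds finite sums of
  \<open>(cmod (F e x))\<^sup>2\<close> by the squared norm of that row. Integration in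
  \<open>x\<close> gives a bound by the squared norm of the kernel that is independent of the finite
  set.\<close>

lemma L2_kernel_imp_hilbert_schmidt:
  assumes M: "sigma_finite_measure M" and T: "L2_bounded_operator M T"
    and G: "(\<lambda>(x, y). G x y) \<in> L2 (M \<Otimes>\<^sub>M M)"
    and kernel: "\<And>g. g \<in> L2 M \<Longrightarrow> (g, \<lambda>x. \<integral>y. G x y * g y \<partial>M) \<in> T"
  shows "L2_hilbert_schmidt M T"
proof -
  interpret sigma_finite_measure M by (rule M)
  interpret pair_sigma_finite M M ..
  obtain E where E: "L2_orthonormal_basis M E" using L2_orthonormal_basis_exists by blast
  have EL: "E \<subseteq> L2 M" using E by (simp add: L2_orthonormal_basis_def)
  have on: "\<forall>e\<in>E. \<forall>e'\<in>E. L2_inner M e e' = (if e = e' then 1 else 0)"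
    using E by (simp add: L2_orthonormal_basis_def)
  define F where "F e x = (\<integral>y. G x y * e y \<partial>M)" for e x
  have FT: "(e, F e) \<in> T" if "e \<in> E" for e
    unfolding F_def[abs_def] using kernel EL that by blast
  have FL: "F e \<in> L2 M" if "e \<in> E" for e
  proof -
    have "T \<subseteq> L2 M \<times> L2 M" using T by (simp add: L2_bounded_operator_def L2_operator_def)
    from subsetD[OF this FT[OF that]] show ?thesis by simp
  qed
  have Gm: "(\<lambda>(x, y). G x y) \<in> borel_measurable (M \<Otimes>\<^sub>M M)" using G by (simp add: L2_def)
  have Gi: "integrable (M \<Otimes>\<^sub>M M) (\<lambda>p. (cmod (case p of (x, y) \<Rightarrow> G x y))\<^sup>2)" using G by (simp add: L2_def)
  have Gx_int: "AE x in M. integrable M (\<lambda>y. (cmod (G x y))\<^sup>2)"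
    using AE_integrable_fst'[OF Gi] by simp
  have Kint: "integrable M (\<lambda>x. \<integral>y. (cmod (G x y))\<^sup>2 \<partial>M)"
    using integrable_fst'[OF Gi] by simp
  define K where "K = (\<integral>x. \<integral>y. (cmod (G x y))\<^sup>2 \<partial>M \<partial>M)"
  have Gx: "AE x in M. G x \<in> L2 M"
    using Gx_int AE_space
  proof eventually_elim
    fix x assume "integrable M (\<lambda>y. (cmod (G x y))\<^sup>2)" "x \<in> space M"
    moreover from this have "(\<lambda>y. G x y) \<in> borel_measurable M"
      using measurable_Pair2[OF Gm, of x] by simp
    ultimately show "G x \<in> L2 M" by (simp add: L2_def)
  qed
  have "(\<lambda>e. (L2_norm M (F e))\<^sup>2) summable_on E"
  proof (rule nonneg_bdd_above_summable_on)
    show "bdd_above (sum (\<lambda>e. (L2_norm M (F e))\<^sup>2) ` {A. A \<subseteq> E \<and> finite A})"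
    proof (rule bdd_aboveI2)
      fix A assume "A \<in> {A. A \<subseteq> E \<and> finite A}"
      then have A: "A \<subseteq> E" "finite A" by auto
      have int: "integrable M (\<lambda>x. (cmod (F e x))\<^sup>2)" if "e \<in> A" for e
        using FL[of e] that A by (auto simp: L2_def)
      have nn: "(\<integral>x. (cmod (F e x))\<^sup>2 \<partial>M) \<ge> 0" for e by (rule integral_nonneg_AE) simp
      have "(\<Sum>e\<in>A. (L2_norm M (F e))\<^sup>2) = (\<Sum>e\<in>A. \<integral>x. (cmod (F e x))\<^sup>2 \<partial>M)"
        by (simp add: L2_norm_def nn)
      also have "\<dots> = (\<integral>x. (\<Sum>e\<in>A. (cmod (F e x))\<^sup>2) \<partial>M)"
        by (rule Bochner_Integration.integral_sum[symmetric]) (rule int)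
      also have "\<dots> \<le> K"
        unfolding K_def
      proof (rule integral_mono_AE[OF _ Kint])
        show "integrable M (\<lambda>x. \<Sum>e\<in>A. (cmod (F e x))\<^sup>2)" using int by auto
        show "AE x in M. (\<Sum>e\<in>A. (cmod (F e x))\<^sup>2) \<le> (\<integral>y. (cmod (G x y))\<^sup>2 \<partial>M)"
          using Gx
        proof (rule eventually_mono)
          fix x assume Gx: "G x \<in> L2 M"
          show "(\<Sum>e\<in>A. (cmod (F e x))\<^sup>2) \<le> (\<integral>y. (cmod (G x y))\<^sup>2 \<partial>M)"
            unfolding F_def
          proof (rule bessel_inequality[OF A(2) order_trans[OF A(1) EL] _ Gx])
            fix e e' assume "e \<in> A" "e' \<in> A"
            then show "L2_inner M e e' = (if e = e' then 1 else 0)"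
              using A(1) by (intro bspec[OF bspec[OF on]]) auto
          qed
        qed
      qed
      finally show "sum (\<lambda>e. (L2_norm M (F e))\<^sup>2) A \<le> K" .
    qed
  qed auto
  then show ?thesis unfolding L2_hilbert_schmidt_def using T E FT by blast
qed

section \<open>The resolvent kernel\<close>

text \<open>Fubini on the square: the two iterated integrals run over the triangles y \<le> x and x
  \<le> y, which cover it and overlap only in the diagonal. Every section of the diagonal is a
  single point and hence null.\<close>

lemma integral_triangle_swap:
  fixes f g :: "real \<Rightarrow> complex"
  assumes M: "sigma_finite_measure M" and borel: "(\<lambda>x. x) \<in> borel_measurable M"
    and null: "\<And>x. AE y in M. y \<noteq> x"
    and f: "integrable M f" and g: "integrable M g"
  shows "(\<integral>x. f x * (\<integral>y. indicator {..x} y * g y \<partial>M) \<partial>M) + (\<integral>x. g x * (\<integral>y. indicator {..x} y * f y \<partial>M) \<partial>M)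
     = (\<integral>x. f x \<partial>M) * (\<integral>x. g x \<partial>M)"
proof -
  interpret sigma_finite_measure M by (rule M)
  interpret pair_sigma_finite M M ..
  have [measurable]: "f \<in> borel_measurable M" "g \<in> borel_measurable M" "(\<lambda>x. x) \<in> borel_measurable M"
    using f g borel by auto
  have m1[measurable]: "(\<lambda>p. fst p :: real) \<in> borel_measurable (M \<Otimes>\<^sub>M M)" "(\<lambda>p. snd p :: real) \<in> borel_measurable (M \<Otimes>\<^sub>M M)"
    using measurable_compose[OF measurable_fst borel] measurable_compose[OF measurable_snd borel] by simp_all
  have fg: "integrable (M \<Otimes>\<^sub>M M) (\<lambda>p. f (fst p) * g (snd p))"
  proof (rule Fubini_integrable)
    show "(\<lambda>p. f (fst p) * g (snd p)) \<in> borel_measurable (M \<Otimes>\<^sub>M M)" by measurable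
    show "integrable M (\<lambda>x. \<integral>y. norm (f (fst (x, y)) * g (snd (x, y))) \<partial>M)"
      using f by (simp add: norm_mult)
    show "AE x in M. integrable M (\<lambda>y. f (fst (x, y)) * g (snd (x, y)))" using g by simp
  qed
  have ind: "indicator {..x} y = (of_bool (y \<le> x) :: complex)" for x y :: real by (simp add: indicator_def)
  have int1: "integrable (M \<Otimes>\<^sub>M M) (\<lambda>p. of_bool (snd p \<le> fst p) * (f (fst p) * g (snd p)))"
    by (rule Bochner_Integration.integrable_bound[OF fg]) (auto simp: norm_mult of_bool_def)
  have int2: "integrable (M \<Otimes>\<^sub>M M) (\<lambda>p. of_bool (fst p \<le> snd p) * (f (fst p) * g (snd p)))"
    by (rule Bochner_Integration.integrable_bound[OF fg]) (auto simp: norm_mult of_bool_def)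
  have 1: "(\<integral>x. f x * (\<integral>y. indicator {..x} y * g y \<partial>M) \<partial>M) = (\<integral>x. \<integral>y. of_bool (y \<le> x) * (f x * g y) \<partial>M \<partial>M)"
    unfolding ind by (subst integral_mult_right_zero[symmetric]) (simp add: algebra_simps)
  have "(\<integral>x. g x * (\<integral>y. indicator {..x} y * f y \<partial>M) \<partial>M) = (\<integral>y. \<integral>x. of_bool (x \<le> y) * (f x * g y) \<partial>M \<partial>M)"
    unfolding ind by (subst integral_mult_right_zero[symmetric]) (simp add: algebra_simps)
  also have "\<dots> = (\<integral>x. \<integral>y. of_bool (x \<le> y) * (f x * g y) \<partial>M \<partial>M)"
    by (rule Fubini_integral) (use int2 in \<open>simp add: case_prod_unfold\<close>)
  finally have 2: "(\<integral>x. g x * (\<integral>y. indicator {..x} y * f y \<partial>M) \<partial>M) = (\<integral>x. \<integral>y. of_bool (x \<le> y) * (f x * g y) \<partial>M \<partial>M)" .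
  have "(\<integral>x. \<integral>y. of_bool (y \<le> x) * (f x * g y) \<partial>M \<partial>M) + (\<integral>x. \<integral>y. of_bool (x \<le> y) * (f x * g y) \<partial>M \<partial>M)
    = (\<integral>x. (\<integral>y. of_bool (y \<le> x) * (f x * g y) \<partial>M) + (\<integral>y. of_bool (x \<le> y) * (f x * g y) \<partial>M) \<partial>M)"
    using integrable_fst'[OF int1] integrable_fst'[OF int2] by (intro Bochner_Integration.integral_add[symmetric]) simp_all
  also have "\<dots> = (\<integral>x. f x * (\<integral>y. g y \<partial>M) \<partial>M)"
  proof (rule Bochner_Integration.integral_cong[OF refl])
    fix x assume x: "x \<in> space M"
    have "integrable M (\<lambda>y. of_bool (y \<le> x) * (f x * g y))" "integrable M (\<lambda>y. of_bool (x \<le> y) * (f x * g y))"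
    proof -
      have i: "integrable M (\<lambda>y. f x * g y)" using g by simp
      show "integrable M (\<lambda>y. of_bool (y \<le> x) * (f x * g y))" "integrable M (\<lambda>y. of_bool (x \<le> y) * (f x * g y))"
        by (rule Bochner_Integration.integrable_bound[OF i]; auto simp: norm_mult of_bool_def)+
    qed
    then have "(\<integral>y. of_bool (y \<le> x) * (f x * g y) \<partial>M) + (\<integral>y. of_bool (x \<le> y) * (f x * g y) \<partial>M)
      = (\<integral>y. of_bool (y \<le> x) * (f x * g y) + of_bool (x \<le> y) * (f x * g y) \<partial>M)" by simp
    also have "\<dots> = (\<integral>y. f x * g y \<partial>M)"
    proof (rule integral_cong_AE)
      show "AE y in M. of_bool (y \<le> x) * (f x * g y) + of_bool (x \<le> y) * (f x * g y) = f x * g y"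
        using null[of x] by (rule eventually_mono) (auto simp: of_bool_def)
    qed measurable
    finally show "(\<integral>y. of_bool (y \<le> x) * (f x * g y) \<partial>M) + (\<integral>y. of_bool (x \<le> y) * (f x * g y) \<partial>M) = f x * (\<integral>y. g y \<partial>M)" by simp
  qed
  finally show ?thesis unfolding 1 2 by simp
qed

section \<open>The measure \<open>r dx\<close> and square integrability of solutions\<close>

lemma weighted_integral:
  fixes f :: "real \<Rightarrow> 'a::{banach,second_countable_topology}"
  assumes r: "r \<in> borel_measurable (lebesgue_on (einterval a b))" "AE x in lebesgue_on (einterval a b). 0 \<le> r x"
    and f: "f \<in> borel_measurable (lebesgue_on (einterval a b))"
  shows "integrable (weighted a b r) f \<longleftrightarrow> set_integrable lebesgue (einterval a b) (\<lambda>x. r x *\<^sub>R f x)"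
    and "(\<integral>x. f x \<partial>weighted a b r) = (LINT x:einterval a b|lebesgue. r x *\<^sub>R f x)"
proof -
  have "einterval a b \<inter> space lebesgue \<in> sets lebesgue" using einterval_lebesgue by auto
  then show "integrable (weighted a b r) f \<longleftrightarrow> set_integrable lebesgue (einterval a b) (\<lambda>x. r x *\<^sub>R f x)"
    and "(\<integral>x. f x \<partial>weighted a b r) = (LINT x:einterval a b|lebesgue. r x *\<^sub>R f x)"
    unfolding weighted_def set_integrable_def set_lebesgue_integral_def
    using integrable_density[OF f r] integral_density[OF f r]
    by (simp_all add: integrable_restrict_space integral_restrict_space)
qed

context sturm_liouville
begin

lemma space_M [simp]: "space M = I"
  by (simp add: weighted_def)

lemma borel_measurable_M [simp]: "borel_measurable M = borel_measurable (lebesgue_on I)"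
  by (rule measurable_cong_sets) (simp_all add: weighted_def)

lemma r_nonneg: "AE x in lebesgue_on I. 0 \<le> r x"
  using r_pos by (rule eventually_mono) simp

text \<open>Positivity of \<open>r\<close> almost everywhere keeps the density from creating new
  null sets.\<close>

lemma AE_M_iff: "(AE x in M. P x) \<longleftrightarrow> (AE x in lebesgue_on I. P x)"
proof -
  have "(AE x in M. P x) \<longleftrightarrow> (AE x in lebesgue_on I. ennreal (r x) > 0 \<longrightarrow> P x)"
    unfolding weighted_def by (rule AE_density) (use r_measurable in measurable)
  also have "\<dots> \<longleftrightarrow> (AE x in lebesgue_on I. P x)"
  proof
    assume "AE x in lebesgue_on I. ennreal (r x) > 0 \<longrightarrow> P x"
    with r_pos show "AE x in lebesgue_on I. P x" by eventually_elim simp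
  next
    assume "AE x in lebesgue_on I. P x"
    then show "AE x in lebesgue_on I. ennreal (r x) > 0 \<longrightarrow> P x" by eventually_elim simp
  qed
  finally show ?thesis .
qed

lemma sigma_finite_M: "sigma_finite_measure M"
proof -
  have "sigma_finite_measure (lebesgue :: real measure)"
  proof (rule sigma_finite_measure.intro)
    show "\<exists>A::real set set. countable A \<and> A \<subseteq> sets lebesgue \<and> \<Union>A = space lebesgue \<and> (\<forall>a\<in>A. emeasure lebesgue a \<noteq> \<infinity>)"
    proof (intro exI conjI ballI)
      show "\<Union>(range (\<lambda>n::nat. {- real n..real n})) = space lebesgue"
      proof (intro equalityI subsetI)
        fix x :: real
        obtain n :: nat where "\<bar>x\<bar> \<le> real n" using real_arch_simple by blast
        then have "x \<in> {- real n..real n}" by auto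
        then show "x \<in> \<Union>(range (\<lambda>n::nat. {- real n..real n}))" by blast
      qed simp
      fix a :: "real set" assume "a \<in> range (\<lambda>n::nat. {- real n..real n})"
      then obtain n :: nat where a: "a = {- real n..real n}" by blast
      show "emeasure lebesgue a \<noteq> \<infinity>" unfolding a by simp
    qed auto
  qed
  then have sf: "sigma_finite_measure (lebesgue_on I)"
    by (rule sigma_finite_measure_restrict_space) (rule einterval_lebesgue)
  show ?thesis
    unfolding weighted_def using r_measurable
    by (subst sigma_finite_measure.sigma_finite_iff_density_finite[OF sf]) auto
qed

lemma AE_M_neq: "AE y in M. y \<noteq> x"
  unfolding AE_M_iff AE_lebesgue_on_iff_negligible[OF einterval_lebesgue]
  by (rule negligible_subset[of "{x}"]) auto

lemma AC_loc_measurable: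
  assumes "AC_loc a b f" shows "f \<in> borel_measurable (lebesgue_on I)"
  by (rule continuous_imp_measurable_on_sets_lebesgue[OF AC_loc_continuous_on[OF assms] einterval_lebesgue])

text \<open>The limit-circle conditions speak of measures on the two halves of the interval.
  Rewritten as Lebesgue integrability of \<open>F\<close>, they can be glued at an interior point
  \<open>c\<close>, which is itself null.\<close>

lemma limit_circle_imp_L2:
  assumes l: "limit_circle_left a b p q r s" and rr: "limit_circle_right a b p q r s"
    and u: "tau_solution a b p q r s z u"
  shows "u \<in> L2 M"
proof -
  obtain c where "a < ereal c" "ereal c < b" using ereal_dense2[OF ab] by blast
  then have c: "c \<in> I" by (simp add: einterval_def)
  have um: "u \<in> borel_measurable (lebesgue_on I)"
    using u by (intro AC_loc_measurable) (simp add: tau_solution_def tau_domain_def)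
  define F where "F x = r x *\<^sub>R (cmod (u x))\<^sup>2" for x
  have part: "set_integrable lebesgue (einterval a' b') F"
    if L: "u \<in> L2 (weighted a' b' r)" and sub: "einterval a' b' \<subseteq> I" for a' b'
  proof -
    have "r \<in> borel_measurable (lebesgue_on (einterval a' b'))"
      by (rule measurable_restrict_mono[OF r_measurable sub])
    moreover have "AE x in lebesgue_on (einterval a' b'). 0 \<le> r x"
      using r_nonneg unfolding AE_lebesgue_on_iff_negligible[OF einterval_lebesgue]
      by (rule negligible_subset) (use sub in auto)
    moreover have "(\<lambda>x. (cmod (u x))\<^sup>2) \<in> borel_measurable (lebesgue_on (einterval a' b'))"
      using measurable_restrict_mono[OF um sub] by measurable
    ultimately show ?thesis
      using weighted_integral(1)[of r a' b' "\<lambda>x. (cmod (u x))\<^sup>2"] L unfolding F_def[abs_def] L2_def by blast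
  qed
  have sub: "einterval a (ereal c) \<subseteq> I" "einterval (ereal c) b \<subseteq> I"
  proof -
    have c': "a < ereal c" "ereal c < b" using c by (auto simp: einterval_def)
    show "einterval a (ereal c) \<subseteq> I"
    proof
      fix x assume "x \<in> einterval a (ereal c)"
      then have "a < ereal x" "ereal x < ereal c" by (auto simp: einterval_def)
      then show "x \<in> I" using less_trans[OF _ c'(2)] by (simp add: einterval_def)
    qed
    show "einterval (ereal c) b \<subseteq> I"
    proof
      fix x assume "x \<in> einterval (ereal c) b"
      then have "ereal c < ereal x" "ereal x < b" by (auto simp: einterval_def)
      then show "x \<in> I" using less_trans[OF c'(1)] by (simp add: einterval_def)
    qed
  qed
  have "set_integrable lebesgue (einterval a (ereal c) \<union> einterval (ereal c) b) F"
    by (rule set_integrable_Un[OF part part])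
       (use l rr u c sub einterval_lebesgue in \<open>auto simp: limit_circle_left_def limit_circle_right_def\<close>)
  moreover have "set_integrable lebesgue {c} F"
    using integrable_on_refl[of F c] absolutely_integrable_on_null[of c c F] by simp
  ultimately have "set_integrable lebesgue ((einterval a (ereal c) \<union> einterval (ereal c) b) \<union> {c}) F"
    by (rule set_integrable_Un) (use einterval_lebesgue in auto)
  moreover have "(einterval a (ereal c) \<union> einterval (ereal c) b) \<union> {c} = I"
  proof (rule equalityI)
    show "(einterval a (ereal c) \<union> einterval (ereal c) b) \<union> {c} \<subseteq> I" using sub c by blast
    show "I \<subseteq> (einterval a (ereal c) \<union> einterval (ereal c) b) \<union> {c}"
      by (auto simp: einterval_def)
  qed
  ultimately have "set_integrable lebesgue I F" by simp
  moreover have "(\<lambda>x. (cmod (u x))\<^sup>2) \<in> borel_measurable (lebesgue_on I)" using um by measurable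
  ultimately have "integrable M (\<lambda>x. (cmod (u x))\<^sup>2)"
    using weighted_integral(1)[OF r_measurable r_nonneg] unfolding F_def[abs_def] by blast
  then show ?thesis using um by (simp add: L2_def)
qed

text \<open>With respect to \<open>dx\<close> this is the primitive of \<open>r f\<close> vanishing at \<open>a\<close>, as \<open>M\<close> is \<open>r dx\<close> on \<open>(a, b)\<close>.\<close>

definition primitive :: "(real \<Rightarrow> complex) \<Rightarrow> real \<Rightarrow> complex" where
  "primitive f x = (\<integral>y. indicator {..x} y * f y \<partial>M)"

lemma indicator_mult_integrable:
  assumes "integrable M f" shows "integrable M (\<lambda>y. indicator {..x} y * f y :: complex)"
proof (rule Bochner_Integration.integrable_bound[OF assms])
  have "f \<in> borel_measurable (lebesgue_on I)" using borel_measurable_integrable[OF assms] by simp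
  moreover have "(indicator {..x} :: real \<Rightarrow> complex) \<in> borel_measurable (lebesgue_on I)"
    by (rule measurable_restrict_space1) (simp add: borel_measurable_indicator)
  ultimately show "(\<lambda>y. indicator {..x} y * f y) \<in> borel_measurable M" by simp
qed (auto simp: norm_mult indicator_def)

text \<open>Connects integrals for \<open>M\<close>, in which the resolvent is described, with gauge
  integrals in \<open>dx\<close>, in which the Lagrange identity is stated.\<close>

lemma primitive_diff:
  assumes f: "integrable M f" and xy: "x \<in> I" "y \<in> I" "x \<le> y"
  shows "primitive f y - primitive f x = integral {x..y} (\<lambda>t. of_real (r t) * f t)"
proof -
  have fm: "f \<in> borel_measurable (lebesgue_on I)" using borel_measurable_integrable[OF f] by simp
  have "{x..y} \<subseteq> I" by (rule einterval_compact_subset) (use xy in \<open>auto simp: einterval_def\<close>)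
  then have sub: "{x<..y} \<subseteq> I" by force
  have indm: "(indicator S :: real \<Rightarrow> complex) \<in> borel_measurable (lebesgue_on I)" if "S \<in> sets borel" for S
    by (rule measurable_restrict_space1) (use that in \<open>simp add: borel_measurable_indicator\<close>)
  have "primitive f y - primitive f x = (\<integral>t. indicator {..y} t * f t - indicator {..x} t * f t \<partial>M)"
    unfolding primitive_def using indicator_mult_integrable[OF f]
    by (intro Bochner_Integration.integral_diff[symmetric]) auto
  also have "\<dots> = (\<integral>t. indicator {x<..y} t * f t \<partial>M)"
    by (intro Bochner_Integration.integral_cong refl) (use xy in \<open>auto simp: indicator_def\<close>)
  also have "\<dots> = (LINT t:I|lebesgue. r t *\<^sub>R (indicator {x<..y} t * f t))"
    by (rule weighted_integral(2)[OF r_measurable r_nonneg]) (use indm fm in simp)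
  also have "\<dots> = (LINT t:{x<..y}|lebesgue. of_real (r t) * f t)"
  proof -
    have "indicator I t *\<^sub>R (r t *\<^sub>R (indicator {x<..y} t * f t)) = indicator {x<..y} t *\<^sub>R (of_real (r t) * f t)" for t
    proof (cases "t \<in> {x<..y}")
      case True
      then have "t \<in> I" using sub by (rule subsetD[rotated])
      then show ?thesis using True by (simp add: scaleR_conv_of_real)
    qed simp
    then show ?thesis unfolding set_lebesgue_integral_def by simp
  qed
  also have "\<dots> = integral {x<..y} (\<lambda>t. of_real (r t) * f t)"
  proof (rule set_lebesgue_integral_eq_integral(2))
    have i: "set_integrable lebesgue I (\<lambda>t. r t *\<^sub>R f t)"
      using weighted_integral(1)[OF r_measurable r_nonneg fm] f by (rule iffD1)
    have "set_integrable lebesgue {x<..y} (\<lambda>t. r t *\<^sub>R f t)"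
      by (rule set_integrable_subset[OF i _ sub]) simp
    then show "set_integrable lebesgue {x<..y} (\<lambda>t. of_real (r t) * f t)" by (simp add: scaleR_conv_of_real)
  qed
  also have "\<dots> = integral {x..y} (\<lambda>t. of_real (r t) * f t)"
  proof (rule integral_spike_set)
    show "negligible {t \<in> {x<..y} - {x..y}. of_real (r t) * f t \<noteq> 0}"
      by (rule negligible_subset[of "{}"]) auto
    show "negligible {t \<in> {x..y} - {x<..y}. of_real (r t) * f t \<noteq> 0}"
      by (rule negligible_subset[of "{x}"]) auto
  qed
  finally show ?thesis .
qed

text \<open>By the Lagrange identity the Wronskian of each basis solution with \<open>h\<close>,
  plus the matching primitive, is constant; Cramer's rule with \<open>W\<close> recovers
  \<open>h\<close> from the two Wronskians. The primitives can start at the endpoint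
  \<open>a\<close> because \<open>u1 * g\<close> and \<open>u2 * g\<close> are integrable up to
  it.\<close>

lemma variation_of_constants:
  assumes u1: "sl_pair z u1 v1 (\<lambda>_. 0)" "u1 \<in> L2 M" and u2: "sl_pair z u2 v2 (\<lambda>_. 0)" "u2 \<in> L2 M"
    and W: "\<And>x. x \<in> I \<Longrightarrow> u1 x * v2 x - v1 x * u2 x = 1"
    and h: "sl_pair z h h1 g" and g: "g \<in> L2 M"
  shows "\<exists>A B. \<forall>x\<in>I. h x = u1 x * primitive (\<lambda>y. u2 y * g y) x - u2 x * primitive (\<lambda>y. u1 y * g y) x + A * u1 x + B * u2 x"
proof -
  obtain c where "a < ereal c" "ereal c < b" using ereal_dense2[OF ab] by blast
  then have c: "c \<in> I" by (simp add: einterval_def)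
  have key: "(u x * h1 x - v x * h x) + primitive (\<lambda>y. u y * g y) x = (u c * h1 c - v c * h c) + primitive (\<lambda>y. u y * g y) c"
    if u: "sl_pair z u v (\<lambda>_. 0)" and uL: "u \<in> L2 M" and x: "x \<in> I" for u v x
  proof -
    have ug: "integrable M (\<lambda>y. u y * g y)" by (rule L2_mult_integrable[OF uL g])
    have *: "(u x * h1 x - v x * h x) + primitive (\<lambda>y. u y * g y) x = (u l * h1 l - v l * h l) + primitive (\<lambda>y. u y * g y) l"
      if lx: "l \<in> I" "x \<in> I" "l \<le> x" for l x
    proof -
      have "a < ereal l" "ereal x < b" using lx by (auto simp: einterval_def)
      from has_integral_neg[OF sl_pair_wronskian[OF u h this \<open>l \<le> x\<close>]]
      have "((\<lambda>t. of_real (r t) * (u t * g t)) has_integral - ((u x * h1 x - v x * h x) - (u l * h1 l - v l * h l))) {l..x}"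
        by simp
      then have "integral {l..x} (\<lambda>t. of_real (r t) * (u t * g t)) = - ((u x * h1 x - v x * h x) - (u l * h1 l - v l * h l))"
        by (rule integral_unique)
      then show ?thesis using primitive_diff[OF ug lx] by (simp add: algebra_simps)
    qed
    show ?thesis
    proof (cases "c \<le> x")
      case True then show ?thesis by (rule *[OF c x])
    next
      case False then show ?thesis using *[OF x c] by simp
    qed
  qed
  \<comment> \<open>The conserved quantities, evaluated at an interior point; they become the
    coefficients \<open>A = - k2\<close> and \<open>B = k1\<close>.\<close>
  define k1 where "k1 = (u1 c * h1 c - v1 c * h c) + primitive (\<lambda>y. u1 y * g y) c"
  define k2 where "k2 = (u2 c * h1 c - v2 c * h c) + primitive (\<lambda>y. u2 y * g y) c"
  show ?thesis
  proof (intro exI ballI)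
    fix x assume x: "x \<in> I"
    have 1: "u1 x * h1 x - v1 x * h x = k1 - primitive (\<lambda>y. u1 y * g y) x"
      using key[OF u1 x] by (simp add: k1_def algebra_simps)
    have 2: "u2 x * h1 x - v2 x * h x = k2 - primitive (\<lambda>y. u2 y * g y) x"
      using key[OF u2 x] by (simp add: k2_def algebra_simps)
    have "h x = h x * (u1 x * v2 x - v1 x * u2 x)" using W[OF x] by simp
    also have "\<dots> = u2 x * (u1 x * h1 x - v1 x * h x) - u1 x * (u2 x * h1 x - v2 x * h x)" by (simp add: algebra_simps)
    also have "\<dots> = u1 x * primitive (\<lambda>y. u2 y * g y) x - u2 x * primitive (\<lambda>y. u1 y * g y) x + (- k2) * u1 x + k1 * u2 x"
      unfolding 1 2 by (simp add: algebra_simps)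
    finally show "h x = u1 x * primitive (\<lambda>y. u2 y * g y) x - u2 x * primitive (\<lambda>y. u1 y * g y) x + (- k2) * u1 x + k1 * u2 x" .
  qed
qed

text \<open>A relation between square integrable functions is known only almost everywhere.
  Continuity lifts it to every point, the first equation of the system passes it on to the
  quasi-derivatives since \<open>p x \<noteq> 0\<close>, and the Wronskian then forces both
  coefficients to be 0.\<close>

lemma fundamental_system_independent:
  assumes u1: "sl_pair z u1 v1 (\<lambda>_. 0)" and u2: "sl_pair z u2 v2 (\<lambda>_. 0)"
    and W: "\<And>x. x \<in> I \<Longrightarrow> u1 x * v2 x - v1 x * u2 x = 1"
    and zero: "AE x in M. c * u1 x + d * u2 x = 0"
  shows "c = 0 \<and> d = 0"
proof -
  have sp: "sl_pair z (\<lambda>x. c * u1 x + d * u2 x) (\<lambda>x. c * v1 x + d * v2 x) (\<lambda>x. c * 0 + d * 0)"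
    by (rule sl_pair_lincomb[OF u1 u2])
  have zI: "c * u1 x + d * u2 x = 0" if "x \<in> I" for x
    by (rule AC_loc_eq_if_AE_eq[OF _ _ zero[unfolded AE_M_iff] that])
       (use sp in \<open>auto simp: sl_pair_def AC_loc_def AC_const\<close>)
  have "AE x in lebesgue_on I. (((\<lambda>x. c * u1 x + d * u2 x) has_vector_derivative
      (of_real (1 / p x) * (c * v1 x + d * v2 x) - of_real (s x) * (c * u1 x + d * u2 x))) (at x) \<and> p x \<noteq> 0) \<and> x \<in> I"
    using sp p_nonzero AE_space[of "lebesgue_on I"] by (auto simp: sl_pair_def)
  then have ae: "AE x in lebesgue_on I. c * v1 x + d * v2 x = 0"
  proof (rule eventually_mono)
    fix x assume x: "(((\<lambda>x. c * u1 x + d * u2 x) has_vector_derivative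
      (of_real (1 / p x) * (c * v1 x + d * v2 x) - of_real (s x) * (c * u1 x + d * u2 x))) (at x) \<and> p x \<noteq> 0) \<and> x \<in> I"
    have "((\<lambda>x. c * u1 x + d * u2 x) has_vector_derivative 0) (at x)"
      by (rule has_vector_derivative_transform_within_open[of "\<lambda>_. 0" _ _ I]) (use x zI in auto)
    with x have "of_real (1 / p x) * (c * v1 x + d * v2 x) - of_real (s x) * (c * u1 x + d * u2 x) = 0"
      using vector_derivative_unique_at by blast
    then show "c * v1 x + d * v2 x = 0" using x zI[of x] by simp
  qed
  obtain x where "a < ereal x" "ereal x < b" using ereal_dense2[OF ab] by blast
  then have x: "x \<in> I" by (simp add: einterval_def)
  have v: "c * v1 x + d * v2 x = 0"
    by (rule AC_loc_eq_if_AE_eq[OF _ _ ae x])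
       (use sp in \<open>auto simp: sl_pair_def AC_loc_def AC_const\<close>)
  note u = zI[OF x]
  have "c = c * (u1 x * v2 x - v1 x * u2 x)" using W[OF x] by simp
  also have "\<dots> = (c * u1 x + d * u2 x) * v2 x - (c * v1 x + d * v2 x) * u2 x" by (simp add: algebra_simps)
  finally have "c = 0" unfolding u v by simp
  have "d = d * (u1 x * v2 x - v1 x * u2 x)" using W[OF x] by simp
  also have "\<dots> = (c * v1 x + d * v2 x) * u1 x - (c * u1 x + d * u2 x) * v1 x" by (simp add: algebra_simps)
  finally have "d = 0" unfolding u v by simp
  with \<open>c = 0\<close> show ?thesis by simp
qed

end

section \<open>Square integrability on the product measure and iterated integrals\<close>

lemma L2_of_bool_mult:
  assumes "f \<in> L2 M" "Measurable.pred M P" shows "(\<lambda>x. of_bool (P x) * f x) \<in> L2 M"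
proof -
  have [measurable]: "f \<in> borel_measurable M" "Measurable.pred M P" using assms by (auto simp: L2_def)
  have "(\<lambda>x. (if P x then f x else 0)) \<in> borel_measurable M" by measurable
  then have m: "(\<lambda>x. of_bool (P x) * f x) \<in> borel_measurable M"
    by (rule measurable_cong[THEN iffD1, rotated]) (simp add: of_bool_def)
  have i: "integrable M (\<lambda>x. (cmod (f x))\<^sup>2)" using assms by (simp add: L2_def)
  have "integrable M (\<lambda>x. (cmod (of_bool (P x) * f x))\<^sup>2)"
  proof (rule Bochner_Integration.integrable_bound[OF i])
    show "(\<lambda>x. (cmod (of_bool (P x) * f x))\<^sup>2) \<in> borel_measurable M" using m by measurable
  qed (auto simp: of_bool_def)
  with m show ?thesis by (simp add: L2_def)
qed

lemma L2_tensor: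
  assumes M: "sigma_finite_measure M" and "f \<in> L2 M" "g \<in> L2 M"
  shows "(\<lambda>p. f (fst p) * g (snd p)) \<in> L2 (M \<Otimes>\<^sub>M M)"
proof -
  interpret sigma_finite_measure M by (rule M)
  interpret pair_sigma_finite M M ..
  have [measurable]: "f \<in> borel_measurable M" "g \<in> borel_measurable M"
    and i: "integrable M (\<lambda>x. (cmod (f x))\<^sup>2)" "integrable M (\<lambda>x. (cmod (g x))\<^sup>2)"
    using assms by (auto simp: L2_def)
  have "integrable (M \<Otimes>\<^sub>M M) (\<lambda>p. (cmod (f (fst p)))\<^sup>2 * (cmod (g (snd p)))\<^sup>2)"
  proof (rule Fubini_integrable)
    show "(\<lambda>p. (cmod (f (fst p)))\<^sup>2 * (cmod (g (snd p)))\<^sup>2) \<in> borel_measurable (M \<Otimes>\<^sub>M M)" by measurable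
    show "integrable M (\<lambda>x. \<integral>y. norm ((cmod (f (fst (x, y))))\<^sup>2 * (cmod (g (snd (x, y))))\<^sup>2) \<partial>M)"
      using i(1) by (simp add: norm_mult)
    show "AE x in M. integrable M (\<lambda>y. (cmod (f (fst (x, y))))\<^sup>2 * (cmod (g (snd (x, y))))\<^sup>2)" using i(2) by simp
  qed
  then show ?thesis by (simp add: L2_def norm_mult power_mult_distrib)
qed

lemma integrable_mult_indefinite:
  fixes f g :: "real \<Rightarrow> complex"
  assumes M: "sigma_finite_measure M" and borel: "(\<lambda>x. x) \<in> borel_measurable M"
    and f: "integrable M f" and g: "integrable M g"
  shows "integrable M (\<lambda>x. f x * (\<integral>y. indicator {..x} y * g y \<partial>M))"
proof -
  interpret sigma_finite_measure M by (rule M)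
  interpret pair_sigma_finite M M ..
  have [measurable]: "f \<in> borel_measurable M" "g \<in> borel_measurable M" "(\<lambda>x. x) \<in> borel_measurable M"
    using f g borel by auto
  have m1[measurable]: "(\<lambda>p. fst p :: real) \<in> borel_measurable (M \<Otimes>\<^sub>M M)" "(\<lambda>p. snd p :: real) \<in> borel_measurable (M \<Otimes>\<^sub>M M)"
    using measurable_compose[OF measurable_fst borel] measurable_compose[OF measurable_snd borel] by simp_all
  have fg: "integrable (M \<Otimes>\<^sub>M M) (\<lambda>p. f (fst p) * g (snd p))"
  proof (rule Fubini_integrable)
    show "(\<lambda>p. f (fst p) * g (snd p)) \<in> borel_measurable (M \<Otimes>\<^sub>M M)" by measurable
    show "integrable M (\<lambda>x. \<integral>y. norm (f (fst (x, y)) * g (snd (x, y))) \<partial>M)"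
      using f by (simp add: norm_mult)
    show "AE x in M. integrable M (\<lambda>y. f (fst (x, y)) * g (snd (x, y)))" using g by simp
  qed
  have int1: "integrable (M \<Otimes>\<^sub>M M) (\<lambda>p. of_bool (snd p \<le> fst p) * (f (fst p) * g (snd p)))"
    by (rule Bochner_Integration.integrable_bound[OF fg]) (auto simp: norm_mult of_bool_def)
  have ind: "indicator {..x} y = (of_bool (y \<le> x) :: complex)" for x y :: real by (simp add: indicator_def)
  have "f x * (\<integral>y. indicator {..x} y * g y \<partial>M) = (\<integral>y. of_bool (y \<le> x) * (f x * g y) \<partial>M)" for x
    unfolding ind by (subst integral_mult_right_zero[symmetric]) (simp add: algebra_simps)
  then show ?thesis using integrable_fst'[OF int1] by simp
qed

lemma sum_12: "(\<Sum>i\<in>{1,2::nat}. f i) = f 1 + (f 2 :: complex)"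
  by (simp add: numeral_2_eq_2)

context sturm_liouville
begin

lemma zero_L2: "(\<lambda>_. 0) \<in> L2 M'"
  by (simp add: L2_def)

lemma borel_M: "(\<lambda>x. x) \<in> borel_measurable M"
proof -
  have "id \<in> borel_measurable (lebesgue_on I)" by simp
  then show ?thesis by (simp add: id_def)
qed

lemma mult_primitive_integrable:
  "integrable M f \<Longrightarrow> integrable M g \<Longrightarrow> integrable M (\<lambda>x. f x * primitive g x)"
  unfolding primitive_def by (rule integrable_mult_indefinite[OF sigma_finite_M borel_M])

lemma primitive_swap:
  "integrable M f \<Longrightarrow> integrable M g \<Longrightarrow>
     (\<integral>x. f x * primitive g x \<partial>M) + (\<integral>x. g x * primitive f x \<partial>M) = (\<integral>x. f x \<partial>M) * (\<integral>x. g x \<partial>M)"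
  unfolding primitive_def by (rule integral_triangle_swap[OF sigma_finite_M borel_M AE_M_neq])

text \<open>The right-hand side of the variation-of-constants formula, named so that it can be used
  for \<open>g\<close> and for the dual functions alike.\<close>

definition particular :: "(real \<Rightarrow> complex) \<Rightarrow> (real \<Rightarrow> complex) \<Rightarrow> (real \<Rightarrow> complex) \<Rightarrow> complex \<Rightarrow> complex \<Rightarrow> real \<Rightarrow> complex" where
  "particular u1 u2 g A B x = u1 x * primitive (\<lambda>y. u2 y * g y) x - u2 x * primitive (\<lambda>y. u1 y * g y) x + A * u1 x + B * u2 x"

text \<open>The hypothesis \<open>eq\<close> says that the solution operator may be moved from
  \<open>g\<close> to \<open>k\<close>. Each iterated integral on one side combines with one on the
  other into a product, leaving a linear equation for \<open>A\<close> and \<open>B\<close> in which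
  \<open>g\<close> enters only through its pairings with \<open>u1\<close> and
  \<open>u2\<close>.\<close>

lemma particular_pairing:
  assumes u: "u1 \<in> L2 M" "u2 \<in> L2 M" and g: "g \<in> L2 M" and k: "k \<in> L2 M"
    and eq: "(\<integral>x. k x * particular u1 u2 g A B x \<partial>M) = (\<integral>x. particular u1 u2 k C D x * g x \<partial>M)"
  shows "A * (\<integral>x. u1 x * k x \<partial>M) + B * (\<integral>x. u2 x * k x \<partial>M) =
    (\<integral>x. u2 x * k x \<partial>M) * (\<integral>x. u1 x * g x \<partial>M) - (\<integral>x. u1 x * k x \<partial>M) * (\<integral>x. u2 x * g x \<partial>M)
      + C * (\<integral>x. u1 x * g x \<partial>M) + D * (\<integral>x. u2 x * g x \<partial>M)"
proof -
  have i: "integrable M (\<lambda>x. u1 x * k x)" "integrable M (\<lambda>x. u2 x * k x)" "integrable M (\<lambda>x. u1 x * g x)" "integrable M (\<lambda>x. u2 x * g x)"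
    using u g k by (auto intro: L2_mult_integrable)
  have L: "(\<integral>x. k x * particular u1 u2 g A B x \<partial>M) =
     (\<integral>x. (u1 x * k x) * primitive (\<lambda>y. u2 y * g y) x \<partial>M) - (\<integral>x. (u2 x * k x) * primitive (\<lambda>y. u1 y * g y) x \<partial>M)
      + A * (\<integral>x. u1 x * k x \<partial>M) + B * (\<integral>x. u2 x * k x \<partial>M)" if "g \<in> L2 M" "k \<in> L2 M" for g k A B
  proof -
    have i: "integrable M (\<lambda>x. u1 x * k x)" "integrable M (\<lambda>x. u2 x * k x)" "integrable M (\<lambda>x. u1 x * g x)" "integrable M (\<lambda>x. u2 x * g x)"
      using u that by (auto intro: L2_mult_integrable)
    have "(\<integral>x. k x * particular u1 u2 g A B x \<partial>M) =
      (\<integral>x. (u1 x * k x) * primitive (\<lambda>y. u2 y * g y) x - (u2 x * k x) * primitive (\<lambda>y. u1 y * g y) x + A * (u1 x * k x) + B * (u2 x * k x) \<partial>M)"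
      by (rule Bochner_Integration.integral_cong[OF refl]) (simp add: particular_def algebra_simps)
    also have "\<dots> = (\<integral>x. (u1 x * k x) * primitive (\<lambda>y. u2 y * g y) x \<partial>M) - (\<integral>x. (u2 x * k x) * primitive (\<lambda>y. u1 y * g y) x \<partial>M)
      + A * (\<integral>x. u1 x * k x \<partial>M) + B * (\<integral>x. u2 x * k x \<partial>M)"
      using mult_primitive_integrable[OF i(1) i(4)] mult_primitive_integrable[OF i(2) i(3)] i(1,2) by simp
    finally show ?thesis .
  qed
  have R: "(\<integral>x. particular u1 u2 k C D x * g x \<partial>M) = (\<integral>x. g x * particular u1 u2 k C D x \<partial>M)"
    by (simp only: mult.commute)
  have s1: "(\<integral>x. (u1 x * k x) * primitive (\<lambda>y. u2 y * g y) x \<partial>M) + (\<integral>x. (u2 x * g x) * primitive (\<lambda>y. u1 y * k y) x \<partial>M)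
     = (\<integral>x. u1 x * k x \<partial>M) * (\<integral>x. u2 x * g x \<partial>M)" by (rule primitive_swap[OF i(1) i(4)])
  have s2: "(\<integral>x. (u2 x * k x) * primitive (\<lambda>y. u1 y * g y) x \<partial>M) + (\<integral>x. (u1 x * g x) * primitive (\<lambda>y. u2 y * k y) x \<partial>M)
     = (\<integral>x. u2 x * k x \<partial>M) * (\<integral>x. u1 x * g x \<partial>M)" by (rule primitive_swap[OF i(2) i(3)])
  show ?thesis
    using eq unfolding R L[OF g k] L[OF k g] s1[symmetric] s2[symmetric] by (simp add: algebra_simps)
qed

text \<open>The spectral parameter is free, since \<open>k = z * h + (k - z * f)\<close> almost
  everywhere for every \<open>z\<close>. It is applied with \<open>z\<close> to values of the
  resolvent and with \<open>cnj z\<close> to the dual elements.\<close>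

lemma T_max_imp_sl_pair:
  assumes "(f, k) \<in> T_max a b p q r s"
  obtains h h1 where "h \<in> tau_domain a b p s" "AE x in M. f x = h x" "sl_pair z h h1 (\<lambda>x. k x - z * f x)"
proof -
  obtain h where h: "h \<in> tau_domain a b p s" "AE x in M. f x = h x" "AE x in M. k x = tau a b p q r s h x"
    using assms by (auto simp: T_max_def)
  have "AE x in M. tau a b p q r s h x = z * h x + (k x - z * f x)"
    using h(2,3) by eventually_elim simp
  then show thesis
    using that[OF h(1,2) tau_domain_imp_sl_pair[OF h(1)]] by (simp add: AE_M_iff)
qed

lemma tau_domain_measurable: "h \<in> tau_domain a b p s \<Longrightarrow> h \<in> borel_measurable M"
  using AC_loc_measurable by (auto simp: tau_domain_def)

end

section \<open>Self-adjoint operators as graphs and the dual pair\<close>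

lemma L2_self_adjoint_symmetric:
  assumes "L2_self_adjoint M S" "(w, w') \<in> S" "(f, f') \<in> S"
  shows "(\<integral>x. cnj (w x) * f' x \<partial>M) = (\<integral>x. cnj (w' x) * f x \<partial>M)"
proof -
  have "(w, w') \<in> L2_adjoint M S" using assms by (simp add: L2_self_adjoint_def)
  then show ?thesis using assms(3) by (auto simp: L2_adjoint_def L2_inner_def)
qed

lemma L2_operatorD:
  assumes "L2_operator M T"
  shows "(f, g) \<in> T \<Longrightarrow> f \<in> L2 M" "(f, g) \<in> T \<Longrightarrow> g \<in> L2 M" "(\<lambda>x. 0, \<lambda>x. 0) \<in> T"
    "(f, g) \<in> T \<Longrightarrow> (f', g') \<in> T \<Longrightarrow> (\<lambda>x. f x + f' x, \<lambda>x. g x + g' x) \<in> T"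
    "(f, g) \<in> T \<Longrightarrow> (\<lambda>x. c * f x, \<lambda>x. c * g x) \<in> T"
    "(f, g) \<in> T \<Longrightarrow> f' \<in> L2 M \<Longrightarrow> g' \<in> L2 M \<Longrightarrow> AE x in M. f x = f' x \<Longrightarrow> AE x in M. g x = g' x \<Longrightarrow> (f', g') \<in> T"
    "(f, g) \<in> T \<Longrightarrow> (f', g') \<in> T \<Longrightarrow> AE x in M. f x = f' x \<Longrightarrow> AE x in M. g x = g' x"
proof -
  have T: "T \<subseteq> L2 M \<times> L2 M" using assms by (simp add: L2_operator_def)
  show "(f, g) \<in> T \<Longrightarrow> f \<in> L2 M" "(f, g) \<in> T \<Longrightarrow> g \<in> L2 M" using T by auto
next
  note A = assms[unfolded L2_operator_def, THEN conjunct2]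
  show "(\<lambda>x. 0, \<lambda>x. 0) \<in> T" by (rule A[THEN conjunct1])
  show "(f, g) \<in> T \<Longrightarrow> (f', g') \<in> T \<Longrightarrow> (\<lambda>x. f x + f' x, \<lambda>x. g x + g' x) \<in> T"
    by (rule A[THEN conjunct2, THEN conjunct1, rule_format])
  show "(f, g) \<in> T \<Longrightarrow> (\<lambda>x. c * f x, \<lambda>x. c * g x) \<in> T"
    by (rule A[THEN conjunct2, THEN conjunct2, THEN conjunct1, rule_format])
  show "(f, g) \<in> T \<Longrightarrow> f' \<in> L2 M \<Longrightarrow> g' \<in> L2 M \<Longrightarrow> AE x in M. f x = f' x \<Longrightarrow> AE x in M. g x = g' x \<Longrightarrow> (f', g') \<in> T"
    by (rule A[THEN conjunct2, THEN conjunct2, THEN conjunct2, THEN conjunct1, rule_format])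
  show "(f, g) \<in> T \<Longrightarrow> (f', g') \<in> T \<Longrightarrow> AE x in M. f x = f' x \<Longrightarrow> AE x in M. g x = g' x"
    by (rule A[THEN conjunct2, THEN conjunct2, THEN conjunct2, THEN conjunct2, rule_format])
qed

text \<open>The conjugates of the elements of \<open>ran (S - cnj z)\<close> separate \<open>u1\<close> and \<open>u2\<close>, because an element
  of the span of \<open>u1\<close> and \<open>u2\<close> orthogonal to this range lies in \<open>ker (S - z)\<close>.\<close>

lemma resolvent_dual_pair:
  assumes sa: "L2_self_adjoint M S" and z: "z \<in> resolvent_set M S"
    and u: "u1 \<in> L2 M" "u2 \<in> L2 M"
    and indep: "\<And>c d. AE x in M. c * u1 x + d * u2 x = 0 \<Longrightarrow> c = 0 \<and> d = 0"
  shows "\<exists>w w'. (w, w') \<in> S \<and> (\<integral>x. u1 x * (cnj (w' x) - z * cnj (w x)) \<partial>M) = e1 \<and>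
     (\<integral>x. u2 x * (cnj (w' x) - z * cnj (w x)) \<partial>M) = e2"
proof -
  have S: "L2_operator M S" using sa by (simp add: L2_self_adjoint_def)
  have R: "L2_operator M (resolvent S z)" using z by (simp add: resolvent_set_def L2_bounded_operator_def)
  define \<kappa> where "\<kappa> w w' x = cnj (w' x) - z * cnj (w x)" for w w' :: "'a \<Rightarrow> complex" and x
  have \<kappa>L: "\<kappa> w w' \<in> L2 M" if "(w, w') \<in> S" for w w'
    using L2_add[OF L2_cnj[OF L2_operatorD(2)[OF S that]] L2_cmult[OF L2_cnj[OF L2_operatorD(1)[OF S that]], of "-z"]]
    by (simp add: \<kappa>_def[abs_def])
  have nondeg: "\<exists>w w'. (w, w') \<in> S \<and> c * (\<integral>x. u1 x * \<kappa> w w' x \<partial>M) + d * (\<integral>x. u2 x * \<kappa> w w' x \<partial>M) \<noteq> 0"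
    if cd: "c \<noteq> 0 \<or> d \<noteq> 0" for c d
  proof (rule ccontr)
    assume nex: "\<not> ?thesis"
    define v where "v x = c * u1 x + d * u2 x" for x
    have vL: "v \<in> L2 M" unfolding v_def by (intro L2_add L2_cmult u)
    have orth: "(\<integral>x. cnj (w' x) * v x \<partial>M) = z * (\<integral>x. cnj (w x) * v x \<partial>M)" if ww: "(w, w') \<in> S" for w w'
    proof -
      have "c * (\<integral>x. u1 x * \<kappa> w w' x \<partial>M) + d * (\<integral>x. u2 x * \<kappa> w w' x \<partial>M) = 0" using nex ww by blast
      moreover have "c * (\<integral>x. u1 x * \<kappa> w w' x \<partial>M) + d * (\<integral>x. u2 x * \<kappa> w w' x \<partial>M) = (\<integral>x. c * (u1 x * \<kappa> w w' x) + d * (u2 x * \<kappa> w w' x) \<partial>M)"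
        using L2_mult_integrable[OF u(1) \<kappa>L[OF ww]] L2_mult_integrable[OF u(2) \<kappa>L[OF ww]] by simp
      moreover have "\<dots> = (\<integral>x. cnj (w' x) * v x - z * (cnj (w x) * v x) \<partial>M)"
        by (rule Bochner_Integration.integral_cong[OF refl]) (simp add: \<kappa>_def v_def algebra_simps)
      moreover have "\<dots> = (\<integral>x. cnj (w' x) * v x \<partial>M) - z * (\<integral>x. cnj (w x) * v x \<partial>M)"
        using L2_mult_integrable[OF L2_cnj[OF L2_operatorD(2)[OF S ww]] vL] L2_mult_integrable[OF L2_cnj[OF L2_operatorD(1)[OF S ww]] vL] by simp
      ultimately show ?thesis by simp
    qed
    have "(v, \<lambda>x. z * v x) \<in> L2_adjoint M S"
      unfolding L2_adjoint_def
    proof (clarify, intro conjI vL L2_cmult ballI, clarify)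
      fix f g assume fg: "(f, g) \<in> S"
      have "L2_inner M v g = cnj (L2_inner M g v)" by (rule L2_inner_commute)
      also have "\<dots> = cnj (z * L2_inner M f v)" using orth[OF fg] by (simp add: L2_inner_def)
      also have "\<dots> = cnj z * L2_inner M v f" by (subst L2_inner_commute[of M v f]) simp
      also have "\<dots> = (\<integral>x. cnj z * (cnj (v x) * f x) \<partial>M)" unfolding L2_inner_def by simp
      finally show "L2_inner M v g = L2_inner M (\<lambda>x. z * v x) f" by (simp add: L2_inner_def mult.assoc)
    qed
    then have "(v, \<lambda>x. z * v x) \<in> S" using sa by (simp add: L2_self_adjoint_def)
    \<comment> \<open>The graph of the resolvent would relate 0 to \<open>v\<close>; as part of
      \<open>L2_operator\<close> it is single-valued up to null sets, which forces \<open>v\<close>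
      to vanish.\<close>
    then have "(\<lambda>x. z * v x - z * v x, v) \<in> resolvent S z" unfolding resolvent_def by (intro CollectI exI conjI) (rule refl)
    then have "(\<lambda>x. 0, v) \<in> resolvent S z" by simp
    from L2_operatorD(7)[OF R this L2_operatorD(3)[OF R]] have "AE x in M. v x = 0" by simp
    then show False using indep[of c d] cd by (simp add: v_def)
  qed
  define l1 where "l1 w w' = (\<integral>x. u1 x * \<kappa> w w' x \<partial>M)" for w w'
  define l2 where "l2 w w' = (\<integral>x. u2 x * \<kappa> w w' x \<partial>M)" for w w'
  obtain wa wa' where a: "(wa, wa') \<in> S" "l1 wa wa' \<noteq> 0" using nondeg[of 1 0] by (auto simp: l1_def)
  \<comment> \<open>Nondegeneracy for the coefficients \<open>- l2 wa wa'\<close> and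
    \<open>l1 wa wa'\<close> yields a second element of \<open>S\<close> whose determinant with the
    first, \<Delta>, is nonzero.\<close>
  have "- l2 wa wa' \<noteq> 0 \<or> l1 wa wa' \<noteq> 0" using a by simp
  from nondeg[OF this] obtain wb wb' where b: "(wb, wb') \<in> S" "- l2 wa wa' * l1 wb wb' + l1 wa wa' * l2 wb wb' \<noteq> 0"
    by (auto simp: l1_def l2_def)
  define \<Delta> where "\<Delta> = l1 wa wa' * l2 wb wb' - l2 wa wa' * l1 wb wb'"
  have \<Delta>: "\<Delta> \<noteq> 0" using b(2) by (simp add: \<Delta>_def algebra_simps)
  define s where "s = (e1 * l2 wb wb' - e2 * l1 wb wb') / \<Delta>"
  define t where "t = (e2 * l1 wa wa' - e1 * l2 wa wa') / \<Delta>"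
  \<comment> \<open>\<open>s\<close> and \<open>t\<close> solve the 2 by 2 system by Cramer's rule;
    they enter conjugated because \<kappa> is conjugate-linear in the pair of functions.\<close>
  define w where "w x = cnj s * wa x + cnj t * wb x" for x
  define w' where "w' x = cnj s * wa' x + cnj t * wb' x" for x
  have wS: "(w, w') \<in> S"
    unfolding w_def w'_def by (rule L2_operatorD(4)[OF S L2_operatorD(5)[OF S a(1)] L2_operatorD(5)[OF S b(1)]])
  have \<kappa>w: "\<kappa> w w' x = s * \<kappa> wa wa' x + t * \<kappa> wb wb' x" for x by (simp add: \<kappa>_def w_def w'_def algebra_simps)
  have lin: "(\<integral>x. u x * \<kappa> w w' x \<partial>M) = s * (\<integral>x. u x * \<kappa> wa wa' x \<partial>M) + t * (\<integral>x. u x * \<kappa> wb wb' x \<partial>M)" if "u \<in> L2 M" for u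
  proof -
    have "(\<integral>x. u x * \<kappa> w w' x \<partial>M) = (\<integral>x. s * (u x * \<kappa> wa wa' x) + t * (u x * \<kappa> wb wb' x) \<partial>M)"
      unfolding \<kappa>w by (rule Bochner_Integration.integral_cong[OF refl]) (simp add: algebra_simps)
    then show ?thesis
      using L2_mult_integrable[OF that \<kappa>L[OF a(1)]] L2_mult_integrable[OF that \<kappa>L[OF b(1)]] by simp
  qed
  have "l1 w w' = s * l1 wa wa' + t * l1 wb wb'" unfolding l1_def by (rule lin[OF u(1)])
  also have "\<dots> = (e1 * \<Delta>) / \<Delta>"
    unfolding s_def t_def times_divide_eq_left add_divide_distrib[symmetric] by (simp add: \<Delta>_def algebra_simps)
  also have "\<dots> = e1" using \<Delta> by simp
  finally have 1: "l1 w w' = e1" .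
  have "l2 w w' = s * l2 wa wa' + t * l2 wb wb'" unfolding l2_def by (rule lin[OF u(2)])
  also have "\<dots> = (e2 * \<Delta>) / \<Delta>"
    unfolding s_def t_def times_divide_eq_left add_divide_distrib[symmetric] by (simp add: \<Delta>_def algebra_simps)
  also have "\<dots> = e2" using \<Delta> by simp
  finally have 2: "l2 w w' = e2" .
  show ?thesis
    by (rule exI[of _ w], rule exI[of _ w']) (use wS 1 2 in \<open>simp add: l1_def l2_def \<kappa>_def\<close>)
qed

context sturm_liouville
begin

text \<open>The constants come from \<open>particular_pairing\<close>: if \<open>\<integral> u\<^sub>j k\<^sub>i dM = \<delta>\<^sub>i\<^sub>j\<close> and \<open>particular u1 u2 k\<^sub>i C\<^sub>i D\<^sub>i\<close> is the
  conjugate of the resolvent at \<open>cnj z\<close> applied to \<open>cnj k\<^sub>i\<close>, then \<open>R\<^sub>z g = particular u1 u2 g A B\<close> with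
  \<open>A = C\<^sub>1 \<integral> u1 g dM + (D\<^sub>1 - 1) \<integral> u2 g dM\<close> and \<open>B = (1 + C\<^sub>2) \<integral> u1 g dM + D\<^sub>2 \<integral> u2 g dM\<close>.\<close>

definition kernel :: "(real \<Rightarrow> complex) \<Rightarrow> (real \<Rightarrow> complex) \<Rightarrow> complex \<Rightarrow> complex \<Rightarrow> complex \<Rightarrow> complex \<Rightarrow> real \<Rightarrow> real \<Rightarrow> complex" where
  "kernel u1 u2 C1 D1 C2 D2 x y = of_bool (y \<le> x) * (u1 x * u2 y - u2 x * u1 y)
     + C1 * (u1 x * u1 y) + (D1 - 1) * (u1 x * u2 y) + (1 + C2) * (u2 x * u1 y) + D2 * (u2 x * u2 y)"

section \<open>The kernel and its action\<close>

lemma kernel_L2: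
  assumes u: "u1 \<in> L2 M" "u2 \<in> L2 M"
  shows "(\<lambda>(x, y). kernel u1 u2 C1 D1 C2 D2 x y) \<in> L2 (M \<Otimes>\<^sub>M M)"
proof -
  have [measurable]: "(\<lambda>p. fst p :: real) \<in> borel_measurable (M \<Otimes>\<^sub>M M)" "(\<lambda>p. snd p :: real) \<in> borel_measurable (M \<Otimes>\<^sub>M M)"
    by (rule measurable_compose[OF measurable_fst borel_M] measurable_compose[OF measurable_snd borel_M])+
  note t = L2_tensor[OF sigma_finite_M]
  have P: "Measurable.pred (M \<Otimes>\<^sub>M M) (\<lambda>p. snd p \<le> fst p)" by measurable
  have d: "(\<lambda>p. u1 (fst p) * u2 (snd p) - u2 (fst p) * u1 (snd p)) \<in> L2 (M \<Otimes>\<^sub>M M)"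
    using L2_add[OF t[OF u] L2_cmult[OF t[OF u(2,1)], of "-1"]] by simp
  have "(\<lambda>p. kernel u1 u2 C1 D1 C2 D2 (fst p) (snd p)) \<in> L2 (M \<Otimes>\<^sub>M M)"
    unfolding kernel_def by (intro L2_add L2_cmult L2_of_bool_mult P d t u)
  then show ?thesis by (simp add: case_prod_unfold)
qed

lemma kernel_integral:
  assumes u: "u1 \<in> L2 M" "u2 \<in> L2 M" and g: "g \<in> L2 M"
  shows "integrable M (\<lambda>y. kernel u1 u2 C1 D1 C2 D2 x y * g y)"
    and "(\<integral>y. kernel u1 u2 C1 D1 C2 D2 x y * g y \<partial>M) = particular u1 u2 g
      (C1 * (\<integral>y. u1 y * g y \<partial>M) + (D1 - 1) * (\<integral>y. u2 y * g y \<partial>M))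
      ((1 + C2) * (\<integral>y. u1 y * g y \<partial>M) + D2 * (\<integral>y. u2 y * g y \<partial>M)) x"
proof -
  have i: "integrable M (\<lambda>y. u1 y * g y)" "integrable M (\<lambda>y. u2 y * g y)"
    using u g by (auto intro: L2_mult_integrable)
  note pi = indicator_mult_integrable[OF i(1), of x] indicator_mult_integrable[OF i(2), of x]
  have eq: "kernel u1 u2 C1 D1 C2 D2 x y * g y = u1 x * (indicator {..x} y * (u2 y * g y)) - u2 x * (indicator {..x} y * (u1 y * g y))
     + (C1 * u1 x + (1 + C2) * u2 x) * (u1 y * g y) + ((D1 - 1) * u1 x + D2 * u2 x) * (u2 y * g y)" for y
    by (simp add: kernel_def indicator_def algebra_simps)
  show "integrable M (\<lambda>y. kernel u1 u2 C1 D1 C2 D2 x y * g y)"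
    unfolding eq using pi i by simp
  have "(\<integral>y. kernel u1 u2 C1 D1 C2 D2 x y * g y \<partial>M) = u1 x * primitive (\<lambda>y. u2 y * g y) x - u2 x * primitive (\<lambda>y. u1 y * g y) x
     + (C1 * u1 x + (1 + C2) * u2 x) * (\<integral>y. u1 y * g y \<partial>M) + ((D1 - 1) * u1 x + D2 * u2 x) * (\<integral>y. u2 y * g y \<partial>M)"
    unfolding eq primitive_def using pi i by simp
  then show "(\<integral>y. kernel u1 u2 C1 D1 C2 D2 x y * g y \<partial>M) = particular u1 u2 g
      (C1 * (\<integral>y. u1 y * g y \<partial>M) + (D1 - 1) * (\<integral>y. u2 y * g y \<partial>M))
      ((1 + C2) * (\<integral>y. u1 y * g y \<partial>M) + D2 * (\<integral>y. u2 y * g y \<partial>M)) x"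
    by (simp add: particular_def algebra_simps)
qed

text \<open>The second conclusion demands more than agreement with the resolvent almost everywhere:
  the integral equals the locally absolutely continuous representative at every point of
  \<open>I\<close>.\<close>

lemma resolvent_kernel:
  assumes sa: "L2_self_adjoint M S" and sub: "S \<subseteq> T_max a b p q r s" and z: "z \<in> resolvent_set M S"
    and u1: "sl_pair z u1 v1 (\<lambda>_. 0)" "u1 \<in> L2 M" and u2: "sl_pair z u2 v2 (\<lambda>_. 0)" "u2 \<in> L2 M"
    and W: "\<And>x. x \<in> I \<Longrightarrow> u1 x * v2 x - v1 x * u2 x = 1"
  obtains C1 D1 C2 D2 where "\<forall>g\<in>L2 M.
      (g, \<lambda>x. \<integral>y. kernel u1 u2 C1 D1 C2 D2 x y * g y \<partial>M) \<in> resolvent S z \<and>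
      (\<lambda>x. \<integral>y. kernel u1 u2 C1 D1 C2 D2 x y * g y \<partial>M) \<in> tau_domain a b p s"
proof -
  have S: "L2_operator M S" using sa by (simp add: L2_self_adjoint_def)
  have R: "L2_operator M (resolvent S z)" and dom: "Domain (resolvent S z) = L2 M"
    using z by (simp_all add: resolvent_set_def L2_bounded_operator_def)
  have repr: "\<exists>A B. \<forall>x\<in>I. h x = particular u1 u2 g A B x" if "sl_pair z h h1 g" "g \<in> L2 M" for h h1 g
    unfolding particular_def by (rule variation_of_constants[OF u1 u2 W that])
  define \<kappa> where "\<kappa> w w' x = cnj (w' x) - z * cnj (w x)" for w w' :: "real \<Rightarrow> complex" and x
  have \<kappa>L: "\<kappa> w w' \<in> L2 M" if "(w, w') \<in> S" for w w'
    using L2_add[OF L2_cnj[OF L2_operatorD(2)[OF S that]] L2_cmult[OF L2_cnj[OF L2_operatorD(1)[OF S that]], of "-z"]]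
    by (simp add: \<kappa>_def[abs_def])
  \<comment> \<open>Since \<open>w' - cnj z * w\<close> is the conjugate of
    \<open>\<kappa> w w'\<close>, the conjugate of \<open>w\<close> solves the equation for
    \<open>z\<close> with right-hand side \<open>\<kappa> w w'\<close>. Variation of constants
    therefore gives it constants \<open>C\<close> and \<open>D\<close> of its own.\<close>
  have dual: "\<exists>w w' C D. (w, w') \<in> S \<and> (\<integral>x. u1 x * \<kappa> w w' x \<partial>M) = e1 \<and> (\<integral>x. u2 x * \<kappa> w w' x \<partial>M) = e2
      \<and> (AE x in M. cnj (w x) = particular u1 u2 (\<kappa> w w') C D x)" for e1 e2
  proof -
    obtain w w' where w: "(w, w') \<in> S" "(\<integral>x. u1 x * (cnj (w' x) - z * cnj (w x)) \<partial>M) = e1"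
      "(\<integral>x. u2 x * (cnj (w' x) - z * cnj (w x)) \<partial>M) = e2"
      using resolvent_dual_pair[OF sa z u1(2) u2(2) fundamental_system_independent[OF u1(1) u2(1) W]] by blast
    obtain h h1 where h: "AE x in M. w x = h x" "sl_pair (cnj z) h h1 (\<lambda>x. w' x - cnj z * w x)"
      using T_max_imp_sl_pair[OF subsetD[OF sub w(1)]] by blast
    have "sl_pair z (\<lambda>x. cnj (h x)) (\<lambda>x. cnj (h1 x)) (\<kappa> w w')"
      using sl_pair_cnj[OF h(2)] by (simp add: \<kappa>_def[abs_def])
    from repr[OF this \<kappa>L[OF w(1)]] obtain C D where CD: "\<forall>x\<in>I. cnj (h x) = particular u1 u2 (\<kappa> w w') C D x" by blast
    have "AE x in M. cnj (w x) = particular u1 u2 (\<kappa> w w') C D x"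
      using h(1) AE_space[of M]
    proof eventually_elim
      fix x assume "w x = h x" "x \<in> space M"
      then show "cnj (w x) = particular u1 u2 (\<kappa> w w') C D x" using CD by simp
    qed
    then show ?thesis using w by (intro exI[of _ w] exI[of _ w'] exI[of _ C] exI[of _ D]) (simp add: \<kappa>_def)
  qed
  obtain wa wa' C1 D1 where a: "(wa, wa') \<in> S" "(\<integral>x. u1 x * \<kappa> wa wa' x \<partial>M) = 1" "(\<integral>x. u2 x * \<kappa> wa wa' x \<partial>M) = 0"
      "AE x in M. cnj (wa x) = particular u1 u2 (\<kappa> wa wa') C1 D1 x" using dual[of 1 0] by blast
  obtain wb wb' C2 D2 where b: "(wb, wb') \<in> S" "(\<integral>x. u1 x * \<kappa> wb wb' x \<partial>M) = 0" "(\<integral>x. u2 x * \<kappa> wb wb' x \<partial>M) = 1"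
      "AE x in M. cnj (wb x) = particular u1 u2 (\<kappa> wb wb') C2 D2 x" using dual[of 0 1] by blast
  show thesis
  proof (rule that[of C1 D1 C2 D2], rule ballI)
    fix g assume g: "g \<in> L2 M"
    then obtain f where "(g, f) \<in> resolvent S z" using dom by blast
    then obtain k where k: "(f, k) \<in> S" "g = (\<lambda>x. k x - z * f x)" by (auto simp: resolvent_def)
    obtain h h1 where h: "h \<in> tau_domain a b p s" "AE x in M. f x = h x" "sl_pair z h h1 (\<lambda>x. k x - z * f x)"
      using T_max_imp_sl_pair[OF subsetD[OF sub k(1)]] by blast
    have "sl_pair z h h1 g" using h(3) k(2) by simp
    from repr[OF this g] obtain A B where AB: "\<And>x. x \<in> I \<Longrightarrow> h x = particular u1 u2 g A B x" by blast
    have fL: "f \<in> L2 M" "k \<in> L2 M" using L2_operatorD(1,2)[OF S k(1)] .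
    have hm: "h \<in> borel_measurable M" by (rule tau_domain_measurable[OF h(1)])
    have pm: "particular u1 u2 g A B \<in> borel_measurable M"
      by (rule measurable_cong[THEN iffD1, OF _ hm]) (simp add: AB)
    \<comment> \<open>Symmetry of \<open>S\<close> replaces the pairing of \<open>cnj w'\<close>
      with \<open>f\<close> by that of \<open>cnj w\<close> with \<open>k\<close>. Hence \<kappa>
      paired with \<open>f\<close> is \<open>cnj w\<close> paired with \<open>k - z * f\<close>,
      that is, with \<open>g\<close>.\<close>
    have pair: "(\<integral>x. \<kappa> w w' x * particular u1 u2 g A B x \<partial>M) = (\<integral>x. particular u1 u2 (\<kappa> w w') C D x * g x \<partial>M)"
      if w: "(w, w') \<in> S" "AE x in M. cnj (w x) = particular u1 u2 (\<kappa> w w') C D x" for w w' C D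
    proof -
      have wL: "w \<in> L2 M" "w' \<in> L2 M" using L2_operatorD(1,2)[OF S w(1)] .
      have int: "integrable M (\<lambda>x. cnj (w x) * f x)" "integrable M (\<lambda>x. cnj (w x) * k x)" "integrable M (\<lambda>x. cnj (w' x) * f x)"
        using wL fL by (auto intro: L2_mult_integrable L2_cnj)
      have fp: "AE x in M. f x = particular u1 u2 g A B x"
        using h(2) AE_space[of M] by eventually_elim (simp add: AB)
      have "(\<integral>x. \<kappa> w w' x * particular u1 u2 g A B x \<partial>M) = (\<integral>x. \<kappa> w w' x * f x \<partial>M)"
      proof (rule integral_cong_AE)
        show "AE x in M. \<kappa> w w' x * particular u1 u2 g A B x = \<kappa> w w' x * f x" using fp by eventually_elim simp
        show "(\<lambda>x. \<kappa> w w' x * particular u1 u2 g A B x) \<in> borel_measurable M" "(\<lambda>x. \<kappa> w w' x * f x) \<in> borel_measurable M"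
          using \<kappa>L[OF w(1)] pm fL by (auto simp: L2_def)
      qed
      also have "\<dots> = (\<integral>x. cnj (w' x) * f x - z * (cnj (w x) * f x) \<partial>M)"
        by (rule Bochner_Integration.integral_cong[OF refl]) (simp add: \<kappa>_def algebra_simps)
      also have "\<dots> = (\<integral>x. cnj (w x) * k x \<partial>M) - z * (\<integral>x. cnj (w x) * f x \<partial>M)"
        using int L2_self_adjoint_symmetric[OF sa w(1) k(1)] by simp
      also have "\<dots> = (\<integral>x. cnj (w x) * k x - z * (cnj (w x) * f x) \<partial>M)" using int by simp
      also have "\<dots> = (\<integral>x. cnj (w x) * g x \<partial>M)"
        by (rule Bochner_Integration.integral_cong[OF refl]) (simp add: k(2) algebra_simps)
      \<comment> \<open>\<open>C\<close> and \<open>D\<close> are tied to \<open>w\<close> only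
        almost everywhere, so measurability is taken from constants \<open>C'\<close> and
        \<open>D'\<close> that represent a domain element at every point of \<open>I\<close>; the
        two expressions differ by a combination of \<open>u1\<close> and \<open>u2\<close>.\<close>
      also have "\<dots> = (\<integral>x. particular u1 u2 (\<kappa> w w') C D x * g x \<partial>M)"
      proof -
        obtain h' h1' where h': "h' \<in> tau_domain a b p s" "AE x in M. w x = h' x" "sl_pair (cnj z) h' h1' (\<lambda>x. w' x - cnj z * w x)"
          using T_max_imp_sl_pair[OF subsetD[OF sub w(1)]] by blast
        have sp: "sl_pair z (\<lambda>x. cnj (h' x)) (\<lambda>x. cnj (h1' x)) (\<kappa> w w')"
          using sl_pair_cnj[OF h'(3)] by (simp add: \<kappa>_def[abs_def])
        then obtain C' D' where CD': "\<And>x. x \<in> I \<Longrightarrow> cnj (h' x) = particular u1 u2 (\<kappa> w w') C' D' x"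
          using repr[OF sp \<kappa>L[OF w(1)]] by blast
        have um: "u1 \<in> borel_measurable M" "u2 \<in> borel_measurable M" using u1(2) u2(2) by (simp_all add: L2_def)
        have "(\<lambda>x. cnj (h' x)) \<in> borel_measurable M"
          using sp AC_loc_measurable by (simp add: sl_pair_def)
        then have "particular u1 u2 (\<kappa> w w') C' D' \<in> borel_measurable M"
          by (rule measurable_cong[THEN iffD1, rotated]) (simp add: CD')
        then have "(\<lambda>x. particular u1 u2 (\<kappa> w w') C' D' x + ((C - C') * u1 x + (D - D') * u2 x)) \<in> borel_measurable M"
          using um by simp
        moreover have "particular u1 u2 (\<kappa> w w') C' D' x + ((C - C') * u1 x + (D - D') * u2 x) = particular u1 u2 (\<kappa> w w') C D x" for x
          by (simp add: particular_def algebra_simps)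
        ultimately have m: "particular u1 u2 (\<kappa> w w') C D \<in> borel_measurable M" by simp
        show ?thesis
        proof (rule integral_cong_AE)
          show "AE x in M. cnj (w x) * g x = particular u1 u2 (\<kappa> w w') C D x * g x" using w(2) by eventually_elim simp
          show "(\<lambda>x. cnj (w x) * g x) \<in> borel_measurable M" "(\<lambda>x. particular u1 u2 (\<kappa> w w') C D x * g x) \<in> borel_measurable M"
            using m L2_cnj[OF wL(1)] g by (auto simp: L2_def)
        qed
      qed
      finally show ?thesis .
    qed
    \<comment> \<open>The pairings 1 and 0 with \<open>u1\<close> and \<open>u2\<close> isolate
      \<open>A\<close>. The product terms of \<open>particular_pairing\<close> contribute the
      \<open>- 1\<close> next to \<open>D1\<close> here and, with pairings 0 and 1, the
      \<open>1\<close> next to \<open>C2\<close> below.\<close>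
    have A: "A = C1 * (\<integral>y. u1 y * g y \<partial>M) + (D1 - 1) * (\<integral>y. u2 y * g y \<partial>M)"
      using particular_pairing[OF u1(2) u2(2) g \<kappa>L[OF a(1)] pair[OF a(1,4)]] unfolding a(2,3) by (simp add: algebra_simps)
    have B: "B = (1 + C2) * (\<integral>y. u1 y * g y \<partial>M) + D2 * (\<integral>y. u2 y * g y \<partial>M)"
      using particular_pairing[OF u1(2) u2(2) g \<kappa>L[OF b(1)] pair[OF b(1,4)]] unfolding b(2,3) by (simp add: algebra_simps)
    define F where "F x = (\<integral>y. kernel u1 u2 C1 D1 C2 D2 x y * g y \<partial>M)" for x
    have Fh: "F x = h x" if "x \<in> I" for x
      unfolding F_def kernel_integral(2)[OF u1(2) u2(2) g] A[symmetric] B[symmetric] using AB[OF that] by simp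
    have "F \<in> tau_domain a b p s" by (rule tau_domain_cong[OF h(1) Fh])
    moreover have "(g, F) \<in> resolvent S z"
    proof -
      have Fm: "F \<in> borel_measurable M" by (rule tau_domain_measurable) fact
      have fF: "AE x in M. f x = F x" using h(2) AE_space[of M] by eventually_elim (simp add: Fh)
      have FL: "F \<in> L2 M"
        by (rule L2_cong_AE[OF fL(1) Fm]) (use fF in eventually_elim, simp)
      have "(F, \<lambda>x. g x + z * F x) \<in> S"
      proof (rule L2_operatorD(6)[OF S k(1) FL L2_add[OF g L2_cmult[OF FL]] fF])
        show "AE x in M. k x = g x + z * F x" using fF by eventually_elim (simp add: k(2))
      qed
      then have "(\<lambda>x. (g x + z * F x) - z * F x, F) \<in> resolvent S z"
        unfolding resolvent_def by (intro CollectI exI conjI) (rule refl)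
      then show ?thesis by simp
    qed
    ultimately show "(g, \<lambda>x. \<integral>y. kernel u1 u2 C1 D1 C2 D2 x y * g y \<partial>M) \<in> resolvent S z \<and>
      (\<lambda>x. \<integral>y. kernel u1 u2 C1 D1 C2 D2 x y * g y \<partial>M) \<in> tau_domain a b p s"
      unfolding F_def by blast
  qed
qed

text \<open>Variation of constants with right-hand side 0, where both primitives vanish.\<close>

lemma solution_in_span:
  assumes u1: "sl_pair z u1 v1 (\<lambda>_. 0)" "u1 \<in> L2 M" and u2: "sl_pair z u2 v2 (\<lambda>_. 0)" "u2 \<in> L2 M"
    and W: "\<And>x. x \<in> I \<Longrightarrow> u1 x * v2 x - v1 x * u2 x = 1"
    and U: "tau_solution a b p q r s z U"
  shows "\<exists>A B. \<forall>x\<in>I. U x = A * u1 x + B * u2 x"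
proof -
  have "AE x in lebesgue_on I. tau a b p q r s U x - z * U x = 0" using U by (simp add: tau_solution_def)
  then have "AE x in lebesgue_on I. tau a b p q r s U x = z * U x + (\<lambda>_. 0) x" by eventually_elim simp
  then have "sl_pair z U (quasi_deriv a b p s U) (\<lambda>_. 0)"
    using U by (intro tau_domain_imp_sl_pair) (simp_all add: tau_solution_def)
  from variation_of_constants[OF u1 u2 W this zero_L2]
  show ?thesis by (simp add: primitive_def)
qed

text \<open>On each side of the diagonal the kernel is a bilinear form in the values of
  \<open>u1\<close> and \<open>u2\<close>; inverting the change of basis rewrites both forms in the
  given solutions.\<close>

lemma kernel_in_basis:
  assumes U1: "\<And>x. x \<in> I \<Longrightarrow> U 1 x = A1 * u1 x + B1 * u2 x"
    and U2: "\<And>x. x \<in> I \<Longrightarrow> U 2 x = A2 * u1 x + B2 * u2 x"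
    and indep: "lin_indep2_on I (U 1) (U 2)"
  shows "\<exists>mp mm :: nat \<Rightarrow> nat \<Rightarrow> complex. \<forall>x\<in>I. \<forall>y\<in>I.
     (y \<le> x \<longrightarrow> kernel u1 u2 C1 D1 C2 D2 x y = (\<Sum>i\<in>{1,2}. \<Sum>j\<in>{1,2}. mp i j * U i x * U j y)) \<and>
     (x \<le> y \<longrightarrow> kernel u1 u2 C1 D1 C2 D2 x y = (\<Sum>i\<in>{1,2}. \<Sum>j\<in>{1,2}. mm i j * U i x * U j y))"
proof -
  have ind: "c = 0 \<and> d = 0" if "\<And>x. x \<in> I \<Longrightarrow> c * U 1 x + d * U 2 x = 0" for c d
    using indep that unfolding lin_indep2_on_def by blast
  define \<Delta> where "\<Delta> = A1 * B2 - A2 * B1"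
  have "\<Delta> \<noteq> 0"
  proof
    assume 0: "\<Delta> = 0"
    have "B2 = 0 \<and> - B1 = 0"
    proof (rule ind)
      fix x assume x: "x \<in> I"
      have "B2 * U 1 x + - B1 * U 2 x = \<Delta> * u1 x" unfolding U1[OF x] U2[OF x] \<Delta>_def by (simp add: algebra_simps)
      then show "B2 * U 1 x + - B1 * U 2 x = 0" using 0 by simp
    qed
    moreover have "A2 = 0 \<and> - A1 = 0"
    proof (rule ind)
      fix x assume x: "x \<in> I"
      have "A2 * U 1 x + - A1 * U 2 x = - \<Delta> * u2 x" unfolding U1[OF x] U2[OF x] \<Delta>_def by (simp add: algebra_simps)
      then show "A2 * U 1 x + - A1 * U 2 x = 0" using 0 by simp
    qed
    \<comment> \<open>All four entries vanish, so \<open>U 1\<close> is zero on \<open>I\<close> and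
      the coefficients 1 and 0 give a nontrivial relation.\<close>
    ultimately have "(1::complex) = 0 \<and> (0::complex) = 0"
      by (intro ind) (simp add: U1 del: One_nat_def)
    then show False by simp
  qed
  define b11 b12 b21 b22 where b: "b11 = B2 / \<Delta>" "b12 = - B1 / \<Delta>" "b21 = - A2 / \<Delta>" "b22 = A1 / \<Delta>"
  have u1: "u1 x = b11 * U 1 x + b12 * U 2 x" if x: "x \<in> I" for x
  proof -
    have "b11 * U 1 x + b12 * U 2 x = (\<Delta> * u1 x) / \<Delta>"
      unfolding U1[OF x] U2[OF x] b times_divide_eq_left add_divide_distrib[symmetric] by (simp add: \<Delta>_def algebra_simps)
    then show ?thesis using \<open>\<Delta> \<noteq> 0\<close> by simp
  qed
  have u2: "u2 x = b21 * U 1 x + b22 * U 2 x" if x: "x \<in> I" for x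
  proof -
    have "b21 * U 1 x + b22 * U 2 x = (\<Delta> * u2 x) / \<Delta>"
      unfolding U1[OF x] U2[OF x] b times_divide_eq_left add_divide_distrib[symmetric] by (simp add: \<Delta>_def algebra_simps)
    then show ?thesis using \<open>\<Delta> \<noteq> 0\<close> by simp
  qed
  define e1 e2 :: "nat \<Rightarrow> complex" where e: "e1 i = (if i = 1 then b11 else b12)" "e2 i = (if i = 1 then b21 else b22)" for i
  define Q where "Q c11 c12 c21 c22 i j = c11 * e1 i * e1 j + c12 * e1 i * e2 j + c21 * e2 i * e1 j + c22 * e2 i * e2 j" for c11 c12 c21 c22 i j
  have Q: "(\<Sum>i\<in>{1,2}. \<Sum>j\<in>{1,2}. Q c11 c12 c21 c22 i j * U i x * U j y) =
      c11 * (u1 x * u1 y) + c12 * (u1 x * u2 y) + c21 * (u2 x * u1 y) + c22 * (u2 x * u2 y)"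
    if "x \<in> I" "y \<in> I" for c11 c12 c21 c22 x y
    unfolding sum_12 Q_def u1[OF that(1)] u1[OF that(2)] u2[OF that(1)] u2[OF that(2)] by (simp add: e algebra_simps)
  \<comment> \<open>For y \<le> x the triangular term cancels the constants \<open>- 1\<close> and
    \<open>1\<close>, leaving \<open>D1\<close> and \<open>C2\<close>; for larger y they stay. On
    the diagonal the antisymmetric term is 0, so both formulas hold there.\<close>
  show ?thesis
  proof (rule exI[of _ "Q C1 D1 C2 D2"], rule exI[of _ "Q C1 (D1 - 1) (1 + C2) D2"], intro ballI conjI impI)
    fix x y assume xy: "x \<in> I" "y \<in> I"
    show "kernel u1 u2 C1 D1 C2 D2 x y = (\<Sum>i\<in>{1,2}. \<Sum>j\<in>{1,2}. Q C1 D1 C2 D2 i j * U i x * U j y)" if "y \<le> x"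
      unfolding Q[OF xy] kernel_def using that by (simp add: algebra_simps)
    show "kernel u1 u2 C1 D1 C2 D2 x y = (\<Sum>i\<in>{1,2}. \<Sum>j\<in>{1,2}. Q C1 (D1 - 1) (1 + C2) D2 i j * U i x * U j y)" if "x \<le> y"
      unfolding Q[OF xy] kernel_def using that by (cases "x = y") (simp_all add: algebra_simps)
  qed
qed

end

theorem theorem7p1:
  fixes a b :: ereal
    and p q r s :: "real \<Rightarrow> real"
    and S :: "real graph"
    and z :: complex
  defines "I \<equiv> einterval a b"
    and "M \<equiv> weighted a b r"
  assumes "a < b"
    and "p \<in> borel_measurable (lebesgue_on I)"
    and "q \<in> borel_measurable (lebesgue_on I)"
    and "r \<in> borel_measurable (lebesgue_on I)"
    and "s \<in> borel_measurable (lebesgue_on I)"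
    and "locally_integrable a b (\<lambda>x. 1 / p x)"
    and "locally_integrable a b q"
    and "locally_integrable a b r"
    and "locally_integrable a b s"
    and "AE x in lebesgue_on I. r x > 0"
    and "AE x in lebesgue_on I. p x \<noteq> 0"
    and "limit_circle_left a b p q r s"
    and "limit_circle_right a b p q r s"
    and "L2_self_adjoint M S"
    and "S \<subseteq> T_max a b p q r s"
    and "z \<in> resolvent_set M S"
  shows "L2_hilbert_schmidt M (resolvent S z) \<and>
    (\<exists>G :: real \<Rightarrow> real \<Rightarrow> complex.
       (\<lambda>(x, y). G x y) \<in> L2 (M \<Otimes>\<^sub>M M) \<and>
       (\<forall>g\<in>L2 M.
          (g, \<lambda>x. \<integral>y. G x y * g y \<partial>M) \<in> resolvent S z \<and>
          (\<lambda>x. \<integral>y. G x y * g y \<partial>M) \<in> tau_domain a b p s \<and>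
          (\<forall>x\<in>I. integrable M (\<lambda>y. G x y * g y))) \<and>
       (\<forall>u :: nat \<Rightarrow> real \<Rightarrow> complex.
          tau_solution a b p q r s z (u 1) \<longrightarrow>
          tau_solution a b p q r s z (u 2) \<longrightarrow>
          lin_indep2_on I (u 1) (u 2) \<longrightarrow>
          (\<exists>mp mm :: nat \<Rightarrow> nat \<Rightarrow> complex. \<forall>x\<in>I. \<forall>y\<in>I.
             (y \<le> x \<longrightarrow> G x y = (\<Sum>i\<in>{1,2}. \<Sum>j\<in>{1,2}. mp i j * u i x * u j y)) \<and>
             (x \<le> y \<longrightarrow> G x y = (\<Sum>i\<in>{1,2}. \<Sum>j\<in>{1,2}. mm i j * u i x * u j y)))))"
proof -
  interpret sturm_liouville a b p q r s
    by (rule sturm_liouville.intro; rule assms(3-13)[unfolded I_def])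
  have sa: "L2_self_adjoint (weighted a b r) S" and z: "z \<in> resolvent_set (weighted a b r) S"
    using assms by (simp_all add: M_def)
  have sub: "S \<subseteq> T_max a b p q r s" by fact
  obtain u1 v1 u2 v2 where u1: "sl_pair z u1 v1 (\<lambda>_. 0)" and u2: "sl_pair z u2 v2 (\<lambda>_. 0)"
    and W: "\<And>x. x \<in> einterval a b \<Longrightarrow> u1 x * v2 x - v1 x * u2 x = 1"
    by (rule fundamental_system[of z]) blast
  have u1L: "u1 \<in> L2 (weighted a b r)" and u2L: "u2 \<in> L2 (weighted a b r)"
    by (rule limit_circle_imp_L2[OF \<open>limit_circle_left a b p q r s\<close> \<open>limit_circle_right a b p q r s\<close> sl_pair_imp_tau_solution], fact)+
  obtain C1 D1 C2 D2 where K: "\<forall>g\<in>L2 (weighted a b r).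
      (g, \<lambda>x. \<integral>y. kernel u1 u2 C1 D1 C2 D2 x y * g y \<partial>weighted a b r) \<in> resolvent S z \<and>
      (\<lambda>x. \<integral>y. kernel u1 u2 C1 D1 C2 D2 x y * g y \<partial>weighted a b r) \<in> tau_domain a b p s"
    by (rule resolvent_kernel[OF sa sub z u1 u1L u2 u2L W]) blast
  \<comment> \<open>The kernel is built from one fundamental system before any pair
    \<open>u 1\<close>, \<open>u 2\<close> is given, so a single \<open>G\<close> serves all
    pairs.\<close>
  show ?thesis
  proof (intro conjI exI[of _ "kernel u1 u2 C1 D1 C2 D2"] ballI allI impI)
    show "L2_hilbert_schmidt M (resolvent S z)"
      unfolding M_def
    proof (rule L2_kernel_imp_hilbert_schmidt[OF sigma_finite_M _ kernel_L2[OF u1L u2L]])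
      show "L2_bounded_operator (weighted a b r) (resolvent S z)" using z by (simp add: resolvent_set_def)
    qed (use K in blast)
    show "(\<lambda>(x, y). kernel u1 u2 C1 D1 C2 D2 x y) \<in> L2 (M \<Otimes>\<^sub>M M)"
      unfolding M_def by (rule kernel_L2[OF u1L u2L])
    fix g assume g: "g \<in> L2 M"
    show "(g, \<lambda>x. \<integral>y. kernel u1 u2 C1 D1 C2 D2 x y * g y \<partial>M) \<in> resolvent S z"
      "(\<lambda>x. \<integral>y. kernel u1 u2 C1 D1 C2 D2 x y * g y \<partial>M) \<in> tau_domain a b p s"
      using K g unfolding M_def by simp_all
    show "integrable M (\<lambda>y. kernel u1 u2 C1 D1 C2 D2 x y * g y)" for x
      using kernel_integral(1)[OF u1L u2L] g unfolding M_def .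
  next
    fix u :: "nat \<Rightarrow> real \<Rightarrow> complex"
    assume U: "tau_solution a b p q r s z (u 1)" "tau_solution a b p q r s z (u 2)" and indep: "lin_indep2_on I (u 1) (u 2)"
    obtain A1 B1 where U1: "\<And>x. x \<in> einterval a b \<Longrightarrow> u 1 x = A1 * u1 x + B1 * u2 x"
      using solution_in_span[OF u1 u1L u2 u2L W U(1)] by blast
    obtain A2 B2 where U2: "\<And>x. x \<in> einterval a b \<Longrightarrow> u 2 x = A2 * u1 x + B2 * u2 x"
      using solution_in_span[OF u1 u1L u2 u2L W U(2)] by blast
    show "\<exists>mp mm :: nat \<Rightarrow> nat \<Rightarrow> complex. \<forall>x\<in>I. \<forall>y\<in>I.
       (y \<le> x \<longrightarrow> kernel u1 u2 C1 D1 C2 D2 x y = (\<Sum>i\<in>{1,2}. \<Sum>j\<in>{1,2}. mp i j * u i x * u j y)) \<and>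
       (x \<le> y \<longrightarrow> kernel u1 u2 C1 D1 C2 D2 x y = (\<Sum>i\<in>{1,2}. \<Sum>j\<in>{1,2}. mm i j * u i x * u j y))"
      unfolding I_def
    proof (rule kernel_in_basis)
      show "u 1 x = A1 * u1 x + B1 * u2 x" "u 2 x = A2 * u1 x + B2 * u2 x" if "x \<in> einterval a b" for x
        using U1[OF that] U2[OF that] by simp_all
      show "lin_indep2_on (einterval a b) (u 1) (u 2)" using indep by (simp add: I_def)
    qed
  qed
qed

end
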